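(* Let $X$ be a Peano continuum with more than one point that is not homeomorphic to $S^1$. The following are equivalent: (i) $X$ is Eulerian; (ii) $X$ is edge-wise Eulerian; (iii) $X$ admits an approximating sequence of Eulerian decompositions.
   Context: All spaces are metrizable; fix a metric on $X$. A Peano continuum is a compact, connected, locally connected metrizable space. A free arc (edge) of $X$ is an inclusion-maximal open subset of $X$ homeomorphic to $(0,1)$; $E(X)$ is the set of edges and $\operatorname{Gr}(X)=X\setminus\bigcup E(X)$ is the ground space. (For $X\neq S^1$ edges are pairwise disjoint.) For each edge $e$ fix a continuous map $[0,1]\to\overline{e}$ restricting to a homeomorphism $(0,1)\to e$, and write $e(0),e(1)\in \operatorname{Gr}(X)$ for the images of $0,1$ (the endpoints of $e$). A continuous surjection $g:S^1\to X$ is Eulerian if it is strongly irreducible, i.e. $g(A)\neq X$ for every closed $A\subsetneq S^1$; $X$ is Eulerian if such a map exists. A continuous surjection $g:S^1\to X$ is edge-wise Eulerian if $g^{-1}(x)$ is a singleton for every $x\in\bigcup E(X)$; $X$ is edge-wise Eulerian if such a map exists. A subspace $Y\subseteq X$ is standard if every edge of $X$ that meets $Y$ is contained in $Y$. A decomposition of $X$ is a pair $(G,\eta)$ where $G$ is a finite multigraph (loops and parallel edges allowed) whose edge set is partitioned $E(G)=F\sqcup D$, each edge $x$ of $G$ having ends $x(0),x(1)\in V(G)$, and $\eta$ is a map on $V(G)\cup E(G)$ such that: (E1) $\eta(v)$ is a nonempty standard Peano subcontinuum of $X$ for each $v\in V(G)$; (E2) $\eta(f)\in E(X)$ for $f\in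 F$; (E3) $\eta(d)\subseteq \operatorname{Gr}(X)$ is an arc or a single point for $d\in D$, with chosen endpoints $\eta(d)(0),\eta(d)(1)$; (E4) $\{\eta(x):x\in V(G)\cup F\}$ covers $X$; (E5) no edge of $X$ is contained in $\eta(x)$ and $\eta(y)$ for two distinct $x\ne y\in V(G)\cup F$; (E6) $\eta(f)(j)\in\eta(f(j))$ for all $f\in F$, $j\in\{0,1\}$; (E7) $\eta(d)(j)\in\eta(d(j))$ for all $d\in D$, $j\in\{0,1\}$. Its width is $\max_{v\in V(G)}\operatorname{diam}\eta(v)$. It is an Eulerian decomposition if $G$ is connected and every vertex has even degree. For an edge $e=xy$ of $G$, the contraction $(G,\eta)/e=(G/e,\eta')$: $G/e$ replaces $x,y$ by a new vertex $v_e$ (every other edge formerly incident to $x$ or $y$ now incident to $v_e$) and deletes $e$ (if $e$ is a loop at $x$, $G/e=G-e$ with $v_e=x$); $\eta'(v_e)=\eta(x)\cup\eta(e)\cup\eta(y)$ and $\eta'=\eta$ elsewhere, with the induced partition of edges. Write $\mathcal D_1\preccurlyeq\mathcal D_2$ if $\mathcal D_1$ is obtained (up to renaming) from $\mathcal D_2$ by contracting finitely many edges in sequence. An approximating sequence of Eulerian decompositions is a sequence $(\mathcal D_n)_{n\in\mathbb N}$ of Eulerian decompositions with $\mathcal D_n\preccurlyeq\mathcal D_{n+1}$ for all $n$ and width of $\mathcal D_n$ tending to $0$. *)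

theory Defs
  imports "HOL-Analysis.Analysis"
begin

section \<open>Peano continua, free arcs, ground space\<close>

definition peano_continuum :: "'a::metric_space set \<Rightarrow> bool" where
  "peano_continuum X \<longleftrightarrow> compact X \<and> connected X \<and> locally connected X"

text \<open>A free arc (edge): an inclusion-maximal open subset of X homeomorphic to (0,1).\<close>
definition open_arc_in :: "'a::metric_space set \<Rightarrow> 'a set \<Rightarrow> bool" where
  "open_arc_in X e \<longleftrightarrow> openin (top_of_set X) e \<and> e homeomorphic {0<..<(1::real)}"

definition edges :: "'a::metric_space set \<Rightarrow> 'a set set" where
  "edges X = {e. open_arc_in X e \<and> (\<forall>e'. open_arc_in X e' \<and> e \<subseteq> e' \<longrightarrow> e' = e)}"

definition ground :: "'a::metric_space set \<Rightarrow> 'a set" where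
  "ground X = X - \<Union>(edges X)"

text \<open>A fixed parametrisation of every edge: p e : [0,1] -> closure e continuous,
  restricting to a homeomorphism (0,1) -> e. Endpoints are p e 0 and p e 1.\<close>
definition edge_param :: "'a::metric_space set \<Rightarrow> ('a set \<Rightarrow> real \<Rightarrow> 'a) \<Rightarrow> bool" where
  "edge_param X p \<longleftrightarrow> (\<forall>e\<in>edges X. continuous_on {0..1} (p e) \<and> p e ` {0..1} \<subseteq> closure e
      \<and> (\<exists>q. homeomorphism {0<..<1} e (p e) q))"

definition standard :: "'a::metric_space set \<Rightarrow> 'a set \<Rightarrow> bool" where
  "standard X Y \<longleftrightarrow> (\<forall>e\<in>edges X. e \<inter> Y \<noteq> {} \<longrightarrow> e \<subseteq> Y)"

section \<open>Eulerian maps\<close>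

abbreviation circle :: "complex set" where "circle \<equiv> sphere 0 1"

definition eulerian_map :: "'a::metric_space set \<Rightarrow> (complex \<Rightarrow> 'a) \<Rightarrow> bool" where
  "eulerian_map X g \<longleftrightarrow> continuous_on circle g \<and> g ` circle = X \<and>
     (\<forall>A. closed A \<and> A \<subset> circle \<longrightarrow> g ` A \<noteq> X)"

definition eulerian :: "'a::metric_space set \<Rightarrow> bool" where
  "eulerian X \<longleftrightarrow> (\<exists>g. eulerian_map X g)"

definition edgewise_eulerian_map :: "'a::metric_space set \<Rightarrow> (complex \<Rightarrow> 'a) \<Rightarrow> bool" where
  "edgewise_eulerian_map X g \<longleftrightarrow> continuous_on circle g \<and> g ` circle = X \<and>
     (\<forall>x\<in>\<Union>(edges X). \<exists>!z. z \<in> circle \<and> g z = x)"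

definition edgewise_eulerian :: "'a::metric_space set \<Rightarrow> bool" where
  "edgewise_eulerian X \<longleftrightarrow> (\<exists>g. edgewise_eulerian_map X g)"

section \<open>Decompositions\<close>

text \<open>A decomposition: finite multigraph with vertex labels dV, edge labels dE
  (partitioned into dF and dE - dF = D), ends of each edge (x(0), x(1)),
  and the map eta: dvert on vertices, dfree on F (an edge of X),
  and on D an arc-or-point darc with chosen endpoints darc0, darc1.\<close>
record 'a decomp =
  dV :: "nat set"
  dE :: "nat set"
  dF :: "nat set"
  dends :: "nat \<Rightarrow> nat \<times> nat"
  dvert :: "nat \<Rightarrow> 'a set"
  dfree :: "nat \<Rightarrow> 'a set"
  darc :: "nat \<Rightarrow> 'a set"
  darc0 :: "nat \<Rightarrow> 'a"
  darc1 :: "nat \<Rightarrow> 'a"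

definition arc_or_point :: "'a::metric_space set \<Rightarrow> 'a \<Rightarrow> 'a \<Rightarrow> bool" where
  "arc_or_point S a b \<longleftrightarrow>
     (\<exists>g::real \<Rightarrow> 'a. arc g \<and> path_image g = S \<and> pathstart g = a \<and> pathfinish g = b)
     \<or> (S = {a} \<and> b = a)"

text \<open>eta(x) for an edge x of G\<close>
definition eta_edge :: "('a, 'b) decomp_scheme \<Rightarrow> nat \<Rightarrow> 'a set" where
  "eta_edge D x = (if x \<in> dF D then dfree D x else darc D x)"

definition is_decomp ::
  "'a::metric_space set \<Rightarrow> ('a set \<Rightarrow> real \<Rightarrow> 'a) \<Rightarrow> 'a decomp \<Rightarrow> bool" where
  "is_decomp X p D \<longleftrightarrow>
     finite (dV D) \<and> finite (dE D) \<and> dF D \<subseteq> dE D \<and>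
     (\<forall>x\<in>dE D. fst (dends D x) \<in> dV D \<and> snd (dends D x) \<in> dV D) \<and>
     \<comment> \<open>(E1)\<close>
     (\<forall>v\<in>dV D. dvert D v \<noteq> {} \<and> dvert D v \<subseteq> X \<and> peano_continuum (dvert D v)
                 \<and> standard X (dvert D v)) \<and>
     \<comment> \<open>(E2)\<close>
     (\<forall>f\<in>dF D. dfree D f \<in> edges X) \<and>
     \<comment> \<open>(E3)\<close>
     (\<forall>d\<in>dE D - dF D. darc D d \<subseteq> ground X \<and> arc_or_point (darc D d) (darc0 D d) (darc1 D d)) \<and>
     \<comment> \<open>(E4)\<close>
     X \<subseteq> (\<Union>v\<in>dV D. dvert D v) \<union> (\<Union>f\<in>dF D. dfree D f) \<and>
     \<comment> \<open>(E5): vertices and F-edges are distinct objects even with equal labels\<close>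
     (\<forall>e\<in>edges X.
        (\<forall>v\<in>dV D. \<forall>w\<in>dV D. v \<noteq> w \<longrightarrow> \<not> (e \<subseteq> dvert D v \<and> e \<subseteq> dvert D w)) \<and>
        (\<forall>f\<in>dF D. \<forall>f'\<in>dF D. f \<noteq> f' \<longrightarrow> \<not> (e \<subseteq> dfree D f \<and> e \<subseteq> dfree D f')) \<and>
        (\<forall>v\<in>dV D. \<forall>f\<in>dF D. \<not> (e \<subseteq> dvert D v \<and> e \<subseteq> dfree D f))) \<and>
     \<comment> \<open>(E6)\<close>
     (\<forall>f\<in>dF D. p (dfree D f) 0 \<in> dvert D (fst (dends D f))
               \<and> p (dfree D f) 1 \<in> dvert D (snd (dends D f))) \<and>
     \<comment> \<open>(E7)\<close>
     (\<forall>d\<in>dE D - dF D. darc0 D d \<in> dvert D (fst (dends D d))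
                     \<and> darc1 D d \<in> dvert D (snd (dends D d)))"

definition width :: "'a::metric_space decomp \<Rightarrow> real" where
  "width D = Max ((\<lambda>v. diameter (dvert D v)) ` dV D)"

text \<open>Degree in the multigraph (a loop contributes 2).\<close>
definition degree :: "'a decomp \<Rightarrow> nat \<Rightarrow> nat" where
  "degree D v = card {x\<in>dE D. fst (dends D x) = v} + card {x\<in>dE D. snd (dends D x) = v}"

definition adj :: "'a decomp \<Rightarrow> (nat \<times> nat) set" where
  "adj D = {(a, b). \<exists>x\<in>dE D. dends D x = (a, b) \<or> dends D x = (b, a)}"

definition graph_connected :: "'a decomp \<Rightarrow> bool" where
  "graph_connected D \<longleftrightarrow> dV D \<noteq> {} \<and> (\<forall>u\<in>dV D. \<forall>w\<in>dV D. (u, w) \<in> (adj D)\<^sup>*)"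

definition eulerian_decomp ::
  "'a::metric_space set \<Rightarrow> ('a set \<Rightarrow> real \<Rightarrow> 'a) \<Rightarrow> 'a decomp \<Rightarrow> bool" where
  "eulerian_decomp X p D \<longleftrightarrow> is_decomp X p D \<and> graph_connected D \<and>
     (\<forall>v\<in>dV D. even (degree D v))"

text \<open>Contraction of the edge e = xy: the new vertex v_e reuses the label x
  (labels are only relevant up to renaming), y is removed and redirected to x,
  and e is deleted. For a loop this is just deletion of e.\<close>
definition contract :: "'a decomp \<Rightarrow> nat \<Rightarrow> 'a decomp" where
  "contract D e =
    (let x = fst (dends D e); y = snd (dends D e);
         r = (\<lambda>u. if u = y then x else u)
     in D\<lparr> dV := (dV D - {y}) \<union> {x},
           dE := dE D - {e},
           dF := dF D - {e},
           dends := (\<lambda>z. map_prod r r (dends D z)),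
           dvert := (dvert D)(x := dvert D x \<union> eta_edge D e \<union> dvert D y) \<rparr>)"

inductive contracts_to :: "'a decomp \<Rightarrow> 'a decomp \<Rightarrow> bool" where
  refl: "contracts_to D D"
| step: "contracts_to D D' \<Longrightarrow> e \<in> dE D' \<Longrightarrow> contracts_to D (contract D' e)"

text \<open>Isomorphism (renaming) of decompositions.\<close>
definition decomp_iso :: "'a decomp \<Rightarrow> 'a decomp \<Rightarrow> bool" where
  "decomp_iso D D' \<longleftrightarrow> (\<exists>\<phi> \<psi>. bij_betw \<phi> (dV D) (dV D') \<and> bij_betw \<psi> (dE D) (dE D') \<and>
     (\<forall>v\<in>dV D. dvert D' (\<phi> v) = dvert D v) \<and>
     (\<forall>x\<in>dE D. (x \<in> dF D \<longleftrightarrow> \<psi> x \<in> dF D') \<and>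
        dends D' (\<psi> x) = map_prod \<phi> \<phi> (dends D x) \<and>
        (x \<in> dF D \<longrightarrow> dfree D' (\<psi> x) = dfree D x) \<and>
        (x \<notin> dF D \<longrightarrow> darc D' (\<psi> x) = darc D x \<and> darc0 D' (\<psi> x) = darc0 D x
                      \<and> darc1 D' (\<psi> x) = darc1 D x)))"

text \<open>D1 \<preccurlyeq> D2: D1 is obtained up to renaming from D2 by finitely many contractions.\<close>
definition decomp_le :: "'a decomp \<Rightarrow> 'a decomp \<Rightarrow> bool" where
  "decomp_le D1 D2 \<longleftrightarrow> (\<exists>D. contracts_to D2 D \<and> decomp_iso D D1)"

definition approximating_sequence ::
  "'a::metric_space set \<Rightarrow> ('a set \<Rightarrow> real \<Rightarrow> 'a) \<Rightarrow> (nat \<Rightarrow> 'a decomp) \<Rightarrow> bool" where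
  "approximating_sequence X p Ds \<longleftrightarrow>
     (\<forall>n. eulerian_decomp X p (Ds n)) \<and> (\<forall>n. decomp_le (Ds n) (Ds (Suc n))) \<and>
     (\<lambda>n. width (Ds n)) \<longlonglongrightarrow> 0"

end

theory Submission
  imports Defs
begin

text \<open>
  An irreducible map cannot traverse an edge twice: each of the (at least three) one-sided passes
  through a point of the edge covers one of only two half neighbourhoods, so two passes overlap and
  part of one of them is superfluous. Hence Eulerian maps are edge-wise Eulerian.

  An edge-wise Eulerian loop is cut at finitely many places: at whole edges, or at single points
  with image in the ground space. The images of the remaining closed intervals and the cuts form
  a decomposition whose graph is a cycle, and inserting a cut is inverse to contracting an edge.
  Cutting along a dense sequence of times gives an approximating sequence.

  Conversely, Euler tours of the graphs in an approximating sequence project to each other under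
  contraction, so Koenig's lemma gives a compatible sequence of tours. Assigning to the edges
  time intervals that respect this compatibility, one obtains in the limit a loop that is edge-wise
  Eulerian. A Baire category style argument finally turns a loop whose fibres over edge points are
  intervals into an irreducible one: for every rational interval \<open>{c<..<d}\<close> an arbitrarily small
  perturbation, preserving this class of loops, makes this time interval indispensable.
\<close>

section \<open>Eulerian maps are edge-wise Eulerian\<close>

text \<open>The implications run in a cycle (i), (ii), (iii), (i). The return to (i) cannot stay
  within edge-wise Eulerian loops: a uniform limit of loops that are injective over edges may pause
  at an edge point. Interval fibres survive such limits, and irreducibility follows as soon as every
  rational time interval visits some point that is missed at all other times. The perturbation has
  two regimes. Away from the closure of the edges nothing forbids repeated visits, so all of a small
  region can be revisited within one short time interval. Near edges this is forbidden, since an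
  edge can be traversed only once; there an edge is carried into the time interval by exchanging two
  stretches of the loop with common ends. In the limit of tours the schedule must never be revised:
  a dart keeps its time interval at all finer levels, and every rest has positive length to leave
  room for edges that become visible only later. That open arcs lie in maximal ones rests on
  separability, which excludes arcs as long as the long line.\<close>

lemma loop_imp_circle_map:
  fixes \<gamma> :: "real \<Rightarrow> 'a::topological_space"
  assumes "continuous_on {0..1} \<gamma>" "\<gamma> 0 = \<gamma> 1"
  obtains h where "continuous_on circle h" "\<And>t. t \<in> {0..1} \<Longrightarrow> h (cis (2 * pi * t)) = \<gamma> t"
proof -
  define h where "h = \<gamma> \<circ> (\<lambda>z. Arg2pi z / (2 * pi))"
  \<comment> \<open>\<open>Arg2pi\<close> jumps at 1, so continuity there cannot be read off the
    composition. The trivial homotopy of the loop to itself yields it, because homotopic loops give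
    homotopic, hence continuous, circle maps.\<close>
  have "homotopic_loops (\<gamma> ` {0..1}) \<gamma> \<gamma>"
    using assms by (simp add: homotopic_loops_refl path_def path_image_def pathstart_def pathfinish_def)
  then have "continuous_on circle h"
    unfolding h_def using homotopic_loops_imp_homotopic_circlemaps homotopic_with_imp_continuous by blast
  moreover have "h (cis (2 * pi * t)) = \<gamma> t" if "t \<in> {0..1}" for t
  proof (cases "t = 1")
    case True
    then have "cis (2 * pi * t) = 1"
      by simp
    then show ?thesis
      using True assms Arg2pi_of_real[of 1] by (simp add: h_def)
  next
    case False
    then have "Arg2pi (cis (2 * pi * t)) = 2 * pi * t"
      using that by (intro Arg2pi_unique[of 1]) (auto simp: cis_conv_exp mult_ac)
    then show ?thesis
      by (simp add: h_def)
  qed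
  ultimately show thesis
    using that by blast
qed

lemma circle_eq_cis:
  assumes "z0 \<in> circle" "z \<in> circle"
  obtains t where "t \<in> {0..<1}" "z = z0 * cis (2 * pi * t)"
proof -
  define w where "w = z / z0"
  have "z0 \<noteq> 0" "norm w = 1"
    using assms by (auto simp: w_def norm_divide)
  then have "w = cis (2 * pi * (Arg2pi w / (2 * pi)))"
    using Arg2pi_eq[of w] by (simp add: cis_conv_exp)
  moreover have "Arg2pi w / (2 * pi) \<in> {0..<1}"
    using Arg2pi_ge_0[of w] Arg2pi_lt_2pi[of w] by simp
  ultimately show thesis
    using that \<open>z0 \<noteq> 0\<close> by (metis w_def nonzero_mult_div_cancel_left times_divide_eq_right)
qed

lemma circle_cis_inj:
  assumes "z0 \<in> circle" "z0 * cis (2 * pi * s) = z0 * cis (2 * pi * t)" "s \<in> {0..<1}" "t \<in> {0..<1}"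
  shows "s = t"
proof -
  have "z0 \<noteq> 0" using assms by auto
  then have "exp (\<i> * (2 * pi * s)) = exp (\<i> * (2 * pi * t))"
    using assms by (simp add: cis_conv_exp)
  then have "2 * pi * s = Arg2pi (exp (\<i> * (2 * pi * t)))"
    using assms by (intro Arg2pi_unique[of 1, symmetric]) auto
  also have "\<dots> = 2 * pi * t"
    using assms by (intro Arg2pi_unique[of 1]) auto
  finally show ?thesis by simp
qed

lemma circle_loop:
  assumes "continuous_on circle g" "z0 \<in> circle"
  shows "continuous_on {0..1} (\<lambda>t. g (z0 * cis (2 * pi * t)))"
    and "(\<lambda>t. g (z0 * cis (2 * pi * t))) ` {0..1} = g ` circle"
proof -
  have *: "z0 * cis (2 * pi * t) \<in> circle" for t
    using assms by (simp add: norm_mult)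
  show "continuous_on {0..1} (\<lambda>t. g (z0 * cis (2 * pi * t)))"
    by (rule continuous_on_compose2[OF assms(1)]) (use * in \<open>auto intro!: continuous_intros\<close>)
  have "\<exists>t\<in>{0..1}. z = z0 * cis (2 * pi * t)" if "z \<in> circle" for z
    using circle_eq_cis[OF assms(2) that] by (metis atLeastAtMost_iff atLeastLessThan_iff less_imp_le)
  then show "(\<lambda>t. g (z0 * cis (2 * pi * t))) ` {0..1} = g ` circle"
    using * by (auto simp: image_iff Bex_def) metis
qed

text \<open>Both images are intervals that reach from the common value \<open>f w\<close> strictly
  upwards. A value \<open>\<mu>\<close> below both tops is attained at some \<open>v\<close>, and
  near \<open>v\<close> the values stay between \<open>f w\<close> and the lower top, hence in the
  second image as well. Two passes leaving a point on the same side therefore overlap.\<close>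

lemma image_Icc_overlap:
  fixes f :: "real \<Rightarrow> real"
  assumes f: "continuous_on {a..b} f" "continuous_on {a'..b'} f"
    and u: "u \<in> {a..b}" "w \<in> {a..b}" "f w < f u"
    and u': "u' \<in> {a'..b'}" "w' \<in> {a'..b'}" "f w' < f u'" and eq: "f w' = f w"
  obtains c d where "c < d" "{c..d} \<subseteq> {a..b}" "f ` {c..d} \<subseteq> f ` {a'..b'}"
proof -
  have iv: "connected (f ` {a..b})" "connected (f ` {a'..b'})"
    using f by (auto intro!: connected_continuous_image)
  define m where "m = min (f u) (f u')"
  define \<mu> where "\<mu> = (f w + m) / 2"
  have m: "f w < \<mu>" "\<mu> < m"
    using u u' eq by (auto simp: \<mu>_def m_def)
  have "\<mu> \<in> f ` {a..b}"
    using connectedD_interval[OF iv(1) imageI[OF u(2)] imageI[OF u(1)], of \<mu>] m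
    by (simp add: m_def)
  then obtain v where v: "v \<in> {a..b}" "f v = \<mu>"
    by auto
  have "\<forall>\<^sub>F x in at v within {a..b}. f x \<in> {f w<..<m}"
    using f(1) v m by (intro topological_tendstoD[of f "f v"]) (auto simp: continuous_on_def)
  then obtain \<delta> where \<delta>: "\<delta> > 0" "\<And>x. x \<in> {a..b} \<Longrightarrow> x \<noteq> v \<Longrightarrow> dist x v < \<delta> \<Longrightarrow> f x \<in> {f w<..<m}"
    unfolding eventually_at by blast
  define c where "c = max a (v - \<delta>/2)"
  define d where "d = min b (v + \<delta>/2)"
  have "u \<noteq> w" using u by auto
  then have "a < b" using u by auto
  then have cd: "c < d" "{c..d} \<subseteq> {a..b}"
    using v \<delta> by (auto simp: c_def d_def)
  have "f x \<in> f ` {a'..b'}" if "x \<in> {c..d}" for x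
  proof -
    have "dist x v < \<delta>"
      using that \<delta>(1) by (auto simp: c_def d_def dist_real_def)
    then have "f x \<in> {f w<..<m}"
      using \<delta>(2)[of x] that cd v m by (cases "x = v") auto
    then show ?thesis
      using connectedD_interval[OF iv(2) imageI[OF u'(2)] imageI[OF u'(1)], of "f x"] eq
      by (simp add: m_def)
  qed
  then show thesis
    using that cd by blast
qed

text \<open>Each one-sided interval ending at a preimage of \<open>x\<close> covers a half neighbourhood of \<open>x\<close> in
  the arc; there are only two sides, so among three such intervals two overlap.\<close>
lemma irreducible_loop_inj_on_arc:
  fixes \<gamma> :: "real \<Rightarrow> 'a::metric_space"
  assumes cont: "continuous_on {0..1} \<gamma>" and im: "\<gamma> ` {0..1} = X"
    and irr: "\<And>c d. 0 \<le> c \<Longrightarrow> c < d \<Longrightarrow> d \<le> 1 \<Longrightarrow> \<gamma> ` ({0..1} - {c<..<d}) \<noteq> X"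
    and e: "open_arc_in X e" "\<gamma> s \<in> e" and st: "0 < s" "s < t" "t < 1" "\<gamma> s = \<gamma> t"
  shows False
proof -
  obtain k k' where k: "homeomorphism e {0<..<1::real} k k'"
    using e by (auto simp: open_arc_in_def homeomorphic_def)
  have "openin (top_of_set {0..1}) ({0..1} \<inter> \<gamma> -` e)"
    using e cont im by (intro continuous_openin_preimage[of _ _ X]) (auto simp: open_arc_in_def)
  then obtain O' where O': "open O'" "{0..1} \<inter> \<gamma> -` e = {0..1} \<inter> O'"
    by (auto simp: openin_open)
  have "s \<in> {0..1} \<inter> \<gamma> -` e" "t \<in> {0..1} \<inter> \<gamma> -` e"
    using st e(2) by simp_all
  then have "s \<in> O'" "t \<in> O'"
    unfolding O' by blast+
  then obtain d1 d2 where d12: "d1 > 0" "cball s d1 \<subseteq> O'" "d2 > 0" "cball t d2 \<subseteq> O'"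
    using O'(1) open_contains_cball by meson
  \<comment> \<open>The radius makes the one-sided intervals at \<open>s\<close> and
    \<open>t\<close> meet at most in endpoints, keeps them in the unit interval, and keeps their
    images in \<open>e\<close>, so that the chart \<open>k\<close> applies.\<close>
  define \<delta> where "\<delta> = min (min d1 d2) (min (min s (1 - t)) ((t - s) / 2))"
  have \<delta>: "\<delta> > 0" "\<delta> \<le> d1" "\<delta> \<le> d2" "\<delta> \<le> s" "\<delta> \<le> 1 - t" "\<delta> \<le> (t - s) / 2"
    using d12 st by (auto simp: \<delta>_def min_def)
  have eI: "\<gamma> u \<in> e" if "u \<in> {s-\<delta>..s+\<delta>} \<union> {t-\<delta>..t+\<delta>}" for u
  proof -
    have "u \<in> cball s d1 \<or> u \<in> cball t d2"
      using that \<delta> by (auto simp: dist_real_def)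
    then have "u \<in> O'" using d12 by blast
    moreover have "u \<in> {0..1}" using that \<delta> st by (elim UnE) simp_all
    ultimately show ?thesis using O' by blast
  qed
  have sub01: "{s-\<delta>..s+\<delta>} \<union> {t-\<delta>..t+\<delta>} \<subseteq> {0..1}"
    using \<delta> st by simp
  define \<phi> where "\<phi> = k \<circ> \<gamma>"
  have cont\<phi>: "continuous_on S \<phi>" if "S \<subseteq> {s-\<delta>..s+\<delta>} \<union> {t-\<delta>..t+\<delta>}" for S
    unfolding \<phi>_def
  proof (rule continuous_on_compose)
    show "continuous_on S \<gamma>"
      using that sub01 by (blast intro: continuous_on_subset[OF cont])
    show "continuous_on (\<gamma> ` S) k"
      using that eI by (blast intro: continuous_on_subset[OF homeomorphism_cont1[OF k]])
  qed
  have \<phi>_inj: "\<gamma> u = \<gamma> v" if "\<phi> u = \<phi> v" "u \<in> {s-\<delta>..s+\<delta>} \<union> {t-\<delta>..t+\<delta>}"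
      "v \<in> {s-\<delta>..s+\<delta>} \<union> {t-\<delta>..t+\<delta>}" for u v
    using that eI homeomorphism_apply1[OF k] by (metis \<phi>_def comp_apply)
  define \<I> where "\<I> = {(s-\<delta>, s), (s, s+\<delta>), (t-\<delta>, t), (t, t+\<delta>)}"
  have I: "a < b \<and> {a..b} \<subseteq> {s-\<delta>..s+\<delta>} \<union> {t-\<delta>..t+\<delta>} \<and> 0 \<le> a \<and> b \<le> 1 \<and>
    (\<exists>w\<in>{a..b}. \<phi> w = \<phi> s)" if "(a, b) \<in> \<I>" for a b
  proof -
    have "\<phi> t = \<phi> s" using st by (simp add: \<phi>_def)
    moreover have "s \<in> {a..b} \<or> t \<in> {a..b}"
      using that \<delta>(1) unfolding \<I>_def by (elim insertE emptyE Pair_inject) simp_all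
    ultimately have "\<exists>w\<in>{a..b}. \<phi> w = \<phi> s"
      by blast
    moreover have "{a..b} \<subseteq> {s-\<delta>..s+\<delta>} \<or> {a..b} \<subseteq> {t-\<delta>..t+\<delta>}"
      using that \<delta>(1) unfolding \<I>_def by (elim insertE emptyE Pair_inject) simp_all
    moreover have "a < b \<and> 0 \<le> a \<and> b \<le> 1"
      using that \<delta> st unfolding \<I>_def by (elim insertE emptyE Pair_inject) simp_all
    ultimately show ?thesis by blast
  qed
  have disj: "{a'..b'} \<inter> {a<..<b} = {}" if "(a, b) \<in> \<I>" "(a', b') \<in> \<I>" "(a, b) \<noteq> (a', b')" for a b a' b'
  proof -
    have "b \<le> a' \<or> b' \<le> a"
      using that \<delta> st unfolding \<I>_def by (elim insertE emptyE Pair_inject) simp_all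
    then show ?thesis by auto
  qed
  \<comment> \<open>A stretch whose image is repeated elsewhere could be deleted, against
    irreducibility. Constancy on a one-sided interval and an overlap of two of them are both reduced
    to this.\<close>
  have shadow: False if "0 \<le> c" "c < d" "d \<le> 1" "Q \<subseteq> {0..1} - {c<..<d}" "\<gamma> ` {c..d} \<subseteq> \<gamma> ` Q" for c d Q
  proof -
    have "\<gamma> x \<in> \<gamma> ` ({0..1} - {c<..<d})" if "x \<in> {0..1}" for x
    proof (cases "x \<in> {c..d}")
      case True
      then have "\<gamma> x \<in> \<gamma> ` Q" using \<open>\<gamma> ` {c..d} \<subseteq> \<gamma> ` Q\<close> by blast
      then show ?thesis using \<open>Q \<subseteq> _\<close> by blast
    next
      case False
      then show ?thesis using that by auto
    qed
    then have "\<gamma> ` ({0..1} - {c<..<d}) = X"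
      using im by auto
    then show False using irr that by blast
  qed
  have noncon: "\<exists>u\<in>{a..b}. \<phi> u \<noteq> \<phi> s" if "(a, b) \<in> \<I>" for a b
  proof (rule ccontr)
    assume "\<not> ?thesis"
    then have *: "\<phi> u = \<phi> s" if "u \<in> {a..b}" for u
      using that by blast
    note Iab = I[OF \<open>(a, b) \<in> \<I>\<close>]
    have "a \<in> {a..b}" using Iab by simp
    then have "\<gamma> u = \<gamma> a" if "u \<in> {a..b}" for u
      using \<phi>_inj[of u a] Iab *[OF that] *[of a] that by (metis subsetD)
    then have "\<gamma> ` {a..b} \<subseteq> \<gamma> ` {a}"
      by blast
    moreover have "0 \<le> a" "a < b" "b \<le> 1"
      using Iab by blast+
    moreover then have "{a} \<subseteq> {0..1} - {a<..<b}"
      by simp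
    ultimately show False
      using shadow[of a b "{a}"] by blast
  qed
  have overlap: False if "(a, b) \<in> \<I>" "(a', b') \<in> \<I>" "(a, b) \<noteq> (a', b')"
      "u \<in> {a..b}" "u' \<in> {a'..b'}" "(\<phi> s < \<phi> u \<and> \<phi> s < \<phi> u') \<or> (\<phi> u < \<phi> s \<and> \<phi> u' < \<phi> s)" for a b a' b' u u'
  proof -
    note I1 = I[OF that(1)] and I2 = I[OF that(2)] and uu = that(4,5)
    obtain w w' where w: "w \<in> {a..b}" "\<phi> w = \<phi> s" "w' \<in> {a'..b'}" "\<phi> w' = \<phi> s"
      using I1 I2 by auto
    have "\<exists>c d. c < d \<and> {c..d} \<subseteq> {a..b} \<and> \<phi> ` {c..d} \<subseteq> \<phi> ` {a'..b'}"
      using that(6)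
    proof
      assume "\<phi> s < \<phi> u \<and> \<phi> s < \<phi> u'"
      then show ?thesis
        using image_Icc_overlap[of a b \<phi> a' b' u w u' w'] cont\<phi> I1 I2 w uu by metis
    next
      assume A: "\<phi> u < \<phi> s \<and> \<phi> u' < \<phi> s"
      obtain c d where "c < d" "{c..d} \<subseteq> {a..b}" "(\<lambda>x. - \<phi> x) ` {c..d} \<subseteq> (\<lambda>x. - \<phi> x) ` {a'..b'}"
        by (rule image_Icc_overlap[of a b "\<lambda>x. - \<phi> x" a' b' u w u' w'])
           (use A cont\<phi> I1 I2 w uu in \<open>auto intro!: continuous_intros\<close>)
      moreover have "\<phi> ` {c..d} = uminus ` (\<lambda>x. - \<phi> x) ` {c..d}" "\<phi> ` {a'..b'} = uminus ` (\<lambda>x. - \<phi> x) ` {a'..b'}"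
        by (simp_all add: image_image)
      ultimately show ?thesis by (metis image_mono)
    qed
    then obtain c d where cd: "c < d" "{c..d} \<subseteq> {a..b}" "\<phi> ` {c..d} \<subseteq> \<phi> ` {a'..b'}"
      by blast
    have "a \<le> c" "d \<le> b"
      using cd by simp_all
    then have "{c<..<d} \<subseteq> {a<..<b}"
      by auto
    moreover have "{a'..b'} \<subseteq> {0..1}"
      using I2 by simp
    ultimately have "{a'..b'} \<subseteq> {0..1} - {c<..<d}"
      using disj[OF that(1-3)] by blast
    moreover have "\<gamma> ` {c..d} \<subseteq> \<gamma> ` {a'..b'}"
    proof
      fix y assume "y \<in> \<gamma> ` {c..d}"
      then obtain u where u: "u \<in> {c..d}" "y = \<gamma> u" by blast
      then obtain v where v: "v \<in> {a'..b'}" "\<phi> u = \<phi> v" using cd by blast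
      then have "\<gamma> u = \<gamma> v"
        using \<phi>_inj[of u v] u cd I1 I2 by blast
      then show "y \<in> \<gamma> ` {a'..b'}" using u v by blast
    qed
    ultimately show False
      using shadow[of c d "{a'..b'}"] cd I1 by auto
  qed
  have in1: "(s-\<delta>, s) \<in> \<I>" and in2: "(s, s+\<delta>) \<in> \<I>" and in3: "(t-\<delta>, t) \<in> \<I>"
    by (auto simp: \<I>_def)
  obtain u1 u2 u3 where u: "u1 \<in> {s-\<delta>..s}" "\<phi> u1 \<noteq> \<phi> s" "u2 \<in> {s..s+\<delta>}" "\<phi> u2 \<noteq> \<phi> s"
     "u3 \<in> {t-\<delta>..t}" "\<phi> u3 \<noteq> \<phi> s"
    using noncon[OF in1] noncon[OF in2] noncon[OF in3] by blast
  \<comment> \<open>None of the three values equals \<open>\<phi> s\<close>, so two of them lie on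
    the same side of it.\<close>
  have "(\<phi> s < \<phi> u1 \<and> \<phi> s < \<phi> u2 \<or> \<phi> u1 < \<phi> s \<and> \<phi> u2 < \<phi> s) \<or>
    (\<phi> s < \<phi> u1 \<and> \<phi> s < \<phi> u3 \<or> \<phi> u1 < \<phi> s \<and> \<phi> u3 < \<phi> s) \<or>
    (\<phi> s < \<phi> u2 \<and> \<phi> s < \<phi> u3 \<or> \<phi> u2 < \<phi> s \<and> \<phi> u3 < \<phi> s)"
    using u by linarith
  then show False
    using overlap[OF in1 in2 _ u(1) u(3)] overlap[OF in1 in3 _ u(1) u(5)] overlap[OF in2 in3 _ u(3) u(5)]
      st \<delta> by auto
qed

lemma eulerian_map_imp_edgewise:
  fixes X :: "'a::metric_space set"
  assumes "eulerian_map X g"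
  shows "edgewise_eulerian_map X g"
proof -
  have g: "continuous_on circle g" "g ` circle = X" "\<And>A. closed A \<Longrightarrow> A \<subset> circle \<Longrightarrow> g ` A \<noteq> X"
    using assms by (auto simp: eulerian_map_def)
  have "z = w" if zw: "z \<in> circle" "w \<in> circle" "g z = x" "g w = x" "x \<in> e" "e \<in> edges X" for z w x e
  proof (rule ccontr)
    assume "z \<noteq> w"
    \<comment> \<open>A base point different from \<open>z\<close> and \<open>w\<close> puts both
      preimages at parameters strictly between 0 and 1, where one-sided intervals exist on both
      sides.\<close>
    have "infinite circle"
      using connected_uncountable[of circle z w] connected_sphere[of "0::complex" 1] zw \<open>z \<noteq> w\<close>
      by (auto dest: countable_finite)
    then obtain z0 where z0: "z0 \<in> circle" "z0 \<noteq> z" "z0 \<noteq> w"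
      by (metis finite.emptyI finite_insert finite_subset insert_iff subsetI)
    obtain s t where st: "s \<in> {0..<1}" "z = z0 * cis (2 * pi * s)" "t \<in> {0..<1}" "w = z0 * cis (2 * pi * t)"
      using circle_eq_cis z0 zw by metis
    define \<gamma> where "\<gamma> = (\<lambda>t. g (z0 * cis (2 * pi * t)))"
    have \<gamma>: "continuous_on {0..1} \<gamma>" "\<gamma> ` {0..1} = X"
      using circle_loop[OF g(1) z0(1)] g(2) by (simp_all add: \<gamma>_def)
    have irr: "\<gamma> ` ({0..1} - {c<..<d}) \<noteq> X" if cd: "0 \<le> c" "c < d" "d \<le> 1" for c d
    proof -
      define A where "A = (\<lambda>t. z0 * cis (2 * pi * t)) ` ({0..1} - {c<..<d})"
      have "compact A"
        unfolding A_def
        by (intro compact_continuous_image compact_diff continuous_intros) auto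
      moreover have "A \<subseteq> circle"
        using z0 by (auto simp: A_def norm_mult)
      moreover have "z0 * cis (2 * pi * ((c + d) / 2)) \<notin> A"
      proof
        assume "z0 * cis (2 * pi * ((c + d) / 2)) \<in> A"
        then obtain u where u: "u \<in> {0..1}" "u \<notin> {c<..<d}"
          "z0 * cis (2 * pi * ((c + d) / 2)) = z0 * cis (2 * pi * u)"
          by (auto simp: A_def)
        show False
        \<comment> \<open>The parameters 0 and 1 name the same point, and injectivity holds on the
          half-open interval only, so \<open>u = 1\<close> is replaced by 0.\<close>
        proof (cases "u = 1")
          case True
          then have "z0 * cis (2 * pi * ((c + d) / 2)) = z0 * cis (2 * pi * 0)"
            using u(3) by simp
          then have "(c + d) / 2 = 0"
            by (rule circle_cis_inj[OF z0(1)]) (use cd in auto)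
          then show False using cd by simp
        next
          case False
          have "(c + d) / 2 = u"
            by (rule circle_cis_inj[OF z0(1) u(3)]) (use cd u False in auto)
          then show False using cd u by auto
        qed
      qed
      moreover have "z0 * cis (2 * pi * ((c + d) / 2)) \<in> circle"
        using z0 by (simp add: norm_mult)
      ultimately have "g ` A \<noteq> X"
        by (intro g(3)) (auto simp: compact_imp_closed)
      then show ?thesis
        by (simp add: A_def \<gamma>_def image_image)
    qed
    have arc: "open_arc_in X e"
      using zw by (simp add: edges_def)
    have "s \<noteq> 0" "t \<noteq> 0" "s \<noteq> t" using st z0 \<open>z \<noteq> w\<close> by auto
    moreover have "\<gamma> s = x" "\<gamma> t = x" using st zw by (auto simp: \<gamma>_def)
    ultimately show False
      using irreducible_loop_inj_on_arc[OF \<gamma> irr arc, of s t] irreducible_loop_inj_on_arc[OF \<gamma> irr arc, of t s]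
        st zw by (cases "s < t") auto
  qed
  note inj = this
  have "\<exists>!z. z \<in> circle \<and> g z = x" if "x \<in> \<Union>(edges X)" for x
  proof -
    have "x \<in> X" using that by (auto simp: edges_def open_arc_in_def openin_open)
    then show ?thesis using that inj g(2) by blast
  qed
  then show ?thesis
    using g by (simp add: edgewise_eulerian_map_def)
qed

section \<open>Open arcs lie in edges\<close>

text \<open>A monotone map with open image has no jumps, so it is continuous; the inverse is
  monotone too, with the open image \<open>I\<close>.\<close>

lemma strict_mono_homeomorphism:
  fixes f :: "real \<Rightarrow> real"
  assumes "strict_mono_on I f" "f ` I = J" "open I" "open J"
  shows "homeomorphism I J f (inv_into I f)"
proof -
  have inj: "inj_on f I"
    using assms(1) strict_mono_on_imp_inj_on by blast
  have bij: "inv_into I f ` J = I"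
    using inj assms(2) inv_into_image_cancel[of f I I] by simp
  have "continuous_on I f"
  proof (rule continuous_onI_mono)
    show "open (f ` I)" using assms by simp
    show "f x \<le> f y" if "x \<in> I" "y \<in> I" "x \<le> y" for x y
      using strict_mono_onD[OF assms(1), of x y] that by (cases "x = y") auto
  qed
  moreover have "continuous_on J (inv_into I f)"
  proof (rule continuous_onI_mono)
    show "open (inv_into I f ` J)" using assms bij by simp
    show "inv_into I f x \<le> inv_into I f y" if xy: "x \<in> J" "y \<in> J" "x \<le> y" for x y
    proof (rule ccontr)
      assume "\<not> ?thesis"
      then have "inv_into I f y < inv_into I f x" by simp
      then have "f (inv_into I f y) < f (inv_into I f x)"
        using xy assms(2) by (intro strict_mono_onD[OF assms(1)]) (simp_all add: inv_into_into)
      then show False using xy assms(2) by (simp add: f_inv_into_f)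
    qed
  qed
  ultimately show ?thesis
    using inj assms(2) bij by (auto simp: homeomorphism_def f_inv_into_f)
qed

lemma open_connected_bounded_real:
  fixes I :: "real set"
  assumes "open I" "connected I" "I \<noteq> {}" "I \<subseteq> {L..R}"
  obtains a b where "a < b" "I = {a<..<b}" "L \<le> a" "b \<le> R"
proof -
  have bdd: "bdd_below I" "bdd_above I"
    using assms(4) by (auto intro: bdd_below_mono bdd_above_mono)
  have iv: "x \<in> I" if "y \<in> I" "z \<in> I" "y \<le> x" "x \<le> z" for x y z
    using assms(2) that connectedD_interval by blast
  have notInf: "Inf I \<notin> I"
  proof
    assume "Inf I \<in> I"
    then obtain d where "d > 0" "ball (Inf I) d \<subseteq> I"
      using assms(1) open_contains_ball by blast
    then have "Inf I - d/2 \<in> I"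
      by (auto simp: subset_iff dist_real_def)
    then show False
      using cInf_lower[OF _ bdd(1), of "Inf I - d/2"] \<open>d > 0\<close> by simp
  qed
  have notSup: "Sup I \<notin> I"
  proof
    assume "Sup I \<in> I"
    then obtain d where "d > 0" "ball (Sup I) d \<subseteq> I"
      using assms(1) open_contains_ball by blast
    then have "Sup I + d/2 \<in> I"
      by (auto simp: subset_iff dist_real_def)
    then show False
      using cSup_upper[OF _ bdd(2), of "Sup I + d/2"] \<open>d > 0\<close> by simp
  qed
  have eq: "I = {Inf I<..<Sup I}"
  proof (intro equalityI subsetI)
    fix x assume "x \<in> I"
    then have "Inf I \<le> x" "x \<le> Sup I"
      using bdd by (auto intro: cInf_lower cSup_upper)
    moreover have "x \<noteq> Inf I" "x \<noteq> Sup I"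
      using \<open>x \<in> I\<close> notInf notSup by auto
    ultimately show "x \<in> {Inf I<..<Sup I}" by simp
  next
    fix x assume "x \<in> {Inf I<..<Sup I}"
    then obtain y z where "y \<in> I" "y < x" "z \<in> I" "x < z"
      using cInf_less_iff[OF assms(3) bdd(1)] less_cSup_iff[OF assms(3) bdd(2)] by auto
    then show "x \<in> I" using iv[of y z x] by simp
  qed
  then have "Inf I < Sup I" using assms(3) by (metis greaterThanLessThan_empty_iff not_le)
  moreover have "L \<le> Inf I" "Sup I \<le> R"
    using subsetD[OF assms(4)] by (intro cInf_greatest[OF assms(3)] cSup_least[OF assms(3)]; fastforce)+
  ultimately show thesis using that eq by blast
qed

lemma homeomorphic_Ioo:
  assumes "a < (b::real)"
  shows "{a<..<b} homeomorphic {0<..<1::real}"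
proof -
  have "(\<lambda>x. (x - a) / (b - a)) ` {a<..<b} = {0<..<1}"
  proof (intro equalityI subsetI)
    fix y :: real assume "y \<in> {0<..<1}"
    then have "0 < y * (b - a)" "y * (b - a) < 1 * (b - a)"
      using assms by (intro mult_strict_right_mono mult_pos_pos; simp)+
    then have "a + y * (b - a) \<in> {a<..<b}"
      by simp
    moreover have "y = ((a + y * (b - a)) - a) / (b - a)"
      using assms by simp
    ultimately show "y \<in> (\<lambda>x. (x - a) / (b - a)) ` {a<..<b}" by blast
  next
    fix y assume "y \<in> (\<lambda>x. (x - a) / (b - a)) ` {a<..<b}"
    then obtain x where "a < x" "x < b" "y = (x - a) / (b - a)" by auto
    then show "y \<in> {0<..<1}" by simp
  qed
  moreover have "strict_mono_on {a<..<b} (\<lambda>x. (x - a) / (b - a))"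
    using assms by (intro strict_mono_onI divide_strict_right_mono) simp_all
  ultimately have "homeomorphism {a<..<b} {0<..<1} (\<lambda>x. (x - a) / (b - a)) (inv_into {a<..<b} (\<lambda>x. (x - a) / (b - a)))"
    by (intro strict_mono_homeomorphism) simp_all
  then show ?thesis
    unfolding homeomorphic_def by blast
qed

lemma homeomorphism_subset_real_arc:
  fixes X :: "'a::metric_space set" and k' :: "'a \<Rightarrow> real"
  assumes "open_arc_in X A" "open_arc_in X B" "A \<subseteq> B" "homeomorphism {0<..<1} B k k'"
  obtains \<alpha> \<beta> where "0 \<le> \<alpha>" "\<alpha> < \<beta>" "\<beta> \<le> 1" "k' ` A = {\<alpha><..<\<beta>}"
proof -
  have "openin (top_of_set B) A"
    using assms(1,2,3) unfolding open_arc_in_def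
    by (metis openin_imp_subset openin_subset_trans)
  then have "openin (top_of_set {0<..<1::real}) (k' ` A)"
    using assms(4) homeomorphism_imp_open_map homeomorphism_symD by metis
  then have "open (k' ` A)" "k' ` A \<subseteq> {0..1}"
    by (auto simp: openin_open_eq dest!: openin_imp_subset)
  moreover have "connected A"
    using assms(1) homeomorphic_connectedness[of A "{0<..<1::real}"] by (simp add: open_arc_in_def)
  then have "connected (k' ` A)"
    using assms(3,4) by (meson connected_continuous_image continuous_on_subset homeomorphism_cont2)
  moreover have "A \<noteq> {}"
    using assms(1) by (auto simp: open_arc_in_def simp: homeomorphic_empty)
  ultimately obtain \<alpha> \<beta> where "\<alpha> < \<beta>" "k' ` A = {\<alpha><..<\<beta>}" "0 \<le> \<alpha>" "\<beta> \<le> 1"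
    by (metis image_is_empty open_connected_bounded_real)
  then show thesis using that by blast
qed

text \<open>Charts of a growing sequence of arcs must agree where both are defined. The old chart is
  kept on \<open>{a<..<b}\<close> and the rest of \<open>B\<close> is attached by affine pieces at
  the two ends. The bounds \<open>L\<close> and \<open>R\<close> are never reached, so the extension
  can be repeated indefinitely within a bounded interval.\<close>

lemma open_arc_extend:
  fixes X :: "'a::metric_space set" and a b L R :: real
  assumes A: "open_arc_in X A" and B: "open_arc_in X B" and AB: "A \<subseteq> B"
    and f: "homeomorphism {a<..<b} A f g" and ab: "L < a" "a < b" "b < R"
  obtains a' b' f' g' where "L < a'" "a' \<le> a" "b \<le> b'" "b' < R"
    "homeomorphism {a'<..<b'} B f' g'" "\<And>t. t \<in> {a<..<b} \<Longrightarrow> f' t = f t"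
proof -
  obtain k0 and k0' :: "'a \<Rightarrow> real" where k0: "homeomorphism {0<..<1::real} B k0 k0'"
    using B by (auto simp: open_arc_in_def homeomorphic_def dest: homeomorphism_symD)
  \<comment> \<open>Reversing a chart of \<open>B\<close> if necessary makes the coordinate change
    increasing.\<close>
  have "\<exists>k k'. homeomorphism {0<..<1::real} B k k' \<and> strict_mono_on {a<..<b} (k' \<circ> f)"
  proof -
    have sub: "f ` {a<..<b} = A" using f by (simp add: homeomorphism_def)
    have cont: "continuous_on {a<..<b} (k0' \<circ> f)"
      using homeomorphism_cont1[OF f] homeomorphism_cont2[OF k0] AB sub
      by (intro continuous_on_compose) (auto intro: continuous_on_subset)
    have "inj_on (k0' \<circ> f) {a<..<b}"
    proof (rule comp_inj_on)
      show "inj_on f {a<..<b}" using f by (metis homeomorphism_apply1 inj_on_inverseI)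
      show "inj_on k0' (f ` {a<..<b})"
        using k0 AB sub by (metis homeomorphism_apply2 inj_on_inverseI inj_on_subset)
    qed
    then consider "strict_mono_on {a<..<b} (k0' \<circ> f)" | "strict_antimono_on {a<..<b} (k0' \<circ> f)"
      using injective_eq_monotone_map[OF _ cont] by (auto simp: is_interval_1)
    then show ?thesis
    proof cases
      case 1
      then show ?thesis using k0 by blast
    next
      case 2
      have "homeomorphism {0<..<1::real} {0<..<1} (\<lambda>x. 1 - x) (\<lambda>x. 1 - x)"
      proof (rule homeomorphismI)
        show "(\<lambda>x::real. 1 - x) ` {0<..<1} \<subseteq> {0<..<1}" by auto
        show "(\<lambda>x::real. 1 - x) ` {0<..<1} \<subseteq> {0<..<1}" by auto
      qed (auto intro!: continuous_intros)
      then have "homeomorphism {0<..<1::real} B (k0 \<circ> (\<lambda>x. 1 - x)) ((\<lambda>x. 1 - x) \<circ> k0')"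
        using k0 homeomorphism_compose by blast
      moreover have "strict_mono_on {a<..<b} (((\<lambda>x. 1 - x) \<circ> k0') \<circ> f)"
        using 2 by (auto simp: monotone_on_def)
      ultimately show ?thesis by blast
    qed
  qed
  then obtain k and k' :: "'a \<Rightarrow> real" where k: "homeomorphism {0<..<1::real} B k k'"
    and mono: "strict_mono_on {a<..<b} (k' \<circ> f)" by blast
  obtain \<alpha> \<beta> where \<alpha>\<beta>: "0 \<le> \<alpha>" "\<alpha> < \<beta>" "\<beta> \<le> 1" "k' ` A = {\<alpha><..<\<beta>}"
    using homeomorphism_subset_real_arc[OF A B AB k] by blast
  have fim: "f ` {a<..<b} = A" using f by (simp add: homeomorphism_def)
  define \<phi> where "\<phi> = k' \<circ> f"
  have \<phi>im: "\<phi> ` {a<..<b} = {\<alpha><..<\<beta>}"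
    using \<alpha>\<beta>(4) fim unfolding \<phi>_def by (metis image_comp)
  \<comment> \<open>The attached pieces have lengths \<open>\<eta> * \<alpha>\<close> and
    \<open>\<eta> * (1 - \<beta>)\<close>. As \<open>\<alpha>\<close> and \<open>1 - \<beta>\<close>
    are at most 1, each takes at most half of the room left on its side.\<close>
  define \<eta> where "\<eta> = min (a - L) (R - b) / 2"
  have \<eta>: "\<eta> > 0" "\<eta> < a - L" "\<eta> < R - b"
    using ab by (auto simp: \<eta>_def min_def)
  define a' where "a' = a - \<eta> * \<alpha>"
  define b' where "b' = b + \<eta> * (1 - \<beta>)"
  have a': "L < a'" "a' \<le> a"
    using \<eta> \<alpha>\<beta> mult_left_le[of \<alpha> \<eta>] mult_nonneg_nonneg[of \<eta> \<alpha>]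
    unfolding a'_def by linarith+
  have b': "b' < R" "b \<le> b'"
    using \<eta> \<alpha>\<beta> mult_left_le[of "1 - \<beta>" \<eta>] mult_nonneg_nonneg[of \<eta> "1 - \<beta>"]
    unfolding b'_def by linarith+
  define \<Phi> where "\<Phi> t = (if t \<le> a then \<alpha> + (t - a) / \<eta> else if t < b then \<phi> t else \<beta> + (t - b) / \<eta>)" for t
  have \<phi>in: "\<alpha> < \<phi> t" "\<phi> t < \<beta>" if "a < t" "t < b" for t
  proof -
    have "\<phi> t \<in> {\<alpha><..<\<beta>}" unfolding \<phi>im[symmetric] using that by simp
    then show "\<alpha> < \<phi> t" "\<phi> t < \<beta>" by auto
  qed
  have lo: "(t - a) / \<eta> \<le> 0" if "t \<le> a" for t
    using that \<eta> by (simp add: divide_nonpos_pos)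
  have hi: "0 \<le> (t - b) / \<eta>" if "b \<le> t" for t
    using that \<eta> by simp
  have \<Phi>mono: "\<Phi> s < \<Phi> t" if "s < t" for s t
  proof -
    have 1: "(s - a) / \<eta> < (t - a) / \<eta>" "(s - b) / \<eta> < (t - b) / \<eta>"
      using that \<eta> by (auto simp: divide_strict_right_mono)
    have 2: "\<phi> s < \<phi> t" if "a < s" "t < b"
      using strict_mono_onD[OF mono, of s t] that \<open>s < t\<close> by (simp add: \<phi>_def)
    consider "t \<le> a" | "s \<le> a" "a < t" "t < b" | "s \<le> a" "b \<le> t" | "a < s" "t < b" | "a < s" "s < b" "b \<le> t" | "b \<le> s"
      using that by linarith
    then show ?thesis
    proof cases
      case 1 then show ?thesis using that \<open>(s - a) / \<eta> < (t - a) / \<eta>\<close> by (simp add: \<Phi>_def)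
    next
      case 2 then show ?thesis using that lo[of s] \<phi>in[of t] by (simp add: \<Phi>_def)
    next
      case 3 then show ?thesis using that lo[of s] hi[of t] \<alpha>\<beta> ab by (simp add: \<Phi>_def)
    next
      case 4 then show ?thesis using that 2 by (simp add: \<Phi>_def)
    next
      case 5 then show ?thesis using that \<phi>in[of s] hi[of t] ab by (simp add: \<Phi>_def)
    next
      case 6 then show ?thesis using that 1 ab by (simp add: \<Phi>_def)
    qed
  qed
  have \<Phi>a': "\<Phi> a' = 0"
    using \<eta> a' by (simp add: \<Phi>_def) (simp add: a'_def)
  have \<Phi>b': "\<Phi> b' = 1"
    using \<eta> b' ab by (simp add: \<Phi>_def) (simp add: b'_def)
  have \<Phi>im: "\<Phi> ` {a'<..<b'} = {0<..<1}"
  proof (intro equalityI subsetI)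
    fix y assume "y \<in> \<Phi> ` {a'<..<b'}"
    then show "y \<in> {0<..<1}"
      using \<Phi>mono[of a'] \<Phi>mono[of _ b'] \<Phi>a' \<Phi>b' by auto
  next
    fix y :: real assume y: "y \<in> {0<..<1}"
    have "\<exists>t. \<Phi> t = y"
    proof -
      consider "y \<le> \<alpha>" | "\<alpha> < y" "y < \<beta>" | "\<beta> \<le> y" by linarith
      then show ?thesis
      proof cases
        case 1
        then have "\<Phi> (a + \<eta> * (y - \<alpha>)) = y"
          using \<eta> mult_nonneg_nonpos[of \<eta> "y - \<alpha>"] by (simp add: \<Phi>_def)
        then show ?thesis ..
      next
        case 2
        then have "y \<in> \<phi> ` {a<..<b}" unfolding \<phi>im by simp
        then obtain t where "t \<in> {a<..<b}" "y = \<phi> t" by blast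
        then have "\<Phi> t = y" by (simp add: \<Phi>_def)
        then show ?thesis ..
      next
        case 3
        then have "0 \<le> \<eta> * (y - \<beta>)" using \<eta> by simp
        then have "\<Phi> (b + \<eta> * (y - \<beta>)) = y"
          using \<eta>(1) ab by (simp add: \<Phi>_def)
        then show ?thesis ..
      qed
    qed
    then obtain t where t: "\<Phi> t = y" ..
    have "a' < t" "t < b'"
      using \<Phi>mono[of t a'] \<Phi>mono[of b' t] \<Phi>a' \<Phi>b' t y by (cases "t = a'"; cases "t = b'"; force)+
    then show "y \<in> \<Phi> ` {a'<..<b'}" using t by auto
  qed
  obtain \<Psi> where \<Psi>: "homeomorphism {a'<..<b'} {0<..<1} \<Phi> \<Psi>"
    using strict_mono_homeomorphism[OF _ \<Phi>im] \<Phi>mono by (auto simp: monotone_on_def)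
  have "homeomorphism {a'<..<b'} B (k \<circ> \<Phi>) (\<Psi> \<circ> k')"
    using homeomorphism_compose[OF \<Psi> k] .
  moreover have "(k \<circ> \<Phi>) t = f t" if "t \<in> {a<..<b}" for t
  proof -
    have "f t \<in> B" using fim that AB by blast
    then show ?thesis
      using that homeomorphism_apply2[OF k] by (simp add: \<Phi>_def \<phi>_def)
  qed
  ultimately show thesis using that a' b' by blast
qed

text \<open>Successive charts extend each other and their domains stay within
  \<open>{-1<..<2}\<close>, so they glue to one chart on a bounded open interval. The glued map is
  open because each \<open>A n\<close> is open in \<open>X\<close>.\<close>

lemma open_arc_Union_incseq:
  fixes X :: "'a::metric_space set"
  assumes A: "\<And>n. open_arc_in X (A n)" and inc: "\<And>n. A n \<subseteq> A (Suc n)"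
  shows "open_arc_in X (\<Union>n. A n)"
proof -
  define P where "P = (\<lambda>n (a::real, b::real, f, g). -1 < a \<and> a < b \<and> b < 2 \<and> homeomorphism {a<..<b} (A n) f g)"
  define Q where "Q = (\<lambda>n::nat. \<lambda>(a::real, b::real, f::real \<Rightarrow> 'a, g::'a \<Rightarrow> real) (a', b', f', g'::'a \<Rightarrow> real).
     a' \<le> a \<and> b \<le> b' \<and> (\<forall>t\<in>{a<..<b}. f' t = f t))"
  have "\<exists>x. P 0 x"
  proof -
    obtain f g where "homeomorphism {0<..<1::real} (A 0) f g"
      using A[of 0] by (auto simp: open_arc_in_def homeomorphic_def dest: homeomorphism_symD)
    then have "P 0 (0, 1, f, g)" by (simp add: P_def)
    then show ?thesis ..
  qed
  moreover have "\<exists>y. P (Suc n) y \<and> Q n x y" if "P n x" for n x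
  proof -
    obtain a b f g where x: "x = (a, b, f, g)" by (cases x) auto
    have x': "-1 < a" "a < b" "b < 2" "homeomorphism {a<..<b} (A n) f g"
      using that by (auto simp: P_def x)
    obtain a' b' f' g' where "-1 < a'" "a' \<le> a" "b \<le> b'" "b' < 2"
      "homeomorphism {a'<..<b'} (A (Suc n)) f' g'" "\<And>t. t \<in> {a<..<b} \<Longrightarrow> f' t = f t"
      using open_arc_extend[OF A A inc x'(4) x'(1-3)] by metis
    then have "P (Suc n) (a', b', f', g') \<and> Q n x (a', b', f', g')"
      using x' by (simp add: P_def Q_def x)
    then show ?thesis ..
  qed
  ultimately obtain s where s: "\<And>n. P n (s n)" "\<And>n. Q n (s n) (s (Suc n))"
    using dependent_nat_choice[of P Q] by blast
  define a where "a n = fst (s n)" for n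
  define b where "b n = fst (snd (s n))" for n
  define f where "f n = fst (snd (snd (s n)))" for n
  define g where "g n = snd (snd (snd (s n)))" for n
  have sn: "s n = (a n, b n, f n, g n)" for n
    by (simp add: a_def b_def f_def g_def)
  have P: "-1 < a n" "a n < b n" "b n < 2" "homeomorphism {a n<..<b n} (A n) (f n) (g n)" for n
    using s(1)[of n] by (auto simp: P_def sn)
  have Q: "a (Suc n) \<le> a n" "b n \<le> b (Suc n)" "\<And>t. t \<in> {a n<..<b n} \<Longrightarrow> f (Suc n) t = f n t" for n
    using s(2)[of n] by (auto simp: Q_def sn)
  have dec: "a n \<le> a m" "b m \<le> b n" if "m \<le> n" for m n
    using lift_Suc_antimono_le[of a, OF Q(1) that] lift_Suc_mono_le[of b, OF Q(2) that] by auto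
  have fm: "f n t = f m t" if "m \<le> n" "t \<in> {a m<..<b m}" for m n t
    using that(1)
  proof (induction n rule: dec_induct)
    case (step n)
    have "t \<in> {a n<..<b n}" using dec[OF step(1)] that(2) by auto
    then show ?case using Q(3) step by simp
  qed simp
  have Amono: "A m \<subseteq> A n" if "m \<le> n" for m n
    using lift_Suc_mono_le[of A, OF inc that] .
  define I where "I = (\<Union>n. {a n<..<b n})"
  define F where "F t = f (LEAST n. t \<in> {a n<..<b n}) t" for t
  have F: "F t = f n t" if "t \<in> {a n<..<b n}" for t n
    unfolding F_def
    using fm[of "LEAST n. t \<in> {a n<..<b n}" n t] Least_le[of "\<lambda>n. t \<in> {a n<..<b n}", OF that]
      LeastI[of "\<lambda>n. t \<in> {a n<..<b n}", OF that] by metis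
  have Fim: "F ` {a n<..<b n} = A n" for n
    using F P(4)[of n] by (simp add: homeomorphism_def)
  have "F ` I = (\<Union>n. A n)"
    unfolding I_def image_UN Fim ..
  moreover have "continuous_on I F"
    unfolding I_def
  proof (rule continuous_on_open_UN)
    show "continuous_on {a n<..<b n} F" for n
      using P(4)[of n] F by (metis (no_types, lifting) continuous_on_cong homeomorphism_cont1)
  qed auto
  moreover have "inj_on F I"
  proof (rule inj_onI)
    fix t u assume "t \<in> I" "u \<in> I" "F t = F u"
    then obtain m n where mn: "t \<in> {a m<..<b m}" "u \<in> {a n<..<b n}"
      by (auto simp: I_def)
    define k where "k = max m n"
    have "t \<in> {a k<..<b k}" "u \<in> {a k<..<b k}"
      using mn dec[of m k] dec[of n k] by (auto simp: k_def)
    then show "t = u"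
      using F \<open>F t = F u\<close> homeomorphism_apply1[OF P(4)[of k]] by metis
  qed
  moreover have "openin (top_of_set (\<Union>n. A n)) (F ` U)" if "openin (top_of_set I) U" for U
  proof -
    have "open I" by (auto simp: I_def)
    then have U: "U \<subseteq> I" "open U"
      using that openin_open_trans openin_imp_subset by blast+
    have "F ` U = (\<Union>n. F ` (U \<inter> {a n<..<b n}))"
      using U(1) unfolding I_def by blast
    moreover have *: "openin (top_of_set (\<Union>n. A n)) (F ` (U \<inter> {a n<..<b n}))" for n
    proof -
      have "F ` (U \<inter> {a n<..<b n}) = f n ` (U \<inter> {a n<..<b n})"
        using F by (auto intro!: image_cong)
      moreover have "openin (top_of_set {a n<..<b n}) (U \<inter> {a n<..<b n})"
        using U(2) by (metis inf_commute openin_open_Int)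
      ultimately have "openin (top_of_set (A n)) (F ` (U \<inter> {a n<..<b n}))"
        using homeomorphism_imp_open_map[OF P(4)[of n]] by simp
      moreover have "openin (top_of_set X) (A n)"
        using A by (simp add: open_arc_in_def)
      ultimately have "openin (top_of_set X) (F ` (U \<inter> {a n<..<b n}))"
        using openin_trans by blast
      moreover have "F ` (U \<inter> {a n<..<b n}) \<subseteq> (\<Union>n. A n)"
        using Fim[of n] by blast
      moreover have "(\<Union>n. A n) \<subseteq> X"
        using A by (auto simp: open_arc_in_def dest: openin_imp_subset)
      ultimately show ?thesis
        by (rule openin_subset_trans)
    qed
    moreover have "openin (top_of_set (\<Union>n. A n)) (\<Union>n. F ` (U \<inter> {a n<..<b n}))"
      using * by blast
    ultimately show ?thesis by simp
  qed
  ultimately have "I homeomorphic (\<Union>n. A n)"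
    using homeomorphism_injective_open_map unfolding homeomorphic_def by metis
  moreover have "I homeomorphic {0<..<1::real}"
  proof -
    have "open I" by (auto simp: I_def)
    moreover have "connected I"
    proof -
      have "(a 0 + b 0) / 2 \<in> {a n<..<b n}" for n
        using dec[of 0 n] P(2)[of 0] by auto
      then show ?thesis
        unfolding I_def by (intro connected_Union) (auto simp del: greaterThanLessThan_iff)
    qed
    moreover have "(a 0 + b 0) / 2 \<in> I"
      unfolding I_def using P(2)[of 0] by (intro UN_I[of 0]) auto
    then have "I \<noteq> {}" by blast
    moreover have "I \<subseteq> {-1..2}"
    proof
      fix x assume "x \<in> I"
      then obtain n where "a n < x" "x < b n" by (auto simp: I_def)
      then show "x \<in> {-1..2}" using P(1,3)[of n] by simp
    qed
    ultimately show ?thesis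
      using open_connected_bounded_real[of I] homeomorphic_Ioo by metis
  qed
  ultimately have "(\<Union>n. A n) homeomorphic {0<..<1::real}"
    using homeomorphic_sym homeomorphic_trans by blast
  moreover have "openin (top_of_set X) (\<Union>n. A n)"
    using A by (auto simp: open_arc_in_def)
  ultimately show ?thesis by (simp add: open_arc_in_def)
qed

text \<open>In a chart of \<open>B\<close> the smaller arc is a subinterval. A missing end interval
  would be a nonempty open subset of \<open>X\<close> and contain a point of \<open>D\<close> in
  \<open>B\<close> but not in \<open>A\<close>.\<close>

lemma open_arc_dense_subset_eq:
  fixes X :: "'a::metric_space set"
  assumes "open_arc_in X A" "open_arc_in X B" "A \<subseteq> B"
    and D: "D \<subseteq> X" "X \<subseteq> closure D" "\<And>q. q \<in> D \<Longrightarrow> q \<in> B \<Longrightarrow> q \<in> A"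
  shows "A = B"
proof (rule ccontr)
  assume "A \<noteq> B"
  obtain k and k' :: "'a \<Rightarrow> real" where k: "homeomorphism {0<..<1::real} B k k'"
    using assms(2) by (auto simp: open_arc_in_def homeomorphic_def dest: homeomorphism_symD)
  obtain \<alpha> \<beta> where \<alpha>\<beta>: "0 \<le> \<alpha>" "\<alpha> < \<beta>" "\<beta> \<le> 1" "k' ` A = {\<alpha><..<\<beta>}"
    using homeomorphism_subset_real_arc[OF assms(1-3) k] by blast
  have k'inj: "x \<in> A" if "x \<in> B" "k' x \<in> k' ` A" for x
  proof -
    from that(2) obtain y where "y \<in> A" "k' x = k' y" by blast
    then show ?thesis using that assms(3) homeomorphism_apply2[OF k] by (metis subsetD)
  qed
  have miss: False if "0 \<le> c" "c < d" "d \<le> 1" "{c<..<d} \<inter> {\<alpha><..<\<beta>} = {}" for c d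
  proof -
    have "openin (top_of_set {0<..<1::real}) {c<..<d}"
      using that by (simp add: openin_open_eq greaterThanLessThan_subseteq_greaterThanLessThan)
    then have "openin (top_of_set B) (k ` {c<..<d})"
      using homeomorphism_imp_open_map[OF k] by blast
    then have "openin (top_of_set X) (k ` {c<..<d})"
      using assms(2) openin_trans unfolding open_arc_in_def by blast
    then obtain U where U: "open U" "k ` {c<..<d} = X \<inter> U"
      by (auto simp: openin_open)
    have mid: "(c + d) / 2 \<in> {c<..<d}" using that by simp
    then have "k ((c + d) / 2) \<in> U \<inter> closure D"
      using U D by blast
    then obtain q where q: "q \<in> D" "q \<in> U"
      using U(1) by (meson IntE disjoint_iff open_Int_closure_eq_empty)
    have "q \<in> k ` {c<..<d}"
      using U(2) q D(1) by blast
    then obtain t where t: "t \<in> {c<..<d}" "q = k t" by blast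
    have t01: "t \<in> {0<..<1}" using t that by auto
    then have "q \<in> A"
      using D(3)[OF q(1)] k t(2) by (metis homeomorphism_image1 imageI)
    then have "t \<in> {\<alpha><..<\<beta>}"
      using \<alpha>\<beta>(4) homeomorphism_apply1[OF k t01] t(2) by (metis imageI)
    then show False using t that by blast
  qed
  have "\<alpha> = 0"
    using miss[of 0 \<alpha>] \<alpha>\<beta> by (cases "\<alpha> = 0") auto
  moreover have "\<beta> = 1"
    using miss[of \<beta> 1] \<alpha>\<beta> by (cases "\<beta> = 1") auto
  ultimately have "B \<subseteq> A"
    using k'inj \<alpha>\<beta>(4) homeomorphism_image2[OF k] by (metis imageI subsetI)
  then show False using \<open>A \<noteq> B\<close> assms(3) by blast
qed

text \<open>Zorn's lemma needs the union of a chain of open arcs to be an open arc. The chain may be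
  uncountable; the countable dense set \<open>D\<close> shows that one member, or an increasing
  sequence of members, already has the same union.\<close>

lemma open_arc_subset_edge:
  fixes X :: "'a::metric_space set"
  assumes A: "open_arc_in X A" and D: "countable D" "D \<subseteq> X" "X \<subseteq> closure D"
  obtains e where "e \<in> edges X" "A \<subseteq> e"
proof -
  define \<A> where "\<A> = {B. open_arc_in X B \<and> A \<subseteq> B}"
  have "\<exists>M\<in>\<A>. \<forall>B\<in>\<A>. M \<subseteq> B \<longrightarrow> B = M"
  proof (rule subset_Zorn_nonempty)
    show "\<A> \<noteq> {}" using A by (auto simp: \<A>_def)
    fix \<C> assume \<C>: "\<C> \<noteq> {}" "subset.chain \<A> \<C>"
    have chain: "B \<subseteq> C \<or> C \<subseteq> B" if "B \<in> \<C>" "C \<in> \<C>" for B C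
      using \<C>(2) that by (auto simp: subset_chain_def)
    have arc: "open_arc_in X B" "A \<subseteq> B" if "B \<in> \<C>" for B
      using \<C>(2) that by (auto simp: subset_chain_def \<A>_def)
    have "open_arc_in X (\<Union>\<C>)"
    proof (cases "\<exists>C\<in>\<C>. D \<inter> \<Union>\<C> \<subseteq> C")
      case True
      then obtain C where C: "C \<in> \<C>" "D \<inter> \<Union>\<C> \<subseteq> C" by blast
      have "B \<subseteq> C" if "B \<in> \<C>" for B
      proof (cases "C \<subseteq> B")
        case True
        have "C = B"
          by (rule open_arc_dense_subset_eq[OF arc(1)[OF C(1)] arc(1)[OF that] True D(2,3)]) (use that C in blast)
        then show ?thesis by simp
      qed (use chain[OF that C(1)] in blast)
      then have "\<Union>\<C> = C" using C by blast
      then show ?thesis using arc C by simp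
    next
      case False
      then have ne: "D \<inter> \<Union>\<C> \<noteq> {}" using \<C>(1) by blast
      have cD: "countable (D \<inter> \<Union>\<C>)" using D by blast
      define q where "q = from_nat_into (D \<inter> \<Union>\<C>)"
      have q: "range q = D \<inter> \<Union>\<C>"
        using range_from_nat_into[OF ne cD] by (simp add: q_def)
      have "\<exists>B. \<forall>n. B n \<in> \<C> \<and> q n \<in> B n"
        using q by (intro choice) (metis IntD2 UnionE rangeI)
      then obtain B where B: "\<And>n. B n \<in> \<C>" "\<And>n. q n \<in> B n" by blast
      define A' where "A' n = (\<Union>i\<le>n. B i)" for n :: nat
      have A'Suc: "A' (Suc n) = A' n \<union> B (Suc n)" for n
        by (auto simp: A'_def atMost_Suc)
      have A'C: "A' n \<in> \<C>" for n
      proof (induction n)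
        case 0
        then show ?case using B by (simp add: A'_def)
      next
        case (Suc n)
        then show ?case
          using chain[OF Suc B(1)[of "Suc n"]] B(1)[of "Suc n"] A'Suc[of n] by (auto simp: Un_absorb1 Un_absorb2)
      qed
      have "\<Union>\<C> = (\<Union>n. A' n)"
      proof (intro equalityI subsetI)
        fix x assume "x \<in> \<Union>\<C>"
        then obtain C where C: "C \<in> \<C>" "x \<in> C" by blast
        \<comment> \<open>No member contains all points of \<open>D\<close> in the union, so some
          \<open>q n\<close> lies outside \<open>C\<close>; comparability in the chain then puts
          \<open>C\<close> inside \<open>A' n\<close>.\<close>
        obtain n where n: "q n \<notin> C" using False C q by (metis imageE subsetI)
        then have "\<not> A' n \<subseteq> C" using B(2)[of n] by (auto simp: A'_def)
        then show "x \<in> (\<Union>n. A' n)" using chain[OF A'C C(1)] C(2) by blast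
      qed (use A'C in blast)
      moreover have "open_arc_in X (\<Union>n. A' n)"
        using arc A'C A'Suc by (intro open_arc_Union_incseq) auto
      ultimately show ?thesis by simp
    qed
    then show "\<Union>\<C> \<in> \<A>"
      using arc(2) \<C>(1) by (auto simp: \<A>_def)
  qed
  then obtain M where M: "open_arc_in X M" "A \<subseteq> M" "\<And>B. open_arc_in X B \<Longrightarrow> A \<subseteq> B \<Longrightarrow> M \<subseteq> B \<Longrightarrow> B = M"
    by (auto simp: \<A>_def)
  then have "M \<in> edges X" by (auto simp: edges_def)
  then show thesis using M(2) that by blast
qed

section \<open>Loops with interval fibres over edges\<close>

text \<open>The library has arcs inside paths only for complete normed spaces; the Kuratowski embedding
  transfers the result to arbitrary metric spaces.\<close>
lemma path_contains_arc_metric: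
  fixes p :: "real \<Rightarrow> 'a::metric_space"
  assumes "path p" "pathstart p \<noteq> pathfinish p"
  obtains q where "arc q" "path_image q \<subseteq> path_image p"
    "pathstart q = pathstart p" "pathfinish q = pathfinish p"
proof -
  define x0 where "x0 = pathstart p"
  \<comment> \<open>Subtracting the distance from \<open>x0\<close> makes the function bounded on
    the whole type, where distances may be unbounded.\<close>
  define \<iota> :: "'a \<Rightarrow> 'a \<Rightarrow>\<^sub>C real" where "\<iota> x = Bcontfun (\<lambda>y. dist x y - dist x0 y)" for x
  have bc: "(\<lambda>y. dist x y - dist x0 y) \<in> bcontfun" for x
  proof -
    have "\<bar>dist x y - dist x0 y\<bar> \<le> dist x x0" for y
      by (metis abs_dist_diff_le dist_commute)
    then have "bounded (range (\<lambda>y. dist x y - dist x0 y))"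
      by (intro boundedI[of _ "dist x x0"]) auto
    then show ?thesis
      by (auto simp: bcontfun_def intro!: continuous_intros)
  qed
  have \<iota>: "apply_bcontfun (\<iota> x) y = dist x y - dist x0 y" for x y
    unfolding \<iota>_def using Bcontfun_inverse[OF bc] by metis
  have iso: "dist (\<iota> x) (\<iota> y) = dist x y" for x y
  proof (rule antisym)
    show "dist (\<iota> x) (\<iota> y) \<le> dist x y"
    proof (rule dist_bound)
      show "dist (apply_bcontfun (\<iota> x) z) (apply_bcontfun (\<iota> y) z) \<le> dist x y" for z
        unfolding \<iota> dist_real_def using abs_dist_diff_le[of x z y] by (simp add: dist_commute)
    qed
    show "dist x y \<le> dist (\<iota> x) (\<iota> y)"
      using dist_bounded[of "\<iota> x" y "\<iota> y"] by (simp add: \<iota> dist_real_def)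
  qed
  have inj: "inj \<iota>"
    using iso by (metis dist_eq_0_iff injI)
  have cont: "continuous_on S \<iota>" for S
    using iso by (metis continuous_on_iff)
  have cont': "continuous_on (range \<iota>) (inv \<iota>)"
    using iso inj by (auto simp: continuous_on_iff inv_f_f)
  have "path (\<iota> \<circ> p)"
    using assms(1) cont by (rule path_continuous_image)
  moreover have "pathstart (\<iota> \<circ> p) \<noteq> pathfinish (\<iota> \<circ> p)"
    using assms(2) inj by (simp add: pathstart_compose pathfinish_compose inj_eq)
  ultimately obtain q where q: "arc q" "path_image q \<subseteq> path_image (\<iota> \<circ> p)"
    "pathstart q = pathstart (\<iota> \<circ> p)" "pathfinish q = pathfinish (\<iota> \<circ> p)"
    using path_contains_arc by blast
  have sub: "path_image q \<subseteq> range \<iota>"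
    using q(2) by (auto simp: path_image_compose)
  have "arc (inv \<iota> \<circ> q)"
    unfolding arc_def
  proof
    show "path (inv \<iota> \<circ> q)"
      using q(1) cont' sub by (intro path_continuous_image) (auto simp: arc_def intro: continuous_on_subset)
    show "inj_on (inv \<iota> \<circ> q) {0..1}"
    proof (rule comp_inj_on)
      show "inj_on q {0..1}" using q(1) by (simp add: arc_def)
      show "inj_on (inv \<iota>) (q ` {0..1})"
        using sub by (auto simp: path_image_def intro: inj_on_inv_into)
    qed
  qed
  moreover have "path_image (inv \<iota> \<circ> q) \<subseteq> path_image p"
    using q(2) inj by (force simp: path_image_compose)
  ultimately show thesis
    using that[of "inv \<iota> \<circ> q"] q(3,4) inj by (simp add: pathstart_compose pathfinish_compose)
qed

section \<open>Images of compact sets and pasting of paths\<close>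

lemma continuous_image_compact_closedin:
  fixes f :: "'a::topological_space \<Rightarrow> 'b::t2_space"
  assumes "compact S" "continuous_on S f" "closedin (top_of_set S) U"
  shows "closedin (top_of_set (f ` S)) (f ` U)"
proof -
  have "U \<subseteq> S" using assms(3) closedin_imp_subset by blast
  moreover have "compact U" using assms(1,3) closedin_compact by blast
  ultimately have "compact (f ` U)"
    using assms(2) compact_continuous_image continuous_on_subset by blast
  then show ?thesis
    using \<open>U \<subseteq> S\<close> by (intro closed_subset image_mono compact_imp_closed)
qed

text \<open>A continuous map from a compact set is closed, hence a quotient map onto its image, and
  local connectedness passes to quotients.\<close>

lemma continuous_image_locally_connected:
  fixes f :: "'a::topological_space \<Rightarrow> 'b::t2_space"
  assumes "compact S" "continuous_on S f" "locally connected S"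
  shows "locally connected (f ` S)"
  by (rule locally_connected_quotient_image[OF assms(3)], rule closed_map_imp_quotient_map[OF assms(2)])
     (use assms continuous_image_compact_closedin in blast)+

lemma continuous_image_locally_path_connected:
  fixes f :: "'a::topological_space \<Rightarrow> 'b::t2_space"
  assumes "compact S" "continuous_on S f" "locally path_connected S"
  shows "locally path_connected (f ` S)"
  by (rule locally_path_connected_quotient_image[OF assms(3)], rule closed_map_imp_quotient_map[OF assms(2)])
     (use assms continuous_image_compact_closedin in blast)+

lemma openin_connected_imp_path_connected:
  fixes U :: "'a::topological_space set"
  assumes "locally path_connected X" "openin (top_of_set X) U" "connected U"
  shows "path_connected U"
proof -
  have *: "locally path_connected U"
    using assms locally_open_subset by blast
  show ?thesis
    unfolding path_connected_component path_component_eq_connected_component[OF *]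
    using assms(3) connected_iff_connected_component by blast
qed

lemma paste_pieces:
  fixes \<pi> :: "nat \<Rightarrow> real \<Rightarrow> 'a::topological_space"
  assumes N: "N > 0" and cont: "\<And>k. k < N \<Longrightarrow> continuous_on {0..1} (\<pi> k)"
    and match: "\<And>k. Suc k < N \<Longrightarrow> \<pi> k 1 = \<pi> (Suc k) 0"
  obtains f where "continuous_on {0..1} f"
    "\<And>k u. k < N \<Longrightarrow> u \<in> {0..1} \<Longrightarrow> f ((real k + u) / real N) = \<pi> k u"
proof -
  \<comment> \<open>At an inner grid point the floor selects the piece on the right, which agrees
    with the left one by \<open>match\<close>; at \<open>t = 1\<close> the index is
    \<open>N\<close>, and the last piece is used at its end.\<close>
  define f where "f t = (let k = nat \<lfloor>t * real N\<rfloor> in if k \<ge> N then \<pi> (N - 1) 1 else \<pi> k (t * real N - real k))" for t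
  have f: "f ((real k + u) / real N) = \<pi> k u" if "k < N" "u \<in> {0..1}" for k u
  proof (cases "u = 1")
    case True
    have "nat \<lfloor>(real k + u) / real N * real N\<rfloor> = Suc k"
      using N True by simp
    then have f_eq: "f ((real k + u) / real N) = (if Suc k \<ge> N then \<pi> (N - 1) 1 else \<pi> (Suc k) 0)"
      using N True by (simp add: f_def Let_def)
    show ?thesis
    proof (cases "Suc k < N")
      case True
      then show ?thesis using f_eq match[of k] \<open>u = 1\<close> by simp
    next
      case False
      then have "N - 1 = k" using that by linarith
      then show ?thesis using f_eq False True by simp
    qed
  next
    case False
    have "nat \<lfloor>(real k + u) / real N * real N\<rfloor> = k"
    proof -
      have "\<lfloor>u\<rfloor> = 0" using False that by (intro floor_unique) auto
      then show ?thesis using N by simp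
    qed
    then show ?thesis
      using that N by (simp add: f_def Let_def)
  qed
  have piece: "continuous_on {real k / real N..(real k + 1) / real N} f" if "k < N" for k
  proof (rule continuous_on_eq)
    show "continuous_on {real k / real N..(real k + 1) / real N} (\<lambda>t. \<pi> k (t * real N - real k))"
      by (rule continuous_on_compose2[OF cont[OF that]])
         (use N in \<open>auto intro!: continuous_intros simp: field_simps\<close>)
    fix t assume t: "t \<in> {real k / real N..(real k + 1) / real N}"
    have "t * real N - real k \<in> {0..1}"
      using t N by (auto simp: field_simps)
    from f[OF \<open>k < N\<close> this] show "\<pi> k (t * real N - real k) = f t"
      using N by simp
  qed
  have "continuous_on (\<Union>k\<in>{..<N}. {real k / real N..(real k + 1) / real N}) f"
    by (rule continuous_on_closed_Union) (use piece in auto)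
  moreover have "{0..1} \<subseteq> (\<Union>k\<in>{..<N}. {real k / real N..(real k + 1) / real N})"
  proof
    fix t :: real assume t: "t \<in> {0..1}"
    show "t \<in> (\<Union>k\<in>{..<N}. {real k / real N..(real k + 1) / real N})"
    proof (cases "t = 1")
      case True
      then show ?thesis using N by (intro UN_I[of "N - 1"]) (auto simp: field_simps)
    next
      case False
      define k where "k = nat \<lfloor>t * real N\<rfloor>"
      have "real k \<le> t * real N" "t * real N < real k + 1"
        using t N by (auto simp: k_def)
      moreover have "t * real N < real N" using t False N by simp
      ultimately have "k < N" by linarith
      with \<open>real k \<le> t * real N\<close> \<open>t * real N < real k + 1\<close>
      have "k < N" "t \<in> {real k / real N..(real k + 1) / real N}"
        using N by (auto simp: field_simps)
      then show ?thesis by blast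
    qed
  qed
  ultimately show thesis
    using that f continuous_on_subset by blast
qed

lemma unit_interval_piece:
  assumes "N > 0" "t \<in> {0..1::real}"
  obtains k u where "k < N" "u \<in> {0..1}" "t = (real k + u) / real N"
proof (cases "t = 1")
  case True
  then show ?thesis using assms by (intro that[of "N - 1" 1]) auto
next
  case False
  define k where "k = nat \<lfloor>t * real N\<rfloor>"
  have k: "real k \<le> t * real N" "t * real N < real k + 1"
    using assms by (auto simp: k_def)
  have "t * real N < real N" using assms False by simp
  then have "k < N" using k by linarith
  then show ?thesis
    using assms k by (intro that[of k "t * real N - real k"]) auto
qed

text \<open>Each prescribed path is reached and left by connecting paths inside \<open>U\<close>, so
  one path can collect finitely many images.\<close>

lemma path_through_finitely_many_paths:
  fixes f :: "nat \<Rightarrow> real \<Rightarrow> 'a::topological_space"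
  assumes U: "path_connected U" "b \<in> U"
    and f: "\<And>i. i < n \<Longrightarrow> path (f i)" "\<And>i. i < n \<Longrightarrow> path_image (f i) \<subseteq> U"
    and a: "a \<in> U"
  obtains q where "path q" "pathstart q = a" "pathfinish q = b" "path_image q \<subseteq> U"
    "\<And>i. i < n \<Longrightarrow> path_image (f i) \<subseteq> path_image q"
proof -
  have "\<exists>q. path q \<and> pathstart q = a \<and> pathfinish q = b \<and> path_image q \<subseteq> U \<and> (\<forall>i<n. path_image (f i) \<subseteq> path_image q)"
    using f a
  proof (induction n arbitrary: a)
    case 0
    then show ?case using U unfolding path_connected_def by blast
  next
    case (Suc n)
    have U': "pathstart (f n) \<in> U" "pathfinish (f n) \<in> U" "path (f n)"
      using Suc.prems(1,2)[of n] by auto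
    obtain q where q: "path q" "pathstart q = pathfinish (f n)" "pathfinish q = b" "path_image q \<subseteq> U"
      "\<And>i. i < n \<Longrightarrow> path_image (f i) \<subseteq> path_image q"
      using Suc.IH[OF _ _ U'(2)] Suc.prems by (metis less_SucI)
    obtain p where p: "path p" "path_image p \<subseteq> U" "pathstart p = a" "pathfinish p = pathstart (f n)"
      using U(1) Suc.prems(3) U' unfolding path_connected_def by blast
    have "path_image (p +++ (f n +++ q)) = path_image p \<union> (path_image (f n) \<union> path_image q)"
      using p q by (simp add: path_image_join)
    moreover have "path (p +++ (f n +++ q))"
      using p q U' by simp
    moreover have "path_image (f i) \<subseteq> path_image p \<union> (path_image (f n) \<union> path_image q)" if "i < Suc n" for i
      using q(5)[of i] that by (cases "i = n") auto
    ultimately show ?case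
      using p q Suc.prems(2)[of n] by (intro exI[of _ "p +++ (f n +++ q)"]) simp
  qed
  then show thesis using that by blast
qed

section \<open>Loops with interval fibres and the spaces they trace\<close>

text \<open>Fibres over edge points are asked to be intervals, not points, because uniform limits
  and reparametrisations with pauses produce constant stretches. The base point \<open>b\<close> is
  kept by all perturbations, so that limits are again closed.\<close>

definition mono_loop :: "'a::metric_space set \<Rightarrow> 'a \<Rightarrow> (real \<Rightarrow> 'a) \<Rightarrow> bool" where
  "mono_loop X b \<gamma> \<longleftrightarrow> continuous_on {0..1} \<gamma> \<and> \<gamma> ` {0..1} = X \<and> \<gamma> 0 = b \<and> \<gamma> 1 = b \<and>
     (\<forall>x\<in>\<Union>(edges X). \<forall>s u t. 0 \<le> s \<and> s \<le> u \<and> u \<le> t \<and> t \<le> 1 \<and> \<gamma> s = x \<and> \<gamma> t = x \<longrightarrow> \<gamma> u = x)"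

lemma mono_loopD:
  assumes "mono_loop X b \<gamma>"
  shows "continuous_on {0..1} \<gamma>" "\<gamma> ` {0..1} = X" "\<gamma> 0 = b" "\<gamma> 1 = b"
    and mono_loop_fibre: "\<And>x s u t. \<lbrakk>x \<in> \<Union>(edges X); 0 \<le> s; s \<le> u; u \<le> t; t \<le> 1; \<gamma> s = x; \<gamma> t = x\<rbrakk> \<Longrightarrow> \<gamma> u = x"
proof -
  show "continuous_on {0..1} \<gamma>" using assms unfolding mono_loop_def by (elim conjE)
  show "\<gamma> ` {0..1} = X" using assms unfolding mono_loop_def by (elim conjE)
  show "\<gamma> 0 = b" using assms unfolding mono_loop_def by (elim conjE)
  show "\<gamma> 1 = b" using assms unfolding mono_loop_def by (elim conjE)
  have *: "\<forall>x\<in>\<Union>(edges X). \<forall>s u t. 0 \<le> s \<and> s \<le> u \<and> u \<le> t \<and> t \<le> 1 \<and> \<gamma> s = x \<and> \<gamma> t = x \<longrightarrow> \<gamma> u = x"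
    using assms unfolding mono_loop_def by (elim conjE)
  show "\<gamma> u = x" if "x \<in> \<Union>(edges X)" "0 \<le> s" "s \<le> u" "u \<le> t" "t \<le> 1" "\<gamma> s = x" "\<gamma> t = x" for x s u t
    using bspec[OF * that(1)] that(2-) by blast
qed

text \<open>The loop makes \<open>X\<close> a quotient of the unit interval, which supplies local
  path connectedness; its values at rational times are dense.\<close>

lemma mono_loop_space:
  fixes X :: "'a::metric_space set"
  assumes "mono_loop X b \<gamma>"
  shows "compact X" "connected X" "locally path_connected X" "locally connected X"
    and "\<exists>D. countable D \<and> D \<subseteq> X \<and> X \<subseteq> closure D"
proof -
  note \<gamma> = mono_loopD[OF assms]
  show "compact X" "connected X"
    using \<gamma>(1,2) compact_continuous_image connected_continuous_image by (metis compact_Icc connected_Icc)+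
  have "locally path_connected {0..1::real}"
    by (simp add: convex_imp_locally_path_connected)
  then show "locally path_connected X"
    using continuous_image_locally_path_connected[OF _ \<gamma>(1)] \<gamma>(2) by (metis compact_Icc)
  then show "locally connected X"
    by (rule locally_path_connected_imp_locally_connected)
  have "{0..1::real} = closure (\<rat> \<inter> {0<..<1})"
  proof -
    have "closure ({0<..<1} \<inter> \<rat>) = closure {0<..<1::real}"
      by (rule closure_open_Int_superset) (auto simp: Rats_closure_real)
    then show ?thesis by (simp add: Int_commute)
  qed
  then have "\<gamma> ` closure (\<rat> \<inter> {0<..<1}) \<subseteq> closure (\<gamma> ` (\<rat> \<inter> {0<..<1}))"
    using \<gamma>(1) by (intro image_closure_subset) (auto intro: closure_subset[THEN subsetD])
  then have "X \<subseteq> closure (\<gamma> ` (\<rat> \<inter> {0<..<1}))"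
    using \<gamma>(2) \<open>{0..1::real} = _\<close> by simp
  moreover have "\<gamma> ` (\<rat> \<inter> {0<..<1}) \<subseteq> X"
    using \<gamma>(2) by auto
  moreover have "countable (\<gamma> ` (\<rat> \<inter> {0<..<1}))"
    by (intro countable_image) (simp add: countable_rat)
  ultimately show "\<exists>D. countable D \<and> D \<subseteq> X \<and> X \<subseteq> closure D"
    by blast
qed

text \<open>Used in contrapositive form: a nonempty open set that meets no edge is not contained in
  an arc. The parametrisation of the arc is a homeomorphism, so a small open interval of parameters
  in the preimage of \<open>W\<close> has an image that is open in \<open>W\<close>, hence in
  \<open>X\<close>.\<close>

lemma openin_subset_arc_contains_open_arc:
  fixes X :: "'a::metric_space set"
  assumes q: "arc q" "path_image q \<subseteq> X" and W: "openin (top_of_set X) W" "W \<noteq> {}" "W \<subseteq> path_image q"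
  obtains A where "open_arc_in X A" "A \<subseteq> W"
proof -
  obtain h where h: "homeomorphism {0..1} (path_image q) q h"
    using homeomorphism_arc[OF q(1)] by blast
  have qc: "continuous_on {0..1} q" using q by (simp add: arc_def path_def)
  have "openin (top_of_set (path_image q)) W"
    using W q(2) openin_subset_trans by blast
  then have "openin (top_of_set {0..1}) ({0..1} \<inter> q -` W)"
    using qc by (intro continuous_openin_preimage[of _ _ "path_image q"]) (auto simp: path_image_def)
  then obtain O' where O': "open O'" "{0..1} \<inter> q -` W = {0..1} \<inter> O'"
    by (auto simp: openin_open)
  obtain y where "y \<in> W" using W(2) by blast
  moreover then have "y \<in> q ` {0..1}" using W(3) unfolding path_image_def by blast
  ultimately obtain s where s: "s \<in> {0..1}" "q s \<in> W" by blast
  then have "s \<in> {0..1} \<inter> O'" unfolding O'(2)[symmetric] by simp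
  then have "s \<in> O' \<inter> closure {0<..<1}" by simp
  then obtain t where t: "t \<in> O'" "t \<in> {0<..<1}"
    using O'(1) open_Int_closure_eq_empty by blast
  then have "t \<in> O' \<inter> {0<..<1}" "open (O' \<inter> {0<..<1})" using O'(1) by auto
  then obtain \<eta> where \<eta>: "\<eta> > 0" "ball t \<eta> \<subseteq> O' \<inter> {0<..<1}"
    using open_contains_ball by blast
  have ball: "ball t \<eta> = {t - \<eta><..<t + \<eta>}"
    by (rule ball_eq_greaterThanLessThan)
  define A where "A = q ` {t - \<eta><..<t + \<eta>}"
  have sub: "{t - \<eta><..<t + \<eta>} \<subseteq> {0..1} \<inter> O'"
    using \<eta>(2) unfolding ball by (auto simp: subset_iff)
  then have "A \<subseteq> W"
    unfolding A_def O'(2)[symmetric] by blast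
  have "openin (top_of_set {0..1::real}) {t - \<eta><..<t + \<eta>}"
    using sub by (intro open_subset) auto
  then have "openin (top_of_set (path_image q)) A"
    unfolding A_def using homeomorphism_imp_open_map[OF h] by blast
  then have "openin (top_of_set W) A"
    using \<open>A \<subseteq> W\<close> W(3) openin_subset_trans by blast
  then have "openin (top_of_set X) A"
    using W(1) openin_trans by blast
  moreover have "A homeomorphic {0<..<1::real}"
  proof -
    have "homeomorphism {t - \<eta><..<t + \<eta>} A q h"
      using homeomorphism_of_subsets[OF h, of "{t - \<eta><..<t + \<eta>}" A A] sub \<open>A \<subseteq> W\<close> W(3) A_def by blast
    then have "{t - \<eta><..<t + \<eta>} homeomorphic A"
      unfolding homeomorphic_def by blast
    then show ?thesis
      using homeomorphic_Ioo[of "t - \<eta>" "t + \<eta>"] \<eta>(1) homeomorphic_sym homeomorphic_trans by (smt (verit))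
  qed
  ultimately show thesis
    using that \<open>A \<subseteq> W\<close> by (simp add: open_arc_in_def)
qed

text \<open>Finitely many closed sets without interior in \<open>U\<close> are removed one at a
  time; what remains stays open and nonempty.\<close>

lemma openin_minus_nowhere_dense:
  assumes "finite I" "\<And>i. i \<in> I \<Longrightarrow> closed (S i)"
    and "\<And>i W. i \<in> I \<Longrightarrow> openin (top_of_set X) W \<Longrightarrow> W \<noteq> {} \<Longrightarrow> W \<subseteq> U \<Longrightarrow> \<not> W \<subseteq> S i"
    and "openin (top_of_set X) V" "V \<noteq> {}" "V \<subseteq> U"
  shows "V - (\<Union>i\<in>I. S i) \<noteq> {}"
  using assms
proof (induction I arbitrary: V rule: finite_induct)
  case (insert i I)
  have "openin (top_of_set X) (V - S i)"
  proof -
    obtain O' where "open O'" "V = X \<inter> O'" using insert.prems(3) by (auto simp: openin_open)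
    then have "V - S i = X \<inter> (O' - S i)" "open (O' - S i)"
      using insert.prems(1)[of i] by (auto intro: open_Diff)
    then show ?thesis by (auto simp: openin_open)
  qed
  moreover have "V - S i \<noteq> {}"
    using insert.prems(2)[of i V] insert.prems(3-5) by blast
  ultimately have "(V - S i) - (\<Union>i\<in>I. S i) \<noteq> {}"
    using insert.IH[of "V - S i"] insert.prems by blast
  then show ?case by blast
qed simp

lemma uniform_modulus:
  fixes \<gamma> :: "real \<Rightarrow> 'a::metric_space"
  assumes "continuous_on {0..1} \<gamma>" "\<epsilon> > 0"
  obtains \<delta> where "\<delta> > 0" "\<And>s t. s \<in> {0..1} \<Longrightarrow> t \<in> {0..1} \<Longrightarrow> \<bar>s - t\<bar> < \<delta> \<Longrightarrow> dist (\<gamma> s) (\<gamma> t) < \<epsilon>"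
proof -
  have "uniformly_continuous_on {0..1} \<gamma>"
    using assms(1) by (intro compact_uniformly_continuous) auto
  then obtain \<delta> where "\<delta> > 0" "\<And>s t. s \<in> {0..1} \<Longrightarrow> t \<in> {0..1} \<Longrightarrow> dist t s < \<delta> \<Longrightarrow> dist (\<gamma> t) (\<gamma> s) < \<epsilon>"
    using assms(2) unfolding uniformly_continuous_on_def by metis
  then show thesis using that[of \<delta>] by (simp add: dist_real_def)
qed

text \<open>Away from the edges there are no open arcs, so arcs are nowhere dense. All pieces of the loop
  near \<open>\<gamma> \<tau>\<close> are rerouted along arcs, and one piece inside the interval \<open>{c<..<d}\<close> is
  replaced by a path through everything that was lost.\<close>
lemma mono_loop_perturb_fill:
  fixes X :: "'a::metric_space set"
  assumes \<gamma>: "mono_loop X b \<gamma>" and \<epsilon>: "\<epsilon> > 0" and cd: "0 \<le> c" "d \<le> 1"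
    and \<tau>: "c < \<tau>" "\<tau> < d" "\<gamma> \<tau> \<notin> closure (\<Union>(edges X))" "\<gamma> \<tau> \<noteq> b"
  obtains \<gamma>' where "mono_loop X b \<gamma>'" "\<And>t. t \<in> {0..1} \<Longrightarrow> dist (\<gamma>' t) (\<gamma> t) < \<epsilon>"
    "\<gamma>' ` ({0..1} - {c<..<d}) \<noteq> X"
proof -
  note L = mono_loopD[OF \<gamma>] and SP = mono_loop_space[OF \<gamma>]
  \<comment> \<open>Removing the closure of the edges lets all changes inside \<open>U0\<close>
    leave the fibres over edge points alone. Removing \<open>b\<close> makes \<open>U0\<close> a
    proper subset of \<open>X\<close>, which later rules out open one-point subsets.\<close>
  define U0 where "U0 = X \<inter> ball (\<gamma> \<tau>) (\<epsilon>/2) - closure (\<Union>(edges X)) - {b}"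
  have "openin (top_of_set X) U0"
    unfolding U0_def Diff_eq Int_assoc by (intro openin_open_Int) auto
  moreover have "\<gamma> \<tau> \<in> X" using L(2) \<tau> cd by auto
  then have "\<gamma> \<tau> \<in> U0" using \<tau> \<epsilon> by (simp add: U0_def)
  ultimately obtain U where U: "openin (top_of_set X) U" "connected U" "\<gamma> \<tau> \<in> U" "U \<subseteq> U0"
    using SP(4) unfolding locally_connected by blast
  have pcU: "path_connected U"
    using openin_connected_imp_path_connected[OF SP(3)] U by blast
  have UX: "U \<subseteq> X" "b \<notin> U" "U \<inter> \<Union>(edges X) = {}"
    using U(4) closure_subset[of "\<Union>(edges X)"] by (auto simp: U0_def)
  have Ud: "dist x y < \<epsilon>" if "x \<in> U" "y \<in> U" for x y
  proof -
    have "dist (\<gamma> \<tau>) x < \<epsilon>/2" "dist (\<gamma> \<tau>) y < \<epsilon>/2"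
      using that U(4) by (auto simp: U0_def)
    then show ?thesis using dist_triangle3[of x y "\<gamma> \<tau>"] by simp
  qed
  obtain r where r: "r > 0" "ball (\<gamma> \<tau>) r \<inter> X \<subseteq> U"
    using U(1,3) unfolding openin_contains_ball by blast
  \<comment> \<open>The half radius matches the mesh: a piece of the loop that meets
    \<open>V\<close> has its image in the ball of radius \<open>r\<close>, hence in
    \<open>U\<close>.\<close>
  define V where "V = X \<inter> ball (\<gamma> \<tau>) (r/2)"
  have V: "openin (top_of_set X) V" "\<gamma> \<tau> \<in> V" "V \<subseteq> U"
    using r \<open>\<gamma> \<tau> \<in> X\<close> unfolding V_def by (auto intro!: openin_open_Int)
  obtain \<delta> where \<delta>: "\<delta> > 0" "\<And>s t. s \<in> {0..1} \<Longrightarrow> t \<in> {0..1} \<Longrightarrow> \<bar>s - t\<bar> < \<delta> \<Longrightarrow> dist (\<gamma> s) (\<gamma> t) < r/2"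
    using uniform_modulus[OF L(1), of "r/2"] r(1) by auto
  \<comment> \<open>The mesh is also less than the distances of \<open>\<tau>\<close> from
    \<open>c\<close> and \<open>d\<close>, so the piece through \<open>\<tau>\<close> runs inside
    \<open>{c<..<d}\<close>.\<close>
  obtain N :: nat where N: "N > 0" "1 / real N < min \<delta> (min (\<tau> - c) (d - \<tau>))"
    using real_arch_inverse[of "min \<delta> (min (\<tau> - c) (d - \<tau>))"] \<delta>(1) \<tau> by (auto simp: inverse_eq_divide)
  have piece_in: "(real k + u) / real N \<in> {0..1}" if "k < N" "u \<in> {0..1}" for k u
    using that N(1) by (auto simp: divide_simps)
  have piece_diff: "\<bar>(real k + u) / real N - (real k + v) / real N\<bar> \<le> 1 / real N"
    if "u \<in> {0..1}" "v \<in> {0..1}" for k :: nat and u v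
    using that N(1) by (auto simp: diff_divide_distrib[symmetric] abs_le_iff divide_simps)
  define P where "P k u = \<gamma> ((real k + u) / real N)" for k :: nat and u
  have Pcont: "continuous_on {0..1} (P k)" if "k < N" for k
    unfolding P_def using piece_in[OF that] N(1)
    by (intro continuous_on_compose2[OF L(1)]) (auto intro!: continuous_intros)
  have Pmatch: "P k 1 = P (Suc k) 0" for k by (simp add: P_def add.commute)
  obtain k0 u0 where k0: "k0 < N" "u0 \<in> {0..1}" "\<tau> = (real k0 + u0) / real N"
    using unit_interval_piece[OF N(1), of \<tau>] \<tau> cd by (metis atLeastAtMost_iff less_eq_real_def order_trans)
  have k0_in: "(real k0 + u) / real N \<in> {c<..<d}" if "u \<in> {0..1}" for u
    using piece_diff[OF that k0(2), of k0] N(2) k0(3) by (auto simp: abs_le_iff)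
  define M where "M = {k. k < N \<and> (\<exists>u\<in>{0..1}. P k u \<in> V)}"
  have k0M: "k0 \<in> M" using k0 V(2) by (auto simp: M_def P_def)
  have PU: "P k u \<in> U" if "k \<in> M" "u \<in> {0..1}" for k u
  proof -
    from \<open>k \<in> M\<close> obtain v where v: "k < N" "v \<in> {0..1}" "P k v \<in> V" by (auto simp: M_def)
    have "dist (P k v) (P k u) < r/2"
      unfolding P_def using piece_diff[OF v(2) that(2), of k] N(2) piece_in[OF v(1)] v(2) that(2)
      by (intro \<delta>(2)) auto
    then have "dist (\<gamma> \<tau>) (P k u) < r"
      using v(3) dist_triangle[of "\<gamma> \<tau>" "P k u" "P k v"] by (simp add: V_def)
    moreover have "P k u \<in> X"
      using L(2) piece_in[OF v(1) that(2)] by (auto simp: P_def)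
    ultimately show ?thesis using r(2) by auto
  qed
  define good where "good k q \<longleftrightarrow> path q \<and> pathstart q = P k 0 \<and> pathfinish q = P k 1 \<and>
     path_image q \<subseteq> U \<and> (arc q \<or> path_image q = {P k 0})" for k q
  have "\<exists>q. good k q" if "k \<in> M" for k
  proof (cases "P k 0 = P k 1")
    case True
    then show ?thesis
      using PU[OF that, of 0] by (intro exI[of _ "\<lambda>_. P k 0"]) (simp add: good_def path_def pathstart_def pathfinish_def path_image_def)
  next
    case False
    have "P k 0 \<in> U" "P k 1 \<in> U" using PU[OF that] by simp_all
    then obtain p where p: "path p" "path_image p \<subseteq> U" "pathstart p = P k 0" "pathfinish p = P k 1"
      using pcU unfolding path_connected_def by blast
    then obtain q where "arc q" "path_image q \<subseteq> path_image p" "pathstart q = pathstart p" "pathfinish q = pathfinish p"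
      using path_contains_arc_metric[OF p(1)] False by metis
    then have "good k q" using p by (auto simp: good_def arc_imp_path)
    then show ?thesis by blast
  qed
  then obtain \<alpha> where \<alpha>: "\<And>k. k \<in> M \<Longrightarrow> good k (\<alpha> k)" by metis
  \<comment> \<open>The path \<open>\<kappa>\<close> covers the original images of all pieces that
    meet \<open>V\<close>; put in place of the piece through \<open>\<tau>\<close>, it keeps the new
    loop surjective.\<close>
  obtain \<kappa> where \<kappa>: "path \<kappa>" "pathstart \<kappa> = P k0 0" "pathfinish \<kappa> = P k0 1" "path_image \<kappa> \<subseteq> U"
    "\<And>k. k \<in> M \<Longrightarrow> path_image (P k) \<subseteq> path_image \<kappa>"
  proof -
    define f where "f k = (if k \<in> M then P k else P k0)" for k
    have "path (P k) \<and> path_image (P k) \<subseteq> U" if "k \<in> M" for k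
    proof -
      have "k < N" using that by (simp add: M_def)
      then show ?thesis using PU[OF that] Pcont by (auto simp: path_def path_image_def)
    qed
    then have f: "path (f k) \<and> path_image (f k) \<subseteq> U" for k
      using k0M by (simp add: f_def)
    obtain \<kappa> where \<kappa>: "path \<kappa>" "pathstart \<kappa> = P k0 0" "pathfinish \<kappa> = P k0 1" "path_image \<kappa> \<subseteq> U"
      "\<And>k. k < N \<Longrightarrow> path_image (f k) \<subseteq> path_image \<kappa>"
      using path_through_finitely_many_paths[OF pcU _ _ _, of "P k0 1" N f "P k0 0"] f PU[OF k0M] by auto
    have "path_image (P k) \<subseteq> path_image \<kappa>" if "k \<in> M" for k
      using \<kappa>(5)[of k] that by (simp add: M_def f_def)
    then show thesis using that \<kappa>(1-4) by blast
  qed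
  define \<pi> where "\<pi> k = (if k = k0 then \<kappa> else if k \<in> M then \<alpha> k else P k)" for k
  have \<pi>01: "\<pi> k 0 = P k 0" "\<pi> k 1 = P k 1" for k
    using \<kappa> \<alpha>[of k] by (auto simp: \<pi>_def good_def pathstart_def pathfinish_def)
  have \<pi>cont: "continuous_on {0..1} (\<pi> k)" if "k < N" for k
    using \<kappa> \<alpha>[of k] Pcont[OF that] by (auto simp: \<pi>_def good_def path_def)
  have \<pi>U: "\<pi> k u \<in> U" if "k \<in> M" "u \<in> {0..1}" for k u
  proof -
    have "\<alpha> k ` {0..1} \<subseteq> U" "\<kappa> ` {0..1} \<subseteq> U"
      using \<kappa>(4) \<alpha>[OF that(1)] unfolding good_def path_image_def by blast+
    then show ?thesis using that by (simp add: \<pi>_def image_subset_iff)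
  qed
  have \<pi>P: "\<pi> k = P k" if "k \<notin> M" for k using that k0M by (auto simp: \<pi>_def)
  obtain \<gamma>' where \<gamma>': "continuous_on {0..1} \<gamma>'"
    "\<And>k u. k < N \<Longrightarrow> u \<in> {0..1} \<Longrightarrow> \<gamma>' ((real k + u) / real N) = \<pi> k u"
    using paste_pieces[of N \<pi>, OF N(1) \<pi>cont] \<pi>01 Pmatch by metis
  have cmp: "\<gamma>' t = \<gamma> t \<or> \<gamma>' t \<in> U \<and> \<gamma> t \<in> U" if t: "t \<in> {0..1}" for t
  proof -
    obtain k u where ku: "k < N" "u \<in> {0..1}" "t = (real k + u) / real N"
      by (rule unit_interval_piece[OF N(1) t])
    then show ?thesis
      using \<gamma>'(2)[OF ku(1,2)] \<pi>U[of k u] PU[of k u] \<pi>P[of k] by (cases "k \<in> M") (auto simp: P_def)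
  qed
  have fib: "\<gamma>' t = x \<longleftrightarrow> \<gamma> t = x" if "t \<in> {0..1}" "x \<in> \<Union>(edges X)" for t x
  proof -
    have "x \<notin> U" using that(2) UX(3) by (metis disjoint_iff)
    then show ?thesis using cmp[OF that(1)] by metis
  qed
  have "mono_loop X b \<gamma>'"
    unfolding mono_loop_def
  proof (intro conjI ballI allI impI)
    show "\<gamma>' ` {0..1} = X"
    proof (intro equalityI subsetI)
      fix x assume "x \<in> \<gamma>' ` {0..1}"
      then obtain t where t: "t \<in> {0..1}" "x = \<gamma>' t" by blast
      then show "x \<in> X" using cmp[OF t(1)] UX(1) L(2) by auto
    next
      fix x assume "x \<in> X"
      then obtain t where t: "t \<in> {0..1}" "x = \<gamma> t" using L(2) by blast
      obtain k u where ku: "k < N" "u \<in> {0..1}" "t = (real k + u) / real N"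
        by (rule unit_interval_piece[OF N(1) t(1)])
      show "x \<in> \<gamma>' ` {0..1}"
      proof (cases "k \<in> M")
        case True
        then have "x \<in> path_image \<kappa>"
          using \<kappa>(5)[of k] ku t by (auto simp: path_image_def P_def)
        then obtain v where "v \<in> {0..1}" "x = \<kappa> v" by (auto simp: path_image_def)
        then have "x = \<gamma>' ((real k0 + v) / real N)" "(real k0 + v) / real N \<in> {0..1}"
          using \<gamma>'(2)[OF k0(1)] piece_in[OF k0(1)] by (simp_all add: \<pi>_def)
        then show ?thesis by blast
      next
        case False
        then have "x = \<gamma>' t" using \<gamma>'(2)[OF ku(1,2)] \<pi>P ku t by (simp add: P_def)
        then show ?thesis using t by blast
      qed
    qed
    show "\<gamma>' 0 = b"
      using \<gamma>'(2)[of 0 0] N(1) \<pi>01(1)[of 0] L(3) by (simp add: P_def)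
    show "\<gamma>' 1 = b"
      using \<gamma>'(2)[of "N - 1" 1] N(1) \<pi>01(2)[of "N - 1"] L(4) by (simp add: P_def)
    fix x s u t assume x: "x \<in> \<Union>(edges X)" and st: "0 \<le> s \<and> s \<le> u \<and> u \<le> t \<and> t \<le> 1 \<and> \<gamma>' s = x \<and> \<gamma>' t = x"
    then have I: "s \<in> {0..1}" "u \<in> {0..1}" "t \<in> {0..1}" by auto
    have "\<gamma> s = x" "\<gamma> t = x" using fib[OF I(1) x] fib[OF I(3) x] st by blast+
    then have "\<gamma> u = x" using st mono_loop_fibre[OF \<gamma> x] by blast
    then show "\<gamma>' u = x" using fib[OF I(2) x] by blast
  qed (rule \<gamma>'(1))
  moreover have "dist (\<gamma>' t) (\<gamma> t) < \<epsilon>" if "t \<in> {0..1}" for t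
    using cmp[OF that] Ud \<epsilon> by auto
  moreover have "\<gamma>' ` ({0..1} - {c<..<d}) \<noteq> X"
  proof -
    \<comment> \<open>A rerouting path covers no nonempty open part of \<open>U\<close>: inside an
      arc such a part would contain an open arc and hence meet an edge, and an open point would be
      all of the connected space \<open>X\<close>.\<close>
    have nd: "\<not> W \<subseteq> path_image (\<alpha> k)" if k: "k \<in> M" and W: "openin (top_of_set X) W" "W \<noteq> {}" "W \<subseteq> U" for k W
    proof
      assume sub: "W \<subseteq> path_image (\<alpha> k)"
      consider "arc (\<alpha> k)" | "path_image (\<alpha> k) = {P k 0}"
        using \<alpha>[OF k] by (auto simp: good_def)
      then show False
      proof cases
        case 1
        obtain A where A: "open_arc_in X A" "A \<subseteq> W"
          using openin_subset_arc_contains_open_arc[OF 1 _ W(1,2) sub] \<alpha>[OF k] UX(1) by (auto simp: good_def)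
        obtain e where e: "e \<in> edges X" "A \<subseteq> e"
          using open_arc_subset_edge[OF A(1)] SP(5) by metis
        have "A \<noteq> {}" using A(1) by (auto simp: open_arc_in_def)
        then show False using A(2) W(3) e UX(3) by blast
      next
        case 2
        then have "W = {P k 0}" using sub W(2) by (metis subset_singletonD)
        then have "closedin (top_of_set X) W"
          using subset_trans[OF W(3) UX(1)] by (intro closed_subset) simp_all
        then have "W = X" using SP(2) W(1,2) unfolding connected_clopen by blast
        then show False using W(3) UX(2) L(2,3) by force
      qed
    qed
    \<comment> \<open>A point of \<open>V\<close> off all rerouting paths is reached only by the
      piece with index \<open>k0\<close>, since pieces outside \<open>M\<close> do not meet
      \<open>V\<close> at all.\<close>
    have "V - (\<Union>k\<in>M. path_image (\<alpha> k)) \<noteq> {}"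
    proof (rule openin_minus_nowhere_dense[of M "\<lambda>k. path_image (\<alpha> k)" X U V])
      show "closed (path_image (\<alpha> k))" if "k \<in> M" for k
        using \<alpha>[OF that] by (simp add: good_def closed_path_image)
    qed (use nd V in \<open>auto simp: M_def\<close>)
    then obtain y where y: "y \<in> V" "\<And>k. k \<in> M \<Longrightarrow> y \<notin> path_image (\<alpha> k)" by blast
    have "y \<noteq> \<gamma>' t" if t: "t \<in> {0..1} - {c<..<d}" for t
    proof -
      from t have "t \<in> {0..1}" by blast
      then obtain k u where ku: "k < N" "u \<in> {0..1}" "t = (real k + u) / real N"
        by (rule unit_interval_piece[OF N(1)])
      have "k \<noteq> k0" using k0_in[OF ku(2)] ku(3) t by blast
      then have "\<gamma>' t = (if k \<in> M then \<alpha> k u else P k u)"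
        using \<gamma>'(2)[OF ku(1,2)] ku(3) by (simp add: \<pi>_def)
      moreover have "k \<in> M" if "P k u = y" using that ku y(1) by (auto simp: M_def)
      ultimately show ?thesis using y(2)[of k] ku(2) by (auto simp: path_image_def)
    qed
    then have "y \<notin> \<gamma>' ` ({0..1} - {c<..<d})" by blast
    moreover have "y \<in> X" using y(1) by (simp add: V_def)
    ultimately show ?thesis by blast
  qed
  ultimately show thesis using that by blast
qed

section \<open>Reparametrisation and exchange of stretches\<close>

lemma mono_loop_compose:
  fixes X :: "'a::metric_space set"
  assumes \<gamma>: "mono_loop X b \<gamma>" and \<phi>: "continuous_on {0..1} \<phi>" "\<phi> 0 = 0" "\<phi> 1 = 1"
    "\<And>s t. 0 \<le> s \<Longrightarrow> s \<le> t \<Longrightarrow> t \<le> 1 \<Longrightarrow> \<phi> s \<le> \<phi> t"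
  shows "mono_loop X b (\<gamma> \<circ> \<phi>)"
proof -
  note L = mono_loopD[OF \<gamma>]
  have r: "0 \<le> \<phi> t \<and> \<phi> t \<le> 1" if "0 \<le> t" "t \<le> 1" for t
    using \<phi>(4)[of 0 t] \<phi>(4)[of t 1] \<phi>(2,3) that by auto
  have im: "\<phi> ` {0..1} = {0..1}"
  proof (intro equalityI subsetI)
    fix y :: real assume "y \<in> {0..1}"
    then obtain x where "0 \<le> x" "x \<le> 1" "\<phi> x = y"
      using IVT'[of \<phi> 0 y 1] \<phi>(1-3) by auto
    then show "y \<in> \<phi> ` {0..1}" by auto
  qed (use r in auto)
  show ?thesis
    unfolding mono_loop_def
  proof (intro conjI ballI allI impI)
    show "continuous_on {0..1} (\<gamma> \<circ> \<phi>)"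
      using \<phi>(1) L(1) im by (intro continuous_on_compose) simp_all
    show "(\<gamma> \<circ> \<phi>) ` {0..1} = X" using im L(2) by (metis image_comp)
    show "(\<gamma> \<circ> \<phi>) 0 = b" "(\<gamma> \<circ> \<phi>) 1 = b" using L \<phi> by simp_all
    fix x s u t assume x: "x \<in> \<Union>(edges X)"
      and st: "0 \<le> s \<and> s \<le> u \<and> u \<le> t \<and> t \<le> 1 \<and> (\<gamma> \<circ> \<phi>) s = x \<and> (\<gamma> \<circ> \<phi>) t = x"
    show "(\<gamma> \<circ> \<phi>) u = x"
      using mono_loop_fibre[OF \<gamma> x, of "\<phi> s" "\<phi> u" "\<phi> t"] st r[of s] r[of t] \<phi>(4)[of s u] \<phi>(4)[of u t]
      by simp
  qed
qed

lemma mono_loop_reverse: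
  fixes X :: "'a::metric_space set"
  assumes \<gamma>: "mono_loop X b \<gamma>"
  shows "mono_loop X b (\<lambda>t. \<gamma> (1 - t))"
proof -
  note L = mono_loopD[OF \<gamma>]
  have im: "(\<lambda>t. 1 - t) ` {0..1::real} = {0..1}"
  proof (intro equalityI subsetI)
    fix y :: real assume "y \<in> {0..1}"
    then show "y \<in> (\<lambda>t. 1 - t) ` {0..1}" by (intro image_eqI[of _ _ "1 - y"]) auto
  qed auto
  show ?thesis
    unfolding mono_loop_def
  proof (intro conjI ballI allI impI)
    show "continuous_on {0..1} (\<lambda>t. \<gamma> (1 - t))"
      by (rule continuous_on_compose2[OF L(1)]) (auto intro!: continuous_intros)
    have "(\<lambda>t. \<gamma> (1 - t)) ` {0..1} = \<gamma> ` (\<lambda>t. 1 - t) ` {0..1}" by (simp only: image_image)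
    then show "(\<lambda>t. \<gamma> (1 - t)) ` {0..1} = X" using im L(2) by simp
    show "\<gamma> (1 - 0) = b" "\<gamma> (1 - 1) = b" using L by simp_all
    fix x s u t assume x: "x \<in> \<Union>(edges X)"
      and st: "0 \<le> s \<and> s \<le> u \<and> u \<le> t \<and> t \<le> 1 \<and> \<gamma> (1 - s) = x \<and> \<gamma> (1 - t) = x"
    show "\<gamma> (1 - u) = x"
      using mono_loop_fibre[OF \<gamma> x, of "1 - t" "1 - u" "1 - s"] st by simp
  qed
qed

text \<open>The first departure from the constant value after \<open>d\<close> is moved forward into
  \<open>{c..d}\<close>. Only times up to shortly after the departure are affected, and there the
  loop is still close to \<open>m\<close>, so the change is small.\<close>

lemma mono_loop_stretch_right:
  fixes X :: "'a::metric_space set"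
  assumes \<gamma>: "mono_loop X b \<gamma>" and \<epsilon>: "\<epsilon> > 0" and cd: "0 \<le> c" "c < d" "d \<le> 1"
    and const: "\<And>t. t \<in> {c..d} \<Longrightarrow> \<gamma> t = m" and u: "u \<in> {d..1}" "\<gamma> u \<noteq> m"
  obtains \<gamma>' where "mono_loop X b \<gamma>'" "\<And>t. t \<in> {0..1} \<Longrightarrow> dist (\<gamma>' t) (\<gamma> t) < \<epsilon>"
    "\<exists>t\<in>{c..d}. \<gamma>' t \<noteq> \<gamma>' c"
proof -
  note L = mono_loopD[OF \<gamma>]
  obtain \<delta> where \<delta>: "\<delta> > 0" "\<And>s t. s \<in> {0..1} \<Longrightarrow> t \<in> {0..1} \<Longrightarrow> \<bar>s - t\<bar> < \<delta> \<Longrightarrow> dist (\<gamma> s) (\<gamma> t) < \<epsilon>/4"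
    using uniform_modulus[OF L(1), of "\<epsilon>/4"] \<epsilon> by auto
  define A where "A = {u \<in> {d..1}. \<gamma> u \<noteq> m}"
  have A: "A \<noteq> {}" "bdd_below A" using u by (auto simp: A_def intro: bdd_belowI[of _ d])
  define b' where "b' = Inf A"
  have b': "d \<le> b'" unfolding b'_def by (rule cInf_greatest[OF A(1)]) (simp add: A_def)
  have before: "\<gamma> t = m" if "c \<le> t" "t < b'" for t
  proof (cases "t \<le> d")
    case False
    have "b' \<le> 1" using cInf_lower[OF _ A(2), of u] u by (simp add: A_def b'_def)
    moreover have "t \<notin> A" using cInf_lower[OF _ A(2), of t] that by (auto simp: b'_def)
    ultimately show ?thesis using False that by (auto simp: A_def)
  qed (use const that in auto)
  obtain v where v: "v \<in> A" "v < b' + \<delta>"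
    using cInf_lessD[OF A(1), of "b' + \<delta>"] \<delta>(1) by (auto simp: b'_def)
  have vb: "b' \<le> v" using cInf_lower[OF v(1) A(2)] by (simp add: b'_def)
  have v1: "d \<le> v" "v \<le> 1" "\<gamma> v \<noteq> m" using v(1) by (auto simp: A_def)
  \<comment> \<open>A time just before \<open>b'\<close> at which the value is certainly
    \<open>m\<close>; comparison with it shows that the loop at \<open>b'\<close> is still close to
    \<open>m\<close>.\<close>
  define w where "w = max c (b' - \<delta>/2)"
  have w: "c \<le> w" "w < b'" "b' - w < \<delta>" using \<delta>(1) b' cd by (auto simp: w_def)
  have near: "dist (\<gamma> t) m < \<epsilon>/2" if "c \<le> t" "t \<le> v" for t
  proof (cases "t < b'")
    case True
    then show ?thesis using before that \<epsilon> by simp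
  next
    case False
    have "dist (\<gamma> t) (\<gamma> b') < \<epsilon>/4" "dist (\<gamma> b') (\<gamma> w) < \<epsilon>/4"
      by (rule \<delta>(2); use False that v v1 vb w cd b' in auto)+
    then show ?thesis using before[OF w(1,2)] dist_triangle[of "\<gamma> t" m "\<gamma> b'"] by simp
  qed
  define d' where "d' = (c + d) / 2"
  have d': "c < d'" "d' < d" using cd by (auto simp: d'_def)
  define K where "K = (v - c) / (d' - c)"
  have K: "K \<ge> 1" using d' v1 by (simp add: K_def)
  \<comment> \<open>The new clock runs from \<open>c\<close> to \<open>v\<close> during
    \<open>{c..d'}\<close>, waits at \<open>v\<close>, and agrees with the old one from
    \<open>v\<close> on. The maximum with \<open>t\<close> also makes it the identity before
    \<open>c\<close>, as \<open>K\<close> is at least 1.\<close>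
  define \<phi> where "\<phi> t = max t (min v (c + K * (t - c)))" for t
  have \<phi>1: "\<phi> t = t" if "t \<le> c \<or> v \<le> t" for t
  proof (cases "v \<le> t")
    case False
    then have "t \<le> c" using that by simp
    then have "K * (t - c) \<le> 1 * (t - c)" using K by (intro mult_right_mono_neg) auto
    then show ?thesis by (simp add: \<phi>_def)
  qed (simp add: \<phi>_def)
  have \<phi>2: "c \<le> \<phi> t \<and> \<phi> t \<le> v" if "c \<le> t" "t \<le> v" for t
    using that by (auto simp: \<phi>_def)
  have \<phi>mono: "\<phi> s \<le> \<phi> t" if "s \<le> t" for s t
  proof -
    have "K * (s - c) \<le> K * (t - c)" using K that by (intro mult_left_mono) auto
    then show ?thesis using that unfolding \<phi>_def by (intro max.mono min.mono) auto
  qed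
  have \<phi>d': "\<phi> d' = v" using d' v1 by (simp add: \<phi>_def K_def)
  have "mono_loop X b (\<gamma> \<circ> \<phi>)"
  proof (rule mono_loop_compose[OF \<gamma>])
    show "continuous_on {0..1} \<phi>" unfolding \<phi>_def by (intro continuous_intros)
  qed (use \<phi>1 \<phi>mono cd v1 in auto)
  moreover have "dist ((\<gamma> \<circ> \<phi>) t) (\<gamma> t) < \<epsilon>" for t
  proof (cases "t \<le> c \<or> v \<le> t")
    case False
    then have "dist (\<gamma> t) m < \<epsilon>/2" "dist (\<gamma> (\<phi> t)) m < \<epsilon>/2"
      using near[of t] near[of "\<phi> t"] \<phi>2[of t] by auto
    then show ?thesis using dist_triangle2[of "\<gamma> (\<phi> t)" "\<gamma> t" m] by simp
  qed (use \<phi>1 \<epsilon> in auto)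
  moreover have "(\<gamma> \<circ> \<phi>) d' \<noteq> (\<gamma> \<circ> \<phi>) c"
    using \<phi>d' \<phi>1[of c] const[of c] cd v1 by simp
  then have "\<exists>t\<in>{c..d}. (\<gamma> \<circ> \<phi>) t \<noteq> (\<gamma> \<circ> \<phi>) c" using d' by (intro bexI[of _ d']) auto
  ultimately show thesis using that by blast
qed

text \<open>A loop that is constant on \<open>{c..d}\<close> takes another value somewhere, since
  \<open>X\<close> has two points. If that happens before \<open>c\<close>, time is
  reversed.\<close>

lemma mono_loop_stretch:
  fixes X :: "'a::metric_space set"
  assumes \<gamma>: "mono_loop X b \<gamma>" and \<epsilon>: "\<epsilon> > 0" and cd: "0 \<le> c" "c < d" "d \<le> 1"
    and X: "x \<in> X" "y \<in> X" "x \<noteq> y"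
  obtains \<gamma>' where "mono_loop X b \<gamma>'" "\<And>t. t \<in> {0..1} \<Longrightarrow> dist (\<gamma>' t) (\<gamma> t) < \<epsilon>"
    "\<exists>t\<in>{c..d}. \<gamma>' t \<noteq> \<gamma>' c"
proof (cases "\<exists>t\<in>{c..d}. \<gamma> t \<noteq> \<gamma> c")
  case True
  then show ?thesis using that \<gamma> \<epsilon> by (metis dist_self)
next
  case False
  note L = mono_loopD[OF \<gamma>]
  have const: "\<gamma> t = \<gamma> c" if "t \<in> {c..d}" for t using False that by blast
  obtain u where u: "u \<in> {0..1}" "\<gamma> u \<noteq> \<gamma> c"
    using X L(2) by (metis imageE)
  show ?thesis
  proof (cases "u \<ge> d")
    case True
    then show ?thesis
      using mono_loop_stretch_right[OF \<gamma> \<epsilon> cd const] u that by (metis atLeastAtMost_iff)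
  next
    case False
    then have "u \<le> c" using u const[of u] by force
    have const': "\<gamma> (1 - t) = \<gamma> c" if "t \<in> {1-d..1-c}" for t
      using const[of "1 - t"] that by simp
    obtain \<gamma>1 where g1: "mono_loop X b \<gamma>1" "\<And>t. t \<in> {0..1} \<Longrightarrow> dist (\<gamma>1 t) (\<gamma> (1 - t)) < \<epsilon>"
      "\<exists>t\<in>{1-d..1-c}. \<gamma>1 t \<noteq> \<gamma>1 (1-d)"
    proof (rule mono_loop_stretch_right[OF mono_loop_reverse[OF \<gamma>] \<epsilon>, of "1-d" "1-c" "\<gamma> c" "1-u"])
      show "1 - u \<in> {1-c..1}" using u \<open>u \<le> c\<close> by simp
      show "\<gamma> (1 - (1 - u)) \<noteq> \<gamma> c" using u by simp
    qed (use cd const' in auto)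
    define \<gamma>2 where "\<gamma>2 = (\<lambda>t. \<gamma>1 (1 - t))"
    have "mono_loop X b \<gamma>2" using mono_loop_reverse[OF g1(1)] unfolding \<gamma>2_def .
    moreover have "dist (\<gamma>2 t) (\<gamma> t) < \<epsilon>" if "t \<in> {0..1}" for t
      using g1(2)[of "1 - t"] that by (simp add: \<gamma>2_def)
    moreover have "\<exists>t\<in>{c..d}. \<gamma>2 t \<noteq> \<gamma>2 c"
    proof (rule ccontr)
      assume "\<not> ?thesis"
      then have *: "\<gamma>1 (1 - t) = \<gamma>1 (1 - c)" if "t \<in> {c..d}" for t
        using that unfolding \<gamma>2_def by blast
      obtain t where t: "t \<in> {1-d..1-c}" "\<gamma>1 t \<noteq> \<gamma>1 (1-d)" using g1(3) by blast
      have "1 - t \<in> {c..d}" "d \<in> {c..d}" using t cd by simp_all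
      from *[OF this(1)] *[OF this(2)] t(2) show False by simp
    qed
    ultimately show ?thesis using that by blast
  qed
qed

text \<open>Two disjoint stretches with common end values are exchanged by a piecewise affine
  involution of time, which reverses direction when \<open>t1 < t0\<close>. The fibre over an edge
  point is an interval that avoids the four end times, as these lie over the ground space; so it
  lies in one stretch or outside both, and is mapped monotonically.\<close>

lemma mono_loop_swap:
  fixes X :: "'a::metric_space set"
  assumes \<gamma>: "mono_loop X b \<gamma>" and s: "0 \<le> s0" "s0 < s1" "s1 \<le> 1"
    and t: "t0 \<in> {0..1}" "t1 \<in> {0..1}" "t0 \<noteq> t1"
    and disj: "{s0..s1} \<inter> {min t0 t1..max t0 t1} = {}"
    and eq: "\<gamma> s0 = \<gamma> t0" "\<gamma> s1 = \<gamma> t1" and ground: "\<gamma> s0 \<notin> \<Union>(edges X)" "\<gamma> s1 \<notin> \<Union>(edges X)"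
  obtains \<gamma>' where "mono_loop X b \<gamma>'"
    "\<And>t. t \<in> {0..1} \<Longrightarrow> \<gamma>' t = \<gamma> t \<or> t \<in> {s0..s1} \<and> \<gamma>' t \<in> \<gamma> ` {min t0 t1..max t0 t1} \<or>
       t \<in> {min t0 t1..max t0 t1} \<and> \<gamma>' t \<in> \<gamma> ` {s0..s1}"
    "\<And>\<tau> t. s0 < \<tau> \<Longrightarrow> \<tau> < s1 \<Longrightarrow> \<gamma> \<tau> \<in> \<Union>(edges X) \<Longrightarrow> t \<in> {0..1} \<Longrightarrow> \<gamma>' t = \<gamma> \<tau> \<Longrightarrow>
       t \<in> {min t0 t1..max t0 t1}"
proof -
  note L = mono_loopD[OF \<gamma>]
  define I where "I = {s0..s1}"
  define lo where "lo = min t0 t1"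
  define hi where "hi = max t0 t1"
  define T where "T = {lo..hi}"
  have lohi: "0 \<le> lo" "lo < hi" "hi \<le> 1" using t by (auto simp: lo_def hi_def)
  have IT: "I \<inter> T = {}" using disj by (simp add: I_def T_def lo_def hi_def)
  have I01: "I \<subseteq> {0..1}" and T01: "T \<subseteq> {0..1}" using s lohi by (auto simp: I_def T_def)
  define f where "f r = t0 + (r - s0) * (t1 - t0) / (s1 - s0)" for r
  define g where "g r = s0 + (r - t0) * (s1 - s0) / (t1 - t0)" for r
  have gf: "g (f r) = r" and fg: "f (g r) = r" for r
    using s t by (simp_all add: f_def g_def)
  have fT: "f r \<in> T" if "r \<in> I" for r
  proof -
    define q where "q = (r - s0) / (s1 - s0)"
    have q: "0 \<le> q" "q \<le> 1" "f r = t0 + q * (t1 - t0)"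
      using that s by (auto simp: q_def I_def f_def divide_simps)
    show ?thesis
    proof (cases "t0 \<le> t1")
      case True
      then have "0 \<le> q * (t1 - t0)" "q * (t1 - t0) \<le> 1 * (t1 - t0)"
        using q by (intro mult_right_mono mult_nonneg_nonneg; simp)+
      then show ?thesis using True q by (simp add: T_def lo_def hi_def)
    next
      case False
      then have "0 \<le> q * (t0 - t1)" "q * (t0 - t1) \<le> 1 * (t0 - t1)"
        using q by (intro mult_right_mono mult_nonneg_nonneg; simp)+
      then show ?thesis using False q by (simp add: T_def lo_def hi_def algebra_simps)
    qed
  qed
  have gI: "g r \<in> I" if "r \<in> T" for r
  proof -
    define q where "q = (r - t0) / (t1 - t0)"
    have q: "0 \<le> q" "q \<le> 1"
      using that t(3) by (auto simp: q_def T_def lo_def hi_def divide_simps min_def max_def split: if_splits)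
    have "g r = s0 + q * (s1 - s0)" by (simp add: q_def g_def)
    moreover have "0 \<le> q * (s1 - s0)" "q * (s1 - s0) \<le> 1 * (s1 - s0)"
      using q s by (intro mult_right_mono mult_nonneg_nonneg; simp)+
    ultimately show ?thesis by (simp add: I_def)
  qed
  have fend: "f s0 = t0" "f s1 = t1" using s by (simp_all add: f_def)
  have gend: "g t0 = s0" "g t1 = s1" using t by (simp_all add: g_def)
  define \<Theta> where "\<Theta> r = (if r \<in> I then f r else if r \<in> T then g r else r)" for r
  have \<Theta>I: "\<Theta> r = f r" if "r \<in> I" for r using that by (simp add: \<Theta>_def)
  have \<Theta>T: "\<Theta> r = g r" if "r \<in> T" for r using that IT by (auto simp: \<Theta>_def)
  have \<Theta>N: "\<Theta> r = r" if "r \<notin> I" "r \<notin> T" for r using that by (simp add: \<Theta>_def)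
  have \<Theta>01: "\<Theta> r \<in> {0..1}" if "r \<in> {0..1}" for r
    using that fT[of r] gI[of r] I01 T01 unfolding \<Theta>_def by (metis subsetD)
  have \<Theta>\<Theta>: "\<Theta> (\<Theta> r) = r" for r
  proof (cases "r \<in> I \<or> r \<in> T")
    case True
    then show ?thesis using \<Theta>I \<Theta>T fT gI fg gf by metis
  qed (use \<Theta>N in auto)
  define \<gamma>' where "\<gamma>' r = \<gamma> (\<Theta> r)" for r
  \<comment> \<open>At the four end times the involution is not the identity, but the values agree
    by \<open>eq\<close>. Hence the unchanged part can be taken closed, as pasting of continuous
    maps requires.\<close>
  define R where "R = {0..1} - {s0<..<s1} - {lo<..<hi}"
  have \<gamma>R: "\<gamma>' r = \<gamma> r" if "r \<in> R" for r
  proof -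
    have "r = s0 \<or> r = s1 \<or> r = lo \<or> r = hi \<or> r \<notin> I \<and> r \<notin> T"
      using that by (auto simp: R_def I_def T_def)
    then consider "r = s0" | "r = s1" | "r = lo" | "r = hi" | "r \<notin> I" "r \<notin> T"
      by blast
    then show ?thesis
    proof cases
      case 1 then show ?thesis using \<Theta>I[of s0] s fend eq by (simp add: \<gamma>'_def I_def)
    next
      case 2 then show ?thesis using \<Theta>I[of s1] s fend eq by (simp add: \<gamma>'_def I_def)
    next
      case 3
      then show ?thesis using \<Theta>T[of lo] lohi gend eq by (auto simp: \<gamma>'_def T_def lo_def min_def)
    next
      case 4
      then show ?thesis using \<Theta>T[of hi] lohi gend eq by (auto simp: \<gamma>'_def T_def hi_def max_def)
    qed (simp add: \<gamma>'_def \<Theta>N)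
  qed
  have cont: "continuous_on {0..1} \<gamma>'"
  proof -
    have "continuous_on I \<gamma>'"
    proof (rule continuous_on_eq)
      show "continuous_on I (\<lambda>r. \<gamma> (f r))"
        by (rule continuous_on_compose2[OF L(1)]) (use fT T01 s in \<open>auto simp: f_def intro!: continuous_intros\<close>)
    qed (simp add: \<gamma>'_def \<Theta>I)
    moreover have "continuous_on T \<gamma>'"
    proof (rule continuous_on_eq)
      show "continuous_on T (\<lambda>r. \<gamma> (g r))"
        by (rule continuous_on_compose2[OF L(1)]) (use gI I01 t in \<open>auto simp: g_def intro!: continuous_intros\<close>)
    qed (simp add: \<gamma>'_def \<Theta>T)
    moreover have "continuous_on R \<gamma>'"
    proof (rule continuous_on_eq)
      show "continuous_on R \<gamma>" using L(1) by (rule continuous_on_subset) (auto simp: R_def)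
    qed (simp add: \<gamma>R)
    moreover have "closed I" "closed T" "closed R"
      unfolding I_def T_def R_def by (auto intro!: closed_Diff)
    ultimately have "continuous_on (I \<union> (T \<union> R)) \<gamma>'"
      by (intro continuous_on_closed_Un closed_Un)
    moreover have "{0..1} \<subseteq> I \<union> (T \<union> R)"
      by (auto simp: I_def T_def R_def)
    ultimately show ?thesis by (rule continuous_on_subset)
  qed
  have endpts: "\<gamma> t0 \<notin> \<Union>(edges X)" "\<gamma> t1 \<notin> \<Union>(edges X)" using ground eq by simp_all
  have fibI: "v \<in> I \<longleftrightarrow> w \<in> I" and fibT: "v \<in> T \<longleftrightarrow> w \<in> T"
    if vw: "v \<in> {0..1}" "w \<in> {0..1}" "\<gamma> v = \<gamma> w" "\<gamma> v \<in> \<Union>(edges X)" for v w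
  proof -
    have ground': "\<gamma> z \<notin> \<Union>(edges X)" if "z \<in> {s0, s1, t0, t1}" for z
      using that ground endpts by (elim insertE emptyE) simp_all
    have v01: "0 \<le> v" "v \<le> 1" "0 \<le> w" "w \<le> 1" using vw(1,2) by simp_all
    have btw: "\<not> (v \<le> z \<and> z \<le> w)" "\<not> (w \<le> z \<and> z \<le> v)" if "z \<in> {s0, s1, t0, t1}" for z
      using mono_loop_fibre[OF \<gamma> vw(4), of v z w] mono_loop_fibre[OF \<gamma> vw(4), of w z v]
        ground'[OF that] vw(3,4) v01 by metis+
    have z: "\<not> (v \<le> lo \<and> lo \<le> w)" "\<not> (w \<le> lo \<and> lo \<le> v)" "\<not> (v \<le> hi \<and> hi \<le> w)" "\<not> (w \<le> hi \<and> hi \<le> v)"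
      using btw[of t0] btw[of t1] unfolding lo_def hi_def min_def max_def by simp_all
    show "v \<in> I \<longleftrightarrow> w \<in> I"
      using btw[of s0] btw[of s1] unfolding I_def atLeastAtMost_iff by (smt (verit) insertCI)
    show "v \<in> T \<longleftrightarrow> w \<in> T"
      using z unfolding T_def atLeastAtMost_iff by (smt (verit))
  qed
  have "mono_loop X b \<gamma>'"
    unfolding mono_loop_def
  proof (intro conjI ballI allI impI)
    show "\<gamma>' ` {0..1} = X"
    proof (intro equalityI subsetI)
      fix x assume "x \<in> \<gamma>' ` {0..1}"
      then show "x \<in> X" using \<Theta>01 L(2) by (auto simp: \<gamma>'_def)
    next
      fix x assume "x \<in> X"
      then obtain r where r: "r \<in> {0..1}" "x = \<gamma> r" using L(2) by blast
      then have "x = \<gamma>' (\<Theta> r)" by (simp add: \<gamma>'_def \<Theta>\<Theta>)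
      then show "x \<in> \<gamma>' ` {0..1}" using \<Theta>01[OF r(1)] by blast
    qed
    have "0 \<in> R" "1 \<in> R" using s lohi by (auto simp: R_def)
    then show "\<gamma>' 0 = b" "\<gamma>' 1 = b" using \<gamma>R L(3,4) by simp_all
    fix x v u w assume x: "x \<in> \<Union>(edges X)" and "0 \<le> v \<and> v \<le> u \<and> u \<le> w \<and> w \<le> 1 \<and> \<gamma>' v = x \<and> \<gamma>' w = x"
    then have vw: "v \<in> {0..1}" "w \<in> {0..1}" "u \<in> {0..1}" "v \<le> u" "u \<le> w" "\<gamma> (\<Theta> v) = x" "\<gamma> (\<Theta> w) = x"
      by (auto simp: \<gamma>'_def)
    note F = fibI[of "\<Theta> v" "\<Theta> w"] fibT[of "\<Theta> v" "\<Theta> w"]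
    have flip: "\<Theta> r \<in> I \<longleftrightarrow> r \<in> T" "\<Theta> r \<in> T \<longleftrightarrow> r \<in> I" for r
      using \<Theta>I \<Theta>T \<Theta>N fT gI IT by (metis disjoint_iff)+
    \<comment> \<open>Two times with the same edge value lie in the same part, and the involution is
      monotone on each part; so an intermediate time stays between them, possibly in reversed
      order.\<close>
    have btw: "\<Theta> v \<le> \<Theta> u \<and> \<Theta> u \<le> \<Theta> w \<or> \<Theta> w \<le> \<Theta> u \<and> \<Theta> u \<le> \<Theta> v"
    proof -
      consider "v \<in> I" "w \<in> I" | "v \<in> T" "w \<in> T" | "v \<notin> I" "w \<notin> I" "v \<notin> T" "w \<notin> T"
        using F flip \<Theta>01 vw x by metis
      then show ?thesis
      proof cases
        case 1
        then have "u \<in> I" using vw by (auto simp: I_def)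
        then have "\<Theta> v = f v" "\<Theta> u = f u" "\<Theta> w = f w" using \<Theta>I 1 by simp_all
        moreover have "f v \<le> f u \<and> f u \<le> f w \<or> f w \<le> f u \<and> f u \<le> f v"
        proof (cases "t0 \<le> t1")
          case True
          then show ?thesis using vw s unfolding f_def
            by (auto intro!: divide_right_mono mult_right_mono)
        next
          case False
          then show ?thesis using vw s unfolding f_def
            by (auto intro!: divide_right_mono mult_right_mono_neg)
        qed
        ultimately show ?thesis by simp
      next
        case 2
        then have "u \<in> T" using vw by (auto simp: T_def)
        then have "\<Theta> v = g v" "\<Theta> u = g u" "\<Theta> w = g w" using \<Theta>T 2 by simp_all
        moreover have "g v \<le> g u \<and> g u \<le> g w \<or> g w \<le> g u \<and> g u \<le> g v"
        proof (cases "t0 \<le> t1")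
          case True
          then show ?thesis using vw s unfolding g_def
            by (auto intro!: divide_right_mono mult_right_mono)
        next
          case False
          then show ?thesis using vw s unfolding g_def
            by (auto intro!: divide_right_mono_neg mult_right_mono)
        qed
        ultimately show ?thesis by simp
      next
        case 3
        then have vv: "\<Theta> v = v" "\<Theta> w = w" using \<Theta>N by simp_all
        then have "\<gamma> u = x" using mono_loop_fibre[OF \<gamma> x, of v u w] vw by auto
        then have "\<gamma> v = \<gamma> u" "\<gamma> v \<in> \<Union>(edges X)" using vw vv x by simp_all
        then have "u \<notin> I" "u \<notin> T" using fibI[of v u] fibT[of v u] vw 3 by blast+
        then show ?thesis using vv vw \<Theta>N by simp
      qed
    qed
    then show "\<gamma>' u = x"
      using mono_loop_fibre[OF \<gamma> x, of "\<Theta> v" "\<Theta> u" "\<Theta> w"] mono_loop_fibre[OF \<gamma> x, of "\<Theta> w" "\<Theta> u" "\<Theta> v"]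
        \<Theta>01[of v] \<Theta>01[of w] vw unfolding \<gamma>'_def by auto
  qed (rule cont)
  moreover have "\<gamma>' r = \<gamma> r \<or> r \<in> I \<and> \<gamma>' r \<in> \<gamma> ` T \<or> r \<in> T \<and> \<gamma>' r \<in> \<gamma> ` I" for r
    using fT[of r] gI[of r] unfolding \<gamma>'_def \<Theta>_def by auto
  moreover have "r \<in> T" if "s0 < \<tau>" "\<tau> < s1" "\<gamma> \<tau> \<in> \<Union>(edges X)" "r \<in> {0..1}" "\<gamma>' r = \<gamma> \<tau>" for \<tau> r
  proof -
    have "\<tau> \<in> I" using that by (simp add: I_def)
    then have "\<Theta> r \<in> I"
      using fibI[of \<tau> "\<Theta> r"] \<Theta>01[OF that(4)] I01 that by (auto simp: \<gamma>'_def)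
    then show ?thesis using fT[of "\<Theta> r"] \<Theta>I[of "\<Theta> r"] \<Theta>\<Theta>[of r] by simp
  qed
  ultimately show thesis
    using that[of \<gamma>'] unfolding I_def T_def lo_def hi_def by blast
qed

text \<open>If \<open>\<gamma>\<close> stays in the closure of the edges during \<open>{c<..<d}\<close> without contributing anything, then
  nearby points of this part of the loop are also visited, within a short time interval containing
  an edge traversal, outside \<open>{c<..<d}\<close>. Exchanging the two parts moves that edge into \<open>{c<..<d}\<close>.\<close>
lemma mono_loop_perturb_swap:
  fixes X :: "'a::metric_space set"
  assumes \<gamma>: "mono_loop X b \<gamma>" and \<epsilon>: "\<epsilon> > 0" and cd: "0 \<le> c" "c < d" "d \<le> 1"
    and nonconst: "\<exists>t\<in>{c..d}. \<gamma> t \<noteq> \<gamma> c"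
    and clo: "\<And>\<tau>. c < \<tau> \<Longrightarrow> \<tau> < d \<Longrightarrow> \<gamma> \<tau> \<in> closure (\<Union>(edges X)) \<or> \<gamma> \<tau> = b"
    and onto: "\<gamma> ` ({0..1} - {c<..<d}) = X"
  obtains \<gamma>' where "mono_loop X b \<gamma>'" "\<And>t. t \<in> {0..1} \<Longrightarrow> dist (\<gamma>' t) (\<gamma> t) < \<epsilon>"
    "\<gamma>' ` ({0..1} - {c<..<d}) \<noteq> X"
proof -
  note L = mono_loopD[OF \<gamma>]
  define E where "E = \<Union>(edges X)"
  define C where "C = {0..1} - {c<..<d}"
  have "E \<subseteq> X" by (auto simp: E_def edges_def open_arc_in_def dest: openin_imp_subset)
  have C: "closed C" "C \<subseteq> {0..1}" unfolding C_def by (auto intro!: closed_Diff)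
  \<comment> \<open>By compactness the image of \<open>S\<close> contains the closure of the edges.
    So every value other than \<open>b\<close> taken during \<open>{c<..<d}\<close> recurs at a time
    in \<open>S\<close>, and such a time is a limit of times over edges outside
    \<open>{c<..<d}\<close>.\<close>
  define S where "S = closure (C \<inter> \<gamma> -` E)"
  have SC: "S \<subseteq> C" unfolding S_def using C(1) by (intro closure_minimal) auto
  have "compact S"
  proof -
    have "S = {0..1} \<inter> S" using SC C(2) by blast
    moreover have "closed S" by (simp add: S_def)
    ultimately show ?thesis by (metis compact_Icc compact_Int_closed)
  qed
  moreover have "continuous_on S \<gamma>" using L(1) SC C(2) continuous_on_subset by blast
  ultimately have "compact (\<gamma> ` S)" by (rule compact_continuous_image[rotated])
  moreover have "E \<subseteq> \<gamma> ` S"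
  proof
    fix x assume "x \<in> E"
    then obtain t where "t \<in> C" "x = \<gamma> t" using \<open>E \<subseteq> X\<close> onto unfolding C_def by blast
    then show "x \<in> \<gamma> ` S" using \<open>x \<in> E\<close> closure_subset[of "C \<inter> \<gamma> -` E"] unfolding S_def by blast
  qed
  ultimately have clS: "closure E \<subseteq> \<gamma> ` S"
    using closure_minimal compact_imp_closed by blast
  \<comment> \<open>Infinitely many values are needed to find recurrences close to each other. The
    values at \<open>c\<close> and \<open>d\<close> are excluded because an interval fibre with
    times inside and outside would contain one of these ends; so the remaining recurring values lie
    in the ground space.\<close>
  define Y where "Y = \<gamma> ` {c<..<d} - {b, \<gamma> c, \<gamma> d}"
  have "infinite Y"
  proof
    assume "finite Y"
    have "{c..d} \<subseteq> {c<..<d} \<union> {c, d}" by auto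
    then have "\<gamma> ` {c..d} \<subseteq> Y \<union> {b, \<gamma> c, \<gamma> d}" unfolding Y_def by blast
    then have "finite (\<gamma> ` {c..d})" using \<open>finite Y\<close> finite_subset by blast
    moreover have "connected (\<gamma> ` {c..d})"
      using cd by (intro connected_continuous_image continuous_on_subset[OF L(1)]) auto
    moreover obtain t where "t \<in> {c..d}" "\<gamma> t \<noteq> \<gamma> c" using nonconst by blast
    ultimately show False
      using connected_uncountable[of "\<gamma> ` {c..d}" "\<gamma> t" "\<gamma> c"] cd countable_finite by auto
  qed
  then obtain y :: "nat \<Rightarrow> 'a" where y: "inj y" "range y \<subseteq> Y"
    using infinite_countable_subset by blast
  have "\<exists>t. t \<in> {c<..<d} \<and> \<gamma> t = y n" for n
  proof -
    have "y n \<in> \<gamma> ` {c<..<d}" using y(2) unfolding Y_def by blast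
    then show ?thesis by (auto simp: image_iff)
  qed
  then obtain t where t: "\<And>n. t n \<in> {c<..<d}" "\<And>n. \<gamma> (t n) = y n" by metis
  have yb: "y n \<noteq> b" "y n \<noteq> \<gamma> c" "y n \<noteq> \<gamma> d" for n
  proof -
    have "y n \<in> Y" using y(2) by blast
    then show "y n \<noteq> b" "y n \<noteq> \<gamma> c" "y n \<noteq> \<gamma> d" unfolding Y_def by blast+
  qed
  have "\<exists>s. s \<in> S \<and> \<gamma> s = y n" for n
  proof -
    have "y n \<in> closure E"
    proof -
      have "c < t n" "t n < d" using t(1)[of n] by simp_all
      from clo[OF this] show ?thesis using t(2)[of n] yb(1)[of n] unfolding E_def by metis
    qed
    then have "y n \<in> \<gamma> ` S" by (rule subsetD[OF clS])
    then show ?thesis by (metis imageE)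
  qed
  then obtain s where s: "\<And>n. s n \<in> S" "\<And>n. \<gamma> (s n) = y n" by metis
  have sC: "s n \<in> {0..1}" "s n \<le> c \<or> d \<le> s n" for n
  proof -
    have "s n \<in> C" using s(1) SC by blast
    then show "s n \<in> {0..1}" "s n \<le> c \<or> d \<le> s n" by (auto simp: C_def)
  qed
  have yE: "y n \<notin> \<Union>(edges X)" for n
  proof
    assume A: "y n \<in> \<Union>(edges X)"
    have tn: "c < t n" "t n < d" using t(1)[of n] by auto
    show False
      using sC(2)[of n]
    proof
      assume "s n \<le> c"
      then have "\<gamma> c = y n"
        using mono_loop_fibre[OF \<gamma> A, of "s n" c "t n"] s(2) t(2) tn cd sC(1)[of n] by simp
      then show False using yb(2)[of n] by simp
    next
      assume "d \<le> s n"
      then have "\<gamma> d = y n"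
        using mono_loop_fibre[OF \<gamma> A, of "t n" d "s n"] s(2) t(2) tn cd sC(1)[of n] by simp
      then show False using yb(3)[of n] by simp
    qed
  qed
  \<comment> \<open>Along a subsequence both times converge and the outer times are monotone. Of
    three consecutive outer times the middle one lies strictly between the others; being in
    \<open>S\<close>, it yields a time over an edge between them.\<close>
  have "compact ({0..1::real} \<times> {0..1::real})" by (intro compact_Times) auto
  moreover have "(s n, t n) \<in> {0..1} \<times> {0..1}" for n
    using sC(1)[of n] t(1)[of n] cd by simp
  ultimately obtain l r where r: "strict_mono r" "((\<lambda>n. (s n, t n)) \<circ> r) \<longlonglongrightarrow> l"
    using compact_imp_seq_compact unfolding seq_compact_def by meson
  obtain f where f: "strict_mono f" "monoseq (\<lambda>n. (s \<circ> r) (f n))"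
    using seq_monosub by blast
  define g where "g = r \<circ> f"
  have "inj g" using r(1) f(1) unfolding g_def by (intro inj_compose strict_mono_imp_inj_on)
  have lim: "(\<lambda>n. s (g n)) \<longlonglongrightarrow> fst l" "(\<lambda>n. t (g n)) \<longlonglongrightarrow> snd l"
    using tendsto_fst[OF LIMSEQ_subseq_LIMSEQ[OF r(2) f(1)]] tendsto_snd[OF LIMSEQ_subseq_LIMSEQ[OF r(2) f(1)]]
    by (simp_all add: o_def g_def)
  obtain \<delta>0 where \<delta>0: "\<delta>0 > 0" "\<And>s t. s \<in> {0..1} \<Longrightarrow> t \<in> {0..1} \<Longrightarrow> \<bar>s - t\<bar> < \<delta>0 \<Longrightarrow> dist (\<gamma> s) (\<gamma> t) < \<epsilon>/2"
    using uniform_modulus[OF L(1), of "\<epsilon>/2"] \<epsilon> by auto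
  \<comment> \<open>The bound \<open>d - c\<close> prevents the outer stretch from reaching across
    \<open>{c<..<d}\<close>.\<close>
  define \<delta> where "\<delta> = min \<delta>0 (d - c)"
  have \<delta>: "\<delta> > 0" "\<delta> \<le> \<delta>0" "\<delta> \<le> d - c" using \<delta>0 cd by (auto simp: \<delta>_def)
  obtain N where N: "\<And>m n. m \<ge> N \<Longrightarrow> n \<ge> N \<Longrightarrow> dist (s (g m)) (s (g n)) < \<delta>"
    "\<And>m n. m \<ge> N \<Longrightarrow> n \<ge> N \<Longrightarrow> dist (t (g m)) (t (g n)) < \<delta>"
  proof -
    obtain N1 N2 where "\<And>m n. m \<ge> N1 \<Longrightarrow> n \<ge> N1 \<Longrightarrow> dist (s (g m)) (s (g n)) < \<delta>"
      "\<And>m n. m \<ge> N2 \<Longrightarrow> n \<ge> N2 \<Longrightarrow> dist (t (g m)) (t (g n)) < \<delta>"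
      using LIMSEQ_imp_Cauchy[OF lim(1)] LIMSEQ_imp_Cauchy[OF lim(2)] \<delta>(1) unfolding Cauchy_def by metis
    then show thesis using that[of "max N1 N2"] by simp
  qed
  have yg: "y (g m) \<noteq> y (g n)" if "m \<noteq> n" for m n
    using that y(1) \<open>inj g\<close> by (simp add: inj_eq)
  have "\<exists>i j. i \<ge> N \<and> j \<ge> N \<and> s (g i) < s (g (Suc N)) \<and> s (g (Suc N)) < s (g j)"
  proof -
    have ne: "s (g m) \<noteq> s (g n)" if "m \<noteq> n" for m n
      using yg[OF that] s(2) by metis
    have "(\<forall>m. \<forall>n\<ge>m. s (g m) \<le> s (g n)) \<or> (\<forall>m. \<forall>n\<ge>m. s (g n) \<le> s (g m))"
      using f(2) unfolding monoseq_def g_def by simp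
    then show ?thesis
    proof
      assume "\<forall>m. \<forall>n\<ge>m. s (g m) \<le> s (g n)"
      then show ?thesis
        using ne[of N "Suc N"] ne[of "Suc N" "Suc (Suc N)"]
        by (intro exI[of _ N] exI[of _ "Suc (Suc N)"]) (simp add: order_less_le)
    next
      assume "\<forall>m. \<forall>n\<ge>m. s (g n) \<le> s (g m)"
      then show ?thesis
        using ne[of "Suc N" N] ne[of "Suc (Suc N)" "Suc N"]
        by (intro exI[of _ "Suc (Suc N)"] exI[of _ N]) (simp add: order_less_le)
    qed
  qed
  then obtain i j where ij: "i \<ge> N" "j \<ge> N" "s (g i) < s (g (Suc N))" "s (g (Suc N)) < s (g j)" by blast
  define s0 where "s0 = s (g i)"
  define s1 where "s1 = s (g j)"
  define t0 where "t0 = t (g i)"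
  define t1 where "t1 = t (g j)"
  have st: "0 \<le> s0" "s0 < s1" "s1 \<le> 1" using sC(1)[of "g i"] sC(1)[of "g j"] ij by (auto simp: s0_def s1_def)
  have tt: "c < t0" "t0 < d" "c < t1" "t1 < d" using t(1)[of "g i"] t(1)[of "g j"] by (auto simp: t0_def t1_def)
  have small: "s1 - s0 < \<delta>" "\<bar>t1 - t0\<bar> < \<delta>"
    using N(1)[OF ij(2,1)] N(2)[OF ij(2,1)] st by (auto simp: s0_def s1_def t0_def t1_def dist_real_def)
  have "i \<noteq> j" using ij by auto
  then have "\<gamma> t0 \<noteq> \<gamma> t1" using yg[of i j] t(2) by (simp add: t0_def t1_def)
  then have "t0 \<noteq> t1" by auto
  have I: "s1 \<le> c \<or> d \<le> s0"
    using sC(2)[of "g i"] sC(2)[of "g j"] small(1) \<delta>(3) by (auto simp: s0_def s1_def)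
  have eq: "\<gamma> s0 = \<gamma> t0" "\<gamma> s1 = \<gamma> t1" by (simp_all add: s0_def s1_def t0_def t1_def s t)
  have "{s0..s1} \<inter> {min t0 t1..max t0 t1} = {}"
    using I tt by (auto simp: min_def max_def split: if_splits)
  moreover have "t0 \<in> {0..1}" "t1 \<in> {0..1}" using tt cd by simp_all
  moreover have "\<gamma> s0 \<notin> \<Union>(edges X)" "\<gamma> s1 \<notin> \<Union>(edges X)" unfolding s0_def s1_def s(2) by (rule yE)+
  ultimately obtain \<gamma>' where \<gamma>': "mono_loop X b \<gamma>'"
    "\<And>t. t \<in> {0..1} \<Longrightarrow> \<gamma>' t = \<gamma> t \<or> t \<in> {s0..s1} \<and> \<gamma>' t \<in> \<gamma> ` {min t0 t1..max t0 t1} \<or>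
       t \<in> {min t0 t1..max t0 t1} \<and> \<gamma>' t \<in> \<gamma> ` {s0..s1}"
    "\<And>\<tau> t. s0 < \<tau> \<Longrightarrow> \<tau> < s1 \<Longrightarrow> \<gamma> \<tau> \<in> \<Union>(edges X) \<Longrightarrow> t \<in> {0..1} \<Longrightarrow> \<gamma>' t = \<gamma> \<tau> \<Longrightarrow>
       t \<in> {min t0 t1..max t0 t1}"
    using mono_loop_swap[OF \<gamma> st _ _ \<open>t0 \<noteq> t1\<close> _ eq] by metis
  have tT: "u \<in> {0..1}" "dist (\<gamma> u) (\<gamma> t0) < \<epsilon>/2" if "u \<in> {min t0 t1..max t0 t1}" for u
  proof -
    show "u \<in> {0..1}" using that tt cd by (auto simp: min_def max_def split: if_splits)
    then show "dist (\<gamma> u) (\<gamma> t0) < \<epsilon>/2"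
      using that small(2) \<delta>(2) tt cd by (intro \<delta>0(2)) (auto simp: min_def max_def split: if_splits)
  qed
  have sI: "dist (\<gamma> u) (\<gamma> t0) < \<epsilon>/2" if "u \<in> {s0..s1}" for u
    unfolding eq(1)[symmetric] using that small(1) \<delta>(2) st by (intro \<delta>0(2)) auto
  have "dist (\<gamma>' u) (\<gamma> u) < \<epsilon>" if "u \<in> {0..1}" for u
  proof -
    have half: "dist x z < \<epsilon>" if "dist x (\<gamma> t0) < \<epsilon>/2" "dist z (\<gamma> t0) < \<epsilon>/2" for x z
      using that dist_triangle2[of x z "\<gamma> t0"] by simp
    consider "\<gamma>' u = \<gamma> u" | v where "u \<in> {s0..s1}" "\<gamma>' u = \<gamma> v" "v \<in> {min t0 t1..max t0 t1}"
      | v where "u \<in> {min t0 t1..max t0 t1}" "\<gamma>' u = \<gamma> v" "v \<in> {s0..s1}"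
      using \<gamma>'(2)[OF \<open>u \<in> {0..1}\<close>] by blast
    then show ?thesis
    proof cases
      case 1 then show ?thesis using \<epsilon> by simp
    next
      case 2 show ?thesis unfolding 2(2) by (rule half[OF tT(2)[OF 2(3)] sI[OF 2(1)]])
    next
      case 3 show ?thesis unfolding 3(2) by (rule half[OF sI[OF 3(3)] tT(2)[OF 3(1)]])
    qed
  qed
  moreover have "\<gamma>' ` ({0..1} - {c<..<d}) \<noteq> X"
  proof -
    have "s (g (Suc N)) \<in> {s0<..<s1} \<inter> closure (C \<inter> \<gamma> -` E)"
      using ij s(1) by (simp add: S_def s0_def s1_def)
    then have "{s0<..<s1} \<inter> closure (C \<inter> \<gamma> -` E) \<noteq> {}" by blast
    then have "{s0<..<s1} \<inter> (C \<inter> \<gamma> -` E) \<noteq> {}"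
      using open_Int_closure_eq_empty[OF open_greaterThanLessThan] by metis
    then obtain \<tau> where \<tau>: "\<tau> \<in> {s0<..<s1}" "\<gamma> \<tau> \<in> E" by blast
    \<comment> \<open>After the exchange the edge point is visited only between \<open>t0\<close>
      and \<open>t1\<close>, that is, within \<open>{c<..<d}\<close>.\<close>
    have "\<gamma> \<tau> \<notin> \<gamma>' ` ({0..1} - {c<..<d})"
    proof
      assume "\<gamma> \<tau> \<in> \<gamma>' ` ({0..1} - {c<..<d})"
      then obtain u where u': "u \<in> {0..1} - {c<..<d}" "\<gamma> \<tau> = \<gamma>' u" by (rule imageE)
      from u' have u: "u \<in> {0..1}" "u \<notin> {c<..<d}" "\<gamma>' u = \<gamma> \<tau>" by simp_all
      then have "u \<in> {min t0 t1..max t0 t1}"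
        using \<gamma>'(3)[of \<tau> u] \<tau> by (simp add: E_def)
      then show False using u(2) tt by (auto simp: min_def max_def split: if_splits)
    qed
    then show ?thesis using \<tau>(2) \<open>E \<subseteq> X\<close> by blast
  qed
  ultimately show thesis using that \<gamma>'(1) by blast
qed

text \<open>The loop is made nonconstant on \<open>{c..d}\<close> beforehand, because the exchange
  needs infinitely many values there. The choice between filling and exchanging depends on whether
  the interval contains a time off the closure of the edges and off \<open>b\<close>.\<close>

lemma mono_loop_perturb:
  fixes X :: "'a::metric_space set"
  assumes \<gamma>: "mono_loop X b \<gamma>" and \<epsilon>: "\<epsilon> > 0" and cd: "0 \<le> c" "c < d" "d \<le> 1"
    and X: "x \<in> X" "y \<in> X" "x \<noteq> y"
  obtains \<gamma>' where "mono_loop X b \<gamma>'" "\<And>t. t \<in> {0..1} \<Longrightarrow> dist (\<gamma>' t) (\<gamma> t) < \<epsilon>"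
    "\<gamma>' ` ({0..1} - {c<..<d}) \<noteq> X"
proof -
  have "\<epsilon>/2 > 0" using \<epsilon> by simp
  obtain \<gamma>1 where g1: "mono_loop X b \<gamma>1" "\<And>t. t \<in> {0..1} \<Longrightarrow> dist (\<gamma>1 t) (\<gamma> t) < \<epsilon>/2"
    "\<exists>t\<in>{c..d}. \<gamma>1 t \<noteq> \<gamma>1 c"
    using mono_loop_stretch[OF \<gamma> \<open>\<epsilon>/2 > 0\<close> cd X] by blast
  have "\<exists>\<gamma>2. mono_loop X b \<gamma>2 \<and> (\<forall>t\<in>{0..1}. dist (\<gamma>2 t) (\<gamma>1 t) < \<epsilon>/2) \<and> \<gamma>2 ` ({0..1} - {c<..<d}) \<noteq> X"
  proof (cases "\<gamma>1 ` ({0..1} - {c<..<d}) = X")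
    case False
    then show ?thesis using g1 \<open>\<epsilon>/2 > 0\<close> by (intro exI[of _ \<gamma>1]) auto
  next
    case onto: True
    show ?thesis
    proof (cases "\<exists>\<tau>. c < \<tau> \<and> \<tau> < d \<and> \<gamma>1 \<tau> \<notin> closure (\<Union>(edges X)) \<and> \<gamma>1 \<tau> \<noteq> b")
      case True
      then obtain \<tau> where "c < \<tau>" "\<tau> < d" "\<gamma>1 \<tau> \<notin> closure (\<Union>(edges X))" "\<gamma>1 \<tau> \<noteq> b" by blast
      from mono_loop_perturb_fill[OF g1(1) \<open>\<epsilon>/2 > 0\<close> cd(1,3) this] show ?thesis by metis
    next
      case False
      then have *: "\<And>\<tau>. c < \<tau> \<Longrightarrow> \<tau> < d \<Longrightarrow> \<gamma>1 \<tau> \<in> closure (\<Union>(edges X)) \<or> \<gamma>1 \<tau> = b" by blast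
      from mono_loop_perturb_swap[OF g1(1) \<open>\<epsilon>/2 > 0\<close> cd g1(3) * onto] show ?thesis by metis
    qed
  qed
  then obtain \<gamma>2 where g2: "mono_loop X b \<gamma>2" "\<And>t. t \<in> {0..1} \<Longrightarrow> dist (\<gamma>2 t) (\<gamma>1 t) < \<epsilon>/2"
    "\<gamma>2 ` ({0..1} - {c<..<d}) \<noteq> X" by blast
  have "dist (\<gamma>2 t) (\<gamma> t) < \<epsilon>" if "t \<in> {0..1}" for t
    using g1(2)[OF that] g2(2)[OF that] dist_triangle[of "\<gamma>2 t" "\<gamma> t" "\<gamma>1 t"] by simp
  then show thesis using that g2 by blast
qed

section \<open>Limits of perturbations and irreducibility\<close>

text \<open>Suppose the limit leaves \<open>x\<close> between two visits. A compact subarc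
  \<open>N\<close> of the edge around \<open>x\<close> misses the intermediate value, and its
  preimages under the approximating loops are intervals, since these loops are monotone over the
  edge. For large \<open>n\<close> such a preimage contains the two outer times but not the middle
  one.\<close>

lemma mono_loop_uniform_limit:
  fixes X :: "'a::metric_space set"
  assumes g: "\<And>n. mono_loop X b (g n)" and lim: "uniform_limit {0..1} g \<gamma> sequentially"
  shows "mono_loop X b \<gamma>"
proof -
  note L = mono_loopD[OF g] and cX = mono_loop_space(1)[OF g]
  have ptw: "(\<lambda>n. g n t) \<longlonglongrightarrow> \<gamma> t" if "t \<in> {0..1}" for t
    using lim that by (rule tendsto_uniform_limitI)
  have cont: "continuous_on {0..1} \<gamma>"
    using lim L(1) by (intro uniform_limit_theorem) auto
  have fib: "\<gamma> u = x" if x: "e \<in> edges X" "x \<in> e" and st: "0 \<le> s" "s \<le> u" "u \<le> t" "t \<le> 1" "\<gamma> s = x" "\<gamma> t = x" for e x s u t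
  proof (rule ccontr)
    assume ne: "\<gamma> u \<noteq> x"
    have e: "openin (top_of_set X) e" "e homeomorphic {0<..<1::real}"
      using x(1) by (auto simp: edges_def open_arc_in_def)
    obtain k and k' :: "'a \<Rightarrow> real" where k: "homeomorphism {0<..<1::real} e k k'"
      using e(2) homeomorphic_sym unfolding homeomorphic_def by metis
    define \<xi> where "\<xi> = k' x"
    have \<xi>: "\<xi> \<in> {0<..<1}" "k \<xi> = x"
      unfolding \<xi>_def using imageI[OF x(2), of k'] homeomorphism_image2[OF k] homeomorphism_apply2[OF k x(2)]
      by simp_all
    have "open ({0<..<1} \<inter> k -` (- {\<gamma> u}))"
      using homeomorphism_cont1[OF k] by (intro continuous_open_preimage) auto
    moreover have "\<xi> \<in> {0<..<1} \<inter> k -` (- {\<gamma> u})" using \<xi> ne by simp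
    ultimately obtain \<eta> where \<eta>: "\<eta> > 0" "cball \<xi> \<eta> \<subseteq> {0<..<1} \<inter> k -` (- {\<gamma> u})"
      using open_contains_cball by blast
    have cb: "cball \<xi> \<eta> \<subseteq> {0<..<1}" using \<eta>(2) by blast
    define N where "N = k ` cball \<xi> \<eta>"
    define W where "W = k ` ball \<xi> \<eta>"
    have kc: "continuous_on (cball \<xi> \<eta>) k" using homeomorphism_cont1[OF k] cb continuous_on_subset by blast
    have Ncc: "compact N" "connected N"
      unfolding N_def using kc by (auto intro!: compact_continuous_image connected_continuous_image)
    have Ne: "N \<subseteq> e" unfolding N_def using cb homeomorphism_image1[OF k] by blast
    have eX: "e \<subseteq> X" using e(1) openin_imp_subset by blast
    have "\<gamma> u \<notin> N"
    proof
      assume "\<gamma> u \<in> N"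
      then obtain z where "z \<in> cball \<xi> \<eta>" "\<gamma> u = k z" unfolding N_def by (rule imageE)
      with subsetD[OF \<eta>(2) this(1)] show False by simp
    qed
    have "openin (top_of_set {0<..<1}) (ball \<xi> \<eta>)"
      by (rule open_subset[OF subset_trans[OF ball_subset_cball cb] open_ball])
    then have "openin (top_of_set e) W" unfolding W_def by (rule homeomorphism_imp_open_map[OF k])
    then have "openin (top_of_set X) W" using e(1) openin_trans by blast
    then obtain O' where O': "open O'" "W = X \<inter> O'" by (auto simp: openin_open)
    have xW: "x \<in> O'" using \<xi>(2) \<eta>(1) O'(2) unfolding W_def by (metis IntE centre_in_ball imageI)
    have I: "s \<in> {0..1}" "u \<in> {0..1}" "t \<in> {0..1}" using st by auto
    have "\<forall>\<^sub>F n in sequentially. g n s \<in> O'" "\<forall>\<^sub>F n in sequentially. g n t \<in> O'"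
      "\<forall>\<^sub>F n in sequentially. g n u \<in> - N"
      using topological_tendstoD[OF ptw[OF I(1)] O'(1)] topological_tendstoD[OF ptw[OF I(3)] O'(1)]
        topological_tendstoD[OF ptw[OF I(2)], of "- N"] xW st(5,6) \<open>\<gamma> u \<notin> N\<close> Ncc(1)
      by (simp_all add: compact_imp_closed open_Compl)
    then have "\<forall>\<^sub>F n in sequentially. g n s \<in> O' \<and> g n t \<in> O' \<and> g n u \<in> - N"
      by eventually_elim simp
    then obtain n where n: "g n s \<in> O'" "g n t \<in> O'" "g n u \<notin> N"
      using eventually_happens'[OF sequentially_bot] by fastforce
    have WN: "W \<subseteq> N" unfolding W_def N_def by auto
    have "g n s \<in> N" "g n t \<in> N"
      using n L(2)[of n] I O'(2) WN by blast+
    define Q where "Q = {0..1} \<inter> g n -` N"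
    \<comment> \<open>Closed maps with connected fibres pull connected sets back to connected
      sets.\<close>
    have "connected (Q \<inter> g n -` N)"
    proof (rule connected_closed_monotone_preimage[where T = N])
      show contQ: "continuous_on Q (g n)" using L(1) by (rule continuous_on_subset) (simp add: Q_def)
      show imQ: "g n ` Q = N" using L(2)[of n] Ne eX unfolding Q_def by blast
      have "compact Q"
      proof -
        have "closed Q" unfolding Q_def using L(1) Ncc(1) by (intro continuous_closed_preimage) (auto simp: compact_imp_closed)
        moreover have "Q = {0..1} \<inter> Q" by (auto simp: Q_def)
        ultimately show ?thesis by (metis compact_Icc compact_Int_closed)
      qed
      then show "closedin (top_of_set N) (g n ` B)" if "closedin (top_of_set Q) B" for B
        using continuous_image_compact_closedin[OF _ contQ that] imQ by simp
      show "connected (Q \<inter> g n -` {z})" if "z \<in> N" for z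
      proof -
        have zE: "z \<in> \<Union>(edges X)" using that Ne x(1) by blast
        have "is_interval (Q \<inter> g n -` {z})"
          unfolding is_interval_1
        proof (intro ballI allI impI)
          fix p q r assume A: "p \<in> Q \<inter> g n -` {z}" "q \<in> Q \<inter> g n -` {z}" "p \<le> r \<and> r \<le> q"
          then have B: "0 \<le> p" "q \<le> 1" "g n p = z" "g n q = z" by (auto simp: Q_def)
          have "g n r = z" using mono_loop_fibre[OF g zE, of p r q] A(3) B by blast
          then show "r \<in> Q \<inter> g n -` {z}" using A(3) B that by (simp add: Q_def)
        qed
        then show ?thesis by (simp add: is_interval_connected_1)
      qed
      show "connected N" "N \<subseteq> N" using Ncc by auto
    qed
    then have cQ: "connected Q" by (simp add: Q_def Int_assoc)
    have "s \<in> Q" "t \<in> Q" using \<open>g n s \<in> N\<close> \<open>g n t \<in> N\<close> I by (auto simp: Q_def)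
    then have "u \<in> Q" using connectedD_interval[OF cQ] st by blast
    then show False using n(3) by (simp add: Q_def)
  qed
  show ?thesis
    unfolding mono_loop_def
  proof (intro conjI ballI allI impI)
    show "\<gamma> ` {0..1} = X"
    proof (intro equalityI subsetI)
      fix x assume "x \<in> \<gamma> ` {0..1}"
      then obtain t where t: "t \<in> {0..1}" "x = \<gamma> t" by blast
      show "x \<in> X"
        unfolding t(2)
        by (rule closed_sequentially[OF compact_imp_closed[OF cX] _ ptw[OF t(1)]]) (use L(2) t(1) in blast)
    next
      fix x assume x: "x \<in> X"
      have "compact (\<gamma> ` {0..1})" using cont by (intro compact_continuous_image) auto
      then have "closed (\<gamma> ` {0..1})" by (rule compact_imp_closed)
      moreover have "x \<in> closure (\<gamma> ` {0..1})"
        unfolding closure_approachable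
      proof (intro allI impI)
        fix \<epsilon> :: real assume "\<epsilon> > 0"
        then have "\<forall>\<^sub>F n in sequentially. \<forall>t\<in>{0..1}. dist (g n t) (\<gamma> t) < \<epsilon>"
          by (rule uniform_limitD[OF lim])
        then obtain n where n: "\<forall>t\<in>{0..1}. dist (g n t) (\<gamma> t) < \<epsilon>"
          using eventually_happens'[OF sequentially_bot] by blast
        obtain t where "t \<in> {0..1}" "x = g n t" using x L(2)[of n] by blast
        then show "\<exists>y\<in>\<gamma> ` {0..1}. dist y x < \<epsilon>" using n by (metis dist_commute imageI)
      qed
      ultimately show "x \<in> \<gamma> ` {0..1}" by (simp add: closure_closed)
    qed
    show "\<gamma> 0 = b" using ptw[of 0] L(3) by (simp add: LIMSEQ_const_iff)
    show "\<gamma> 1 = b" using ptw[of 1] L(4) by (simp add: LIMSEQ_const_iff)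
  qed (use cont fib in blast)+
qed


text \<open>The state of the recursion is a loop with a tolerance. Once an interval is
  indispensable, some point has distance at least twice the new tolerance from the image of the
  rest. Tolerances at least halve and each move is below half the current one, so all later moves
  together cannot close this gap.\<close>

lemma mono_loop_imp_irreducible:
  fixes X :: "'a::metric_space set"
  assumes g0: "mono_loop X b g0" and X: "x \<in> X" "y \<in> X" "x \<noteq> y"
  obtains \<gamma> where "mono_loop X b \<gamma>"
    "\<And>c d. c \<in> \<rat> \<Longrightarrow> d \<in> \<rat> \<Longrightarrow> 0 \<le> c \<Longrightarrow> c < d \<Longrightarrow> d \<le> 1 \<Longrightarrow> \<gamma> ` ({0..1} - {c<..<d}) \<noteq> X"
proof -
  define J where "J = {(c, d). c \<in> \<rat> \<and> d \<in> \<rat> \<and> (0::real) \<le> c \<and> c < d \<and> d \<le> 1}"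
  have "J \<subseteq> \<rat> \<times> \<rat>" by (auto simp: J_def)
  then have cJ: "countable J" by (rule countable_subset) (intro countable_SIGMA countable_rat)
  have "(0, 1) \<in> J" by (simp add: J_def)
  then have "J \<noteq> {}" by blast
  then have rJ: "range (from_nat_into J) = J" using cJ by (rule range_from_nat_into)
  define c where "c n = fst (from_nat_into J n)" for n
  define d where "d n = snd (from_nat_into J n)" for n
  have cd: "0 \<le> c n" "c n < d n" "d n \<le> 1" for n
  proof -
    have "from_nat_into J n \<in> J" using rJ by blast
    then show "0 \<le> c n" "c n < d n" "d n \<le> 1" by (auto simp: J_def c_def d_def)
  qed
  define C where "C n = {0..1} - {c n<..<d n}" for n
  define P where "P = (\<lambda>n::nat. \<lambda>(g, \<epsilon>::real). mono_loop X b g \<and> \<epsilon> > 0)"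
  define Q where "Q = (\<lambda>n. \<lambda>(g, \<epsilon>::real) (g', \<epsilon>'). (\<forall>t\<in>{0..1}. dist (g' t) (g t) < \<epsilon>/2) \<and> \<epsilon>' \<le> \<epsilon>/2
      \<and> (\<exists>z\<in>X. \<forall>t\<in>C n. dist z (g' t) \<ge> 2 * \<epsilon>'))"
  have "\<exists>s. P 0 s" using g0 by (intro exI[of _ "(g0, 1)"]) (simp add: P_def)
  moreover have "\<exists>s'. P (Suc n) s' \<and> Q n s s'" if "P n s" for n s
  proof -
    obtain g \<epsilon> where s: "s = (g, \<epsilon>)" by (cases s)
    have g: "mono_loop X b g" "\<epsilon>/2 > 0" using \<open>P n s\<close> by (simp_all add: P_def s)
    obtain g' where g': "mono_loop X b g'" "\<And>t. t \<in> {0..1} \<Longrightarrow> dist (g' t) (g t) < \<epsilon>/2" "g' ` C n \<noteq> X"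
      using mono_loop_perturb[OF g cd[of n] X] unfolding C_def by blast
    note L = mono_loopD[OF g'(1)]
    have "C n \<subseteq> {0..1}" by (auto simp: C_def)
    then obtain z where z: "z \<in> X" "z \<notin> g' ` C n" using g'(3) L(2) by blast
    have "compact (C n)" unfolding C_def by (intro compact_diff) auto
    then have "compact (g' ` C n)"
      using L(1) \<open>C n \<subseteq> {0..1}\<close> compact_continuous_image continuous_on_subset by blast
    then have "open (- (g' ` C n))" by (simp add: compact_imp_closed open_Compl)
    then obtain \<eta> where \<eta>: "\<eta> > 0" "ball z \<eta> \<subseteq> - (g' ` C n)"
      using z(2) open_contains_ball by blast
    have far: "dist z (g' t) \<ge> \<eta>" if "t \<in> C n" for t
    proof (rule ccontr)
      assume "\<not> ?thesis"
      then have "g' t \<in> ball z \<eta>" by simp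
      then show False using \<eta>(2) that by blast
    qed
    define \<epsilon>' where "\<epsilon>' = min (\<epsilon>/2) (\<eta>/2)"
    have "P (Suc n) (g', \<epsilon>')" using g' g \<eta> by (simp add: P_def \<epsilon>'_def)
    moreover have "dist z (g' t) \<ge> 2 * \<epsilon>'" if "t \<in> C n" for t
      using far[OF that] by (simp add: \<epsilon>'_def min_def)
    then have "Q n s (g', \<epsilon>')"
      unfolding Q_def s prod.case using g'(2) z(1) min.cobounded1[of "\<epsilon>/2" "\<eta>/2"] unfolding \<epsilon>'_def
      by (intro conjI ballI bexI[of _ z])
    ultimately show ?thesis by blast
  qed
  ultimately obtain sq where sq: "\<And>n. P n (sq n)" "\<And>n. Q n (sq n) (sq (Suc n))"
    using dependent_nat_choice[of P Q] by blast
  define g where "g n = fst (sq n)" for n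
  define \<epsilon> where "\<epsilon> n = snd (sq n)" for n
  have sqn: "sq n = (g n, \<epsilon> n)" for n by (simp add: g_def \<epsilon>_def)
  have P: "mono_loop X b (g n)" "\<epsilon> n > 0" for n using sq(1)[of n] by (simp_all add: P_def sqn)
  have Q: "\<And>t. t \<in> {0..1} \<Longrightarrow> dist (g (Suc n) t) (g n t) < \<epsilon> n / 2" "\<epsilon> (Suc n) \<le> \<epsilon> n / 2"
    "\<exists>z\<in>X. \<forall>t\<in>C n. dist z (g (Suc n) t) \<ge> 2 * \<epsilon> (Suc n)" for n
    using sq(2)[of n] unfolding Q_def sqn by auto
  \<comment> \<open>Each move is paid for by the drop of the tolerance: a move below half of the
    tolerance comes with a drop by at least that much, so the total telescopes.\<close>
  have near: "dist (g (m + k) t) (g m t) \<le> \<epsilon> m - \<epsilon> (m + k)" if "t \<in> {0..1}" for m k t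
  proof (induction k)
    case (Suc k)
    have "dist (g (m + Suc k) t) (g m t) \<le> dist (g (Suc (m + k)) t) (g (m + k) t) + dist (g (m + k) t) (g m t)"
      by (simp add: dist_triangle)
    also have "\<dots> \<le> \<epsilon> (m + k) / 2 + (\<epsilon> m - \<epsilon> (m + k))"
      using Q(1)[OF that, of "m + k"] Suc by simp
    also have "\<dots> \<le> \<epsilon> m - \<epsilon> (m + Suc k)"
      using Q(2)[of "m + k"] by simp
    finally show ?case .
  qed simp
  have near': "dist (g n t) (g m t) \<le> \<epsilon> m" if "m \<le> n" "t \<in> {0..1}" for m n t
    using near[OF that(2), of m "n - m"] that(1) P(2)[of n] by simp
  have "\<epsilon> n \<le> \<epsilon> 0 * (1/2) ^ n" for n
  proof (induction n)
    case (Suc n)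
    then show ?case using Q(2)[of n] by simp
  qed simp
  moreover have "(\<lambda>n. \<epsilon> 0 * (1/2) ^ n) \<longlonglongrightarrow> \<epsilon> 0 * 0"
    by (intro tendsto_mult tendsto_const LIMSEQ_realpow_zero) auto
  then have "(\<lambda>n. \<epsilon> 0 * (1/2) ^ n) \<longlonglongrightarrow> 0" by simp
  ultimately have e0: "\<epsilon> \<longlonglongrightarrow> 0"
    using P(2) by (intro tendsto_sandwich[of "\<lambda>_. 0" \<epsilon> sequentially "\<lambda>n. \<epsilon> 0 * (1/2) ^ n"]) (auto intro: less_imp_le always_eventually)
  have "\<exists>l. (\<lambda>n. g n t) \<longlonglongrightarrow> l" if t: "t \<in> {0..1}" for t
  proof -
    have "Cauchy (\<lambda>n. g n t)"
    proof (rule metric_CauchyI)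
      fix r :: real assume "r > 0"
      then obtain M where M: "\<epsilon> M < r/2"
        using order_tendstoD(2)[OF e0, of "r/2"] eventually_happens'[OF sequentially_bot] by fastforce
      have "dist (g m t) (g n t) < r" if "m \<ge> M" "n \<ge> M" for m n
        using near'[OF that(1) t] near'[OF that(2) t] M dist_triangle2[of "g m t" "g n t" "g M t"] by simp
      then show "\<exists>M. \<forall>m\<ge>M. \<forall>n\<ge>M. dist (g m t) (g n t) < r" by blast
    qed
    moreover have "complete X" using mono_loop_space(1)[OF g0] by (rule compact_imp_complete)
    moreover have "g n t \<in> X" for n using mono_loopD(2)[OF P(1)[of n]] t by blast
    ultimately show ?thesis unfolding complete_def by metis
  qed
  then obtain \<gamma> where \<gamma>: "\<And>t. t \<in> {0..1} \<Longrightarrow> (\<lambda>n. g n t) \<longlonglongrightarrow> \<gamma> t" by metis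
  have lim: "dist (\<gamma> t) (g m t) \<le> \<epsilon> m" if t: "t \<in> {0..1}" for m t
  proof (rule tendsto_upperbound[of "\<lambda>n. dist (g n t) (g m t)"])
    show "(\<lambda>n. dist (g n t) (g m t)) \<longlonglongrightarrow> dist (\<gamma> t) (g m t)"
      by (intro tendsto_dist \<gamma>[OF t] tendsto_const)
    show "\<forall>\<^sub>F n in sequentially. dist (g n t) (g m t) \<le> \<epsilon> m"
      using near'[OF _ t, of m] by (auto simp: eventually_sequentially)
  qed simp
  have "uniform_limit {0..1} g \<gamma> sequentially"
  proof (rule uniform_limitI)
    fix r :: real assume "r > 0"
    then have "\<forall>\<^sub>F n in sequentially. \<epsilon> n < r" using order_tendstoD(2)[OF e0] by blast
    then show "\<forall>\<^sub>F n in sequentially. \<forall>t\<in>{0..1}. dist (g n t) (\<gamma> t) < r"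
    proof eventually_elim
      case (elim n)
      show ?case
      proof
        fix t :: real assume "t \<in> {0..1}"
        from lim[OF this, of n] show "dist (g n t) (\<gamma> t) < r" using elim by (simp add: dist_commute)
      qed
    qed
  qed
  then have "mono_loop X b \<gamma>" by (rule mono_loop_uniform_limit[OF P(1)])
  moreover have "\<gamma> ` ({0..1} - {c'<..<d'}) \<noteq> X" if "c' \<in> \<rat>" "d' \<in> \<rat>" "0 \<le> c'" "c' < d'" "d' \<le> 1" for c' d'
  proof -
    have "(c', d') \<in> J" using that by (simp add: J_def)
    then obtain n where "from_nat_into J n = (c', d')" using rJ by (metis imageE)
    then have n: "C n = {0..1} - {c'<..<d'}" by (simp add: C_def c_def d_def)
    obtain z where z: "z \<in> X" "\<forall>t\<in>C n. dist z (g (Suc n) t) \<ge> 2 * \<epsilon> (Suc n)" using Q(3) by blast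
    have "z \<noteq> \<gamma> t" if "t \<in> C n" for t
    proof
      assume "z = \<gamma> t"
      moreover have "t \<in> {0..1}" using that by (simp add: C_def)
      ultimately have "dist z (g (Suc n) t) \<le> \<epsilon> (Suc n)" using lim[of t "Suc n"] by simp
      moreover have "dist z (g (Suc n) t) \<ge> 2 * \<epsilon> (Suc n)" using z(2) that by blast
      ultimately show False using P(2)[of "Suc n"] by simp
    qed
    then show ?thesis using z(1) n by blast
  qed
  ultimately show thesis using that by blast
qed

text \<open>A proper closed subset of the circle misses an open arc, and every open arc contains the
  image of a rational parameter interval, whose times are indispensable.\<close>

lemma mono_loop_imp_eulerian:
  fixes X :: "'a::metric_space set"
  assumes g0: "mono_loop X b g0" and X: "x \<in> X" "y \<in> X" "x \<noteq> y"
  shows "eulerian X"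
proof -
  obtain \<gamma> where \<gamma>: "mono_loop X b \<gamma>"
    "\<And>c d. c \<in> \<rat> \<Longrightarrow> d \<in> \<rat> \<Longrightarrow> 0 \<le> c \<Longrightarrow> c < d \<Longrightarrow> d \<le> 1 \<Longrightarrow> \<gamma> ` ({0..1} - {c<..<d}) \<noteq> X"
    using mono_loop_imp_irreducible[OF assms] by blast
  note L = mono_loopD[OF \<gamma>(1)]
  obtain h where h: "continuous_on circle h" "\<And>t. t \<in> {0..1} \<Longrightarrow> h (cis (2 * pi * t)) = \<gamma> t"
    using loop_imp_circle_map[OF L(1)] L(3,4) by metis
  have param: "\<exists>t\<in>{0..<1}. z = cis (2 * pi * t)" if "z \<in> circle" for z
    using circle_eq_cis[of 1 z] that by (metis dist_0_norm mem_sphere mult_1 norm_one)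
  have "h ` circle = X"
  proof (intro equalityI subsetI)
    fix w assume "w \<in> h ` circle"
    then obtain t where "t \<in> {0..<1}" "w = h (cis (2 * pi * t))" using param by blast
    then show "w \<in> X" using h(2)[of t] L(2) by auto
  next
    fix w assume "w \<in> X"
    then obtain t where "t \<in> {0..1}" "w = h (cis (2 * pi * t))" using L(2) h(2) by (metis imageE)
    then show "w \<in> h ` circle" by simp
  qed
  moreover have "h ` A \<noteq> X" if A: "closed A" "A \<subset> circle" for A
  proof -
    obtain z where z: "z \<in> circle" "z \<notin> A" using A(2) by blast
    obtain t0 where t0: "t0 \<in> {0..<1}" "z = cis (2 * pi * t0)" using param[OF z(1)] by blast
    have "open ((\<lambda>t::real. cis (2 * pi * t)) -` (- A))"
      using A(1) by (intro open_vimage) (auto intro!: continuous_intros)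
    moreover have "t0 \<in> (\<lambda>t. cis (2 * pi * t)) -` (- A)" using z t0 by simp
    ultimately obtain \<eta> where \<eta>: "\<eta> > 0" "ball t0 \<eta> \<subseteq> (\<lambda>t. cis (2 * pi * t)) -` (- A)"
      using open_contains_ball by blast
    \<comment> \<open>The rational interval is taken to the right of \<open>t0\<close> and below 1,
      which avoids wrapping around the base point when \<open>t0 = 0\<close>.\<close>
    obtain c where c: "c \<in> \<rat>" "t0 < c" "c < min 1 (t0 + \<eta>)"
      using Rats_dense_in_real[of t0 "min 1 (t0 + \<eta>)"] \<eta>(1) t0(1) by auto
    obtain d where d: "d \<in> \<rat>" "c < d" "d < min 1 (t0 + \<eta>)"
      using Rats_dense_in_real[OF c(3)] by auto
    have "h ` A \<subseteq> \<gamma> ` ({0..1} - {c<..<d})"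
    proof
      fix w assume "w \<in> h ` A"
      then obtain a where a: "a \<in> A" "w = h a" by blast
      then obtain u where u: "u \<in> {0..<1}" "a = cis (2 * pi * u)" using param A(2) by blast
      have "u \<notin> {c<..<d}"
      proof
        assume "u \<in> {c<..<d}"
        then have "u \<in> ball t0 \<eta>" using c d by (simp add: dist_real_def)
        then show False using \<eta>(2) a u by blast
      qed
      then show "w \<in> \<gamma> ` ({0..1} - {c<..<d})" using u a h(2)[of u] by auto
    qed
    moreover have "\<gamma> ` ({0..1} - {c<..<d}) \<noteq> X" using \<gamma>(2) c d t0(1) by simp
    moreover have "\<gamma> ` ({0..1} - {c<..<d}) \<subseteq> X" using L(2) by blast
    ultimately show ?thesis by blast
  qed
  ultimately have "eulerian_map X h" using h(1) unfolding eulerian_map_def by blast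
  then show ?thesis unfolding eulerian_def by blast
qed

section \<open>Euler tours of decompositions\<close>

text \<open>The flag \<^const>\<open>True\<close> of a dart means traversal from the first to the second end.\<close>
type_synonym dart = "nat \<times> bool"

definition dtail :: "(nat \<Rightarrow> nat \<times> nat) \<Rightarrow> dart \<Rightarrow> nat" where
  "dtail en a = (if snd a then fst (en (fst a)) else snd (en (fst a)))"

definition dhead :: "(nat \<Rightarrow> nat \<times> nat) \<Rightarrow> dart \<Rightarrow> nat" where
  "dhead en a = (if snd a then snd (en (fst a)) else fst (en (fst a)))"

fun walk :: "(nat \<Rightarrow> nat \<times> nat) \<Rightarrow> nat \<Rightarrow> dart list \<Rightarrow> nat \<Rightarrow> bool" where
  "walk en u [] w \<longleftrightarrow> u = w"
| "walk en u (a # as) w \<longleftrightarrow> dtail en a = u \<and> walk en (dhead en a) as w"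

lemma walk_append: "walk en u (as @ bs) w \<longleftrightarrow> (\<exists>v. walk en u as v \<and> walk en v bs w)"
  by (induction as arbitrary: u) auto

text \<open>The degree within an edge set \<open>F\<close>, a loop counting twice; for
  \<open>F = dE D\<close> it is \<open>degree\<close>. The parity argument needs it for the edges of
  a trail.\<close>

definition mdeg :: "(nat \<Rightarrow> nat \<times> nat) \<Rightarrow> nat set \<Rightarrow> nat \<Rightarrow> nat" where
  "mdeg en F v = card {x \<in> F. fst (en x) = v} + card {x \<in> F. snd (en x) = v}"

lemma mdeg_insert:
  assumes "finite F" "x \<notin> F"
  shows "mdeg en (insert x F) v = mdeg en F v + of_bool (fst (en x) = v) + of_bool (snd (en x) = v)"
proof -
  have "{y \<in> insert x F. P y} = (if P x then insert x {y \<in> F. P y} else {y \<in> F. P y})" for P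
    by auto
  then show ?thesis
    using assms by (simp add: mdeg_def)
qed

text \<open>Every passage through a vertex uses two edge ends, so only the two ends of the trail
  contribute to the parity, and they cancel when they coincide.\<close>

lemma even_mdeg_trail:
  assumes "walk en u as w" "distinct (map fst as)"
  shows "even (mdeg en (fst ` set as) v) \<longleftrightarrow> (u = v) = (w = v)"
  using assms
proof (induction as arbitrary: u)
  case Nil
  then show ?case by (simp add: mdeg_def)
next
  case (Cons a as)
  have "mdeg en (fst ` set (a # as)) v =
      mdeg en (fst ` set as) v + of_bool (fst (en (fst a)) = v) + of_bool (snd (en (fst a)) = v)"
    using Cons.prems by (simp add: mdeg_insert)
  moreover have "even (mdeg en (fst ` set as) v) \<longleftrightarrow> (dhead en a = v) = (w = v)"
    using Cons by simp
  moreover have "u = dtail en a" using Cons.prems by simp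
  ultimately show ?case
    by (cases "snd a") (auto simp: dtail_def dhead_def)
qed

definition tour :: "('a, 'b) decomp_scheme \<Rightarrow> nat \<Rightarrow> dart list \<Rightarrow> bool" where
  "tour D u as \<longleftrightarrow> u \<in> dV D \<and> walk (dends D) u as u \<and> distinct (map fst as) \<and> fst ` set as = dE D"

lemma walk_in_vertices:
  assumes "walk en u as w" "u \<in> V" "\<And>a. a \<in> set as \<Longrightarrow> fst (en (fst a)) \<in> V \<and> snd (en (fst a)) \<in> V"
  shows "w \<in> V"
  using assms by (induction as arbitrary: u) (auto simp: dhead_def split: if_splits)

lemma dart_at:
  assumes "fst (en x) = w \<or> snd (en x) = w"
  obtains a where "fst a = x" "dtail en a = w"
  using assms that[of "(x, True)"] that[of "(x, False)"] by (auto simp: dtail_def)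

text \<open>A longest trail is closed by parity and exhausts all edges by connectedness.\<close>
lemma euler_tour_exists:
  fixes D :: "'a decomp"
  assumes fin: "finite (dE D)" and ends: "\<And>x. x \<in> dE D \<Longrightarrow> fst (dends D x) \<in> dV D \<and> snd (dends D x) \<in> dV D"
    and conn: "graph_connected D" and ev: "\<And>v. v \<in> dV D \<Longrightarrow> even (degree D v)"
  shows "\<exists>u as. tour D u as"
proof -
  let ?en = "dends D"
  define trail where "trail u as w \<longleftrightarrow> u \<in> dV D \<and> walk ?en u as w \<and> distinct (map fst as) \<and> fst ` set as \<subseteq> dE D" for u as w
  have len: "length as \<le> card (dE D)" if "trail u as w" for u as w
  proof -
    have "length as = card (fst ` set as)"
      using that distinct_card[of "map fst as"] by (simp add: trail_def)
    also have "\<dots> \<le> card (dE D)" using that fin by (intro card_mono) (auto simp: trail_def)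
    finally show ?thesis .
  qed
  obtain u0 where "u0 \<in> dV D" using conn by (auto simp: graph_connected_def)
  then have tr0: "trail u0 [] u0" by (simp add: trail_def)
  define P where "P n \<longleftrightarrow> (\<exists>u as w. trail u as w \<and> length as = n)" for n
  have P0: "P 0" unfolding P_def using tr0 by (metis list.size(3))
  have Pb: "m \<le> card (dE D)" if "P m" for m using that len unfolding P_def by metis
  define n where "n = Greatest P"
  have "P n" unfolding n_def using P0 Pb by (rule GreatestI_nat)
  then have n: "\<exists>u as w. trail u as w \<and> length as = n"
    "\<And>m. \<exists>u as w. trail u as w \<and> length as = m \<Longrightarrow> m \<le> n"
    unfolding P_def[symmetric] using Greatest_le_nat[OF _ Pb] by (simp_all add: n_def)
  from n(1) obtain u as w where t: "trail u as w" "length as = n" by blast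
  \<comment> \<open>Stated for every trail of maximal length, since it is applied to rotations of
    \<open>as\<close> as well.\<close>
  have no_ext: False if "trail v bs z" "length bs = n" "x \<in> dE D - fst ` set bs"
    and x: "fst (?en x) = z \<or> snd (?en x) = z" for v bs z x
  proof -
    obtain a where a: "fst a = x" "dtail ?en a = z" by (rule dart_at[of ?en x z]) (use x in auto)
    have "trail v (bs @ [a]) (dhead ?en a)"
      using that(1,3) a by (auto simp: trail_def walk_append)
    then have "Suc n \<le> n" using n(2)[of "Suc n"] that(2) by (metis length_append_singleton)
    then show False by simp
  qed
  have tt: "u \<in> dV D" "walk ?en u as w" "distinct (map fst as)" "fst ` set as \<subseteq> dE D"
    using t(1) by (auto simp: trail_def)
  have "w \<in> dV D"
    using tt(1,2,4) ends by (intro walk_in_vertices[of ?en u as w "dV D"]) auto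
  \<comment> \<open>A maximal trail has exhausted the edges at its last vertex, so its degree there
    is the even degree in the whole graph; an open trail would make it odd.\<close>
  have "u = w"
  proof (rule ccontr)
    assume "u \<noteq> w"
    then have "odd (mdeg ?en (fst ` set as) w)" using even_mdeg_trail[OF tt(2,3), of w] by simp
    moreover have "even (mdeg ?en (dE D) w)" using ev[OF \<open>w \<in> dV D\<close>] by (simp add: degree_def mdeg_def)
    moreover have "mdeg ?en (fst ` set as) w = mdeg ?en (dE D) w"
    proof -
      have "{x \<in> fst ` set as. fst (?en x) = w} = {x \<in> dE D. fst (?en x) = w}"
        "{x \<in> fst ` set as. snd (?en x) = w} = {x \<in> dE D. snd (?en x) = w}"
        using no_ext[OF t] tt(4) by blast+
      then show ?thesis by (simp add: mdeg_def)
    qed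
    ultimately show False by simp
  qed
  \<comment> \<open>The vertices at which the closed trail can be cut open. Rotating it there gives
    a trail of the same length that ends at \<open>p\<close>, so a missing edge at \<open>p\<close>
    would extend it.\<close>
  define Vis where "Vis = {p. \<exists>bs cs. as = bs @ cs \<and> walk ?en u bs p \<and> walk ?en p cs u}"
  have "u \<in> Vis" using tt(2) \<open>u = w\<close> unfolding Vis_def by (intro CollectI exI[of _ "[]"] exI[of _ as]) simp
  have vis: "dtail ?en a \<in> Vis" "dhead ?en a \<in> Vis" if a: "a \<in> set as" for a
  proof -
    obtain bs cs where as: "as = bs @ a # cs" using split_list[OF a] by blast
    then have *: "walk ?en u bs (dtail ?en a)" "walk ?en (dhead ?en a) cs u"
      using tt(2) \<open>u = w\<close> by (auto simp: walk_append)
    then show "dtail ?en a \<in> Vis" using as unfolding Vis_def by (intro CollectI exI[of _ bs] exI[of _ "a # cs"]) simp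
    show "dhead ?en a \<in> Vis"
      using as * unfolding Vis_def by (intro CollectI exI[of _ "bs @ [a]"] exI[of _ cs]) (simp add: walk_append)
  qed
  have vis': "fst (?en x) \<in> Vis" "snd (?en x) \<in> Vis" if x: "x \<in> fst ` set as" for x
  proof -
    obtain a where "a \<in> set as" "x = fst a" using x by blast
    then show "fst (?en x) \<in> Vis" "snd (?en x) \<in> Vis"
      using vis[of a] by (cases "snd a"; simp add: dtail_def dhead_def)+
  qed
  have sat: "x \<in> fst ` set as" if "p \<in> Vis" "x \<in> dE D" "fst (?en x) = p \<or> snd (?en x) = p" for p x
  proof (rule ccontr)
    assume x: "x \<notin> fst ` set as"
    from that(1) obtain bs cs where bc: "as = bs @ cs" "walk ?en u bs p" "walk ?en p cs u" unfolding Vis_def by blast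
    have "p \<in> dV D" using that(2,3) ends by blast
    then have "trail p (cs @ bs) p"
      using tt bc unfolding trail_def by (auto simp: walk_append)
    then show False
      using no_ext[of p "cs @ bs" p x] t(2) bc(1) that x by auto
  qed
  have reach: "v \<in> Vis" if "(u, v) \<in> (adj D)\<^sup>*" for v
    using that
  proof (induction rule: rtrancl_induct)
    case (step y z)
    then obtain x where "x \<in> dE D" "?en x = (y, z) \<or> ?en x = (z, y)" by (auto simp: adj_def)
    then have "x \<in> fst ` set as" using sat[of y x] step.IH by auto
    then show ?case using vis'[of x] \<open>?en x = (y, z) \<or> ?en x = (z, y)\<close> by auto
  qed (rule \<open>u \<in> Vis\<close>)
  have "dE D \<subseteq> fst ` set as"
  proof
    fix x assume "x \<in> dE D"
    then have "fst (?en x) \<in> Vis" using ends tt(1) conn by (intro reach) (auto simp: graph_connected_def)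
    then show "x \<in> fst ` set as" using sat \<open>x \<in> dE D\<close> by blast
  qed
  then have "tour D u as" using tt \<open>u = w\<close> by (auto simp: tour_def)
  then show ?thesis by blast
qed

lemma finite_tours:
  assumes "finite (dV D)" "finite (dE D)"
  shows "finite {(u, as). tour D u as}"
proof (rule finite_subset)
  show "{(u, as). tour D u as} \<subseteq> dV D \<times> {as. set as \<subseteq> dE D \<times> UNIV \<and> length as = card (dE D)}"
  proof safe
    fix u as assume t: "tour D u as"
    show "u \<in> dV D" using t by (simp add: tour_def)
    show "length as = card (dE D)"
      using t distinct_card[of "map fst as"] by (simp add: tour_def)
    fix x d assume "(x, d) \<in> set as"
    then show "x \<in> dE D" using t by (force simp: tour_def)
  qed simp
  show "finite (dV D \<times> {as. set as \<subseteq> dE D \<times> (UNIV :: bool set) \<and> length as = card (dE D)})"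
    using assms by (intro finite_cartesian_product finite_lists_length_eq) auto
qed

lemma tour_visits:
  assumes t: "tour D u as" and conn: "graph_connected D" and v: "v \<in> dV D"
  shows "v = u \<or> (\<exists>a\<in>set as. dtail (dends D) a = v \<or> dhead (dends D) a = v)"
proof (cases "v = u")
  case False
  have "(u, v) \<in> (adj D)\<^sup>*" using t conn v by (auto simp: tour_def graph_connected_def)
  then obtain y where "(y, v) \<in> adj D" using False by (metis rtranclE)
  then obtain x where x: "x \<in> dE D" "dends D x = (y, v) \<or> dends D x = (v, y)" by (auto simp: adj_def)
  have "x \<in> fst ` set as" using t x(1) by (simp add: tour_def)
  then obtain a where "a \<in> set as" "x = fst a" by blast
  moreover have "dtail (dends D) a = v \<or> dhead (dends D) a = v"
    using x(2) \<open>x = fst a\<close> by (auto simp: dtail_def dhead_def)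
  ultimately show ?thesis by blast
qed simp

text \<open>\<open>D\<close> arises from \<open>D'\<close> by contracting the edges outside \<open>S\<close>; \<open>\<rho>\<close> sends a vertex to the vertex it
  is merged into, and \<open>\<sigma>\<close> renames the surviving edges.\<close>
definition minor :: "(nat \<Rightarrow> nat) \<Rightarrow> nat set \<Rightarrow> (nat \<Rightarrow> nat) \<Rightarrow> 'a decomp \<Rightarrow> 'a decomp \<Rightarrow> bool" where
  "minor \<rho> S \<sigma> D' D \<longleftrightarrow>
     (\<forall>v\<in>dV D'. \<rho> v \<in> dV D \<and> dvert D' v \<subseteq> dvert D (\<rho> v)) \<and>
     S \<subseteq> dE D' \<and> bij_betw \<sigma> S (dE D) \<and>
     (\<forall>x\<in>dE D' - S. \<rho> (fst (dends D' x)) = \<rho> (snd (dends D' x)) \<and>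
        eta_edge D' x \<subseteq> dvert D (\<rho> (fst (dends D' x)))) \<and>
     (\<forall>x\<in>S. dends D (\<sigma> x) = map_prod \<rho> \<rho> (dends D' x) \<and> (\<sigma> x \<in> dF D \<longleftrightarrow> x \<in> dF D') \<and>
        (x \<in> dF D' \<longrightarrow> dfree D (\<sigma> x) = dfree D' x) \<and>
        (x \<notin> dF D' \<longrightarrow> darc D (\<sigma> x) = darc D' x \<and> darc0 D (\<sigma> x) = darc0 D' x \<and> darc1 D (\<sigma> x) = darc1 D' x))"

text \<open>One more contraction composes the vertex map with the merging map and drops the preimage
  of the edge from \<open>S\<close>. The dropped edge lies in the new vertex piece because
  \<open>contract\<close> adds its image to that piece.\<close>

lemma minor_contract:
  assumes m: "minor \<rho> S \<sigma> D' D" and e: "e \<in> dE D"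
    and ends': "\<And>x. x \<in> dE D' \<Longrightarrow> fst (dends D' x) \<in> dV D' \<and> snd (dends D' x) \<in> dV D'"
  shows "\<exists>\<rho>' S'. minor \<rho>' S' \<sigma> D' (contract D e)"
proof -
  define x where "x = fst (dends D e)"
  define y where "y = snd (dends D e)"
  define r where "r u = (if u = y then x else u)" for u
  define S' where "S' = {z \<in> S. \<sigma> z \<noteq> e}"
  have c: "dV (contract D e) = (dV D - {y}) \<union> {x}" "dE (contract D e) = dE D - {e}"
    "dF (contract D e) = dF D - {e}" "dends (contract D e) = (\<lambda>z. map_prod r r (dends D z))"
    "dvert (contract D e) = (dvert D)(x := dvert D x \<union> eta_edge D e \<union> dvert D y)"
    "dfree (contract D e) = dfree D" "darc (contract D e) = darc D"
    "darc0 (contract D e) = darc0 D" "darc1 (contract D e) = darc1 D"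
    by (simp_all add: contract_def Let_def x_def[symmetric] y_def[symmetric] r_def[abs_def])
  have rv: "r v \<in> dV (contract D e)" "dvert D v \<subseteq> dvert (contract D e) (r v)" if "v \<in> dV D" for v
    using that by (auto simp: c r_def)
  have mV: "\<rho> v \<in> dV D" "dvert D' v \<subseteq> dvert D (\<rho> v)" if "v \<in> dV D'" for v
    using m that by (auto simp: minor_def)
  have mS: "S \<subseteq> dE D'" "bij_betw \<sigma> S (dE D)" using m by (auto simp: minor_def)
  have mN: "\<rho> (fst (dends D' z)) = \<rho> (snd (dends D' z))" "eta_edge D' z \<subseteq> dvert D (\<rho> (fst (dends D' z)))"
    if "z \<in> dE D' - S" for z using m that unfolding minor_def by blast+
  have mE: "dends D (\<sigma> z) = map_prod \<rho> \<rho> (dends D' z)" "\<sigma> z \<in> dF D \<longleftrightarrow> z \<in> dF D'"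
    "z \<in> dF D' \<Longrightarrow> dfree D (\<sigma> z) = dfree D' z"
    "z \<notin> dF D' \<Longrightarrow> darc D (\<sigma> z) = darc D' z \<and> darc0 D (\<sigma> z) = darc0 D' z \<and> darc1 D (\<sigma> z) = darc1 D' z"
    if "z \<in> S" for z using m that unfolding minor_def by blast+
  have "minor (r \<circ> \<rho>) S' \<sigma> D' (contract D e)"
    unfolding minor_def
  proof (intro conjI ballI)
    fix v assume v: "v \<in> dV D'"
    show "(r \<circ> \<rho>) v \<in> dV (contract D e)" using rv(1) mV(1)[OF v] by simp
    show "dvert D' v \<subseteq> dvert (contract D e) ((r \<circ> \<rho>) v)"
      using mV[OF v] rv(2)[OF mV(1)[OF v]] by auto
  next
    show "S' \<subseteq> dE D'" using mS by (auto simp: S'_def)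
    show "bij_betw \<sigma> S' (dE (contract D e))"
      using mS(2) unfolding bij_betw_def c(2) S'_def by (auto simp: inj_on_def)
  next
    fix z assume z: "z \<in> dE D' - S'"
    have "(r \<circ> \<rho>) (fst (dends D' z)) = (r \<circ> \<rho>) (snd (dends D' z)) \<and>
        eta_edge D' z \<subseteq> dvert (contract D e) ((r \<circ> \<rho>) (fst (dends D' z)))"
    proof (cases "z \<in> S")
      case False
      then have zz: "z \<in> dE D' - S" using z by simp
      then have "fst (dends D' z) \<in> dV D'" using ends' by blast
      then show ?thesis using mN[OF zz] rv(2)[OF mV(1)[of "fst (dends D' z)"]] by auto
    next
      case True
      then have ze: "\<sigma> z = e" using z by (auto simp: S'_def)
      have "\<rho> (fst (dends D' z)) = x" "\<rho> (snd (dends D' z)) = y"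
        using mE(1)[OF True] ze by (simp_all add: x_def y_def)
      moreover have "eta_edge D' z = eta_edge D e"
        using mE(2-4)[OF True] ze by (auto simp: eta_edge_def)
      ultimately show ?thesis by (auto simp: r_def c)
    qed
    then show "(r \<circ> \<rho>) (fst (dends D' z)) = (r \<circ> \<rho>) (snd (dends D' z))"
      "eta_edge D' z \<subseteq> dvert (contract D e) ((r \<circ> \<rho>) (fst (dends D' z)))" by auto
  next
    fix z assume z: "z \<in> S'"
    then have zS: "z \<in> S" and ne: "\<sigma> z \<noteq> e" by (auto simp: S'_def)
    show "dends (contract D e) (\<sigma> z) = map_prod (r \<circ> \<rho>) (r \<circ> \<rho>) (dends D' z)"
      using mE(1)[OF zS] by (simp add: c prod.map_comp)
    show "\<sigma> z \<in> dF (contract D e) \<longleftrightarrow> z \<in> dF D'" using mE(2)[OF zS] ne by (simp add: c)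
    show "z \<in> dF D' \<longrightarrow> dfree (contract D e) (\<sigma> z) = dfree D' z" using mE(3)[OF zS] by (simp add: c)
    show "z \<notin> dF D' \<longrightarrow> darc (contract D e) (\<sigma> z) = darc D' z \<and> darc0 (contract D e) (\<sigma> z) = darc0 D' z
        \<and> darc1 (contract D e) (\<sigma> z) = darc1 D' z" using mE(4)[OF zS] by (simp add: c)
  qed
  then show ?thesis by blast
qed

lemma minor_contracts_to:
  assumes "contracts_to D' D" and "\<And>x. x \<in> dE D' \<Longrightarrow> fst (dends D' x) \<in> dV D' \<and> snd (dends D' x) \<in> dV D'"
  shows "\<exists>\<rho> S \<sigma>. minor \<rho> S \<sigma> D' D"
  using assms
proof (induction rule: contracts_to.induct)
  case (refl D)
  have "minor id (dE D) id D D" by (auto simp: minor_def prod.map_id)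
  then show ?case by blast
next
  case (step D D' e)
  then show ?case using minor_contract by metis
qed

text \<open>A chain of contractions followed by a renaming is condensed into one vertex map and one
  edge bijection, the form in which tours and timetables are projected.\<close>

lemma decomp_le_minor:
  assumes le: "decomp_le D D'" and ends': "\<And>x. x \<in> dE D' \<Longrightarrow> fst (dends D' x) \<in> dV D' \<and> snd (dends D' x) \<in> dV D'"
  shows "\<exists>\<rho> S \<sigma>. minor \<rho> S \<sigma> D' D"
proof -
  obtain D0 where D0: "contracts_to D' D0" "decomp_iso D0 D" using le by (auto simp: decomp_le_def)
  obtain \<rho> S \<sigma> where m: "minor \<rho> S \<sigma> D' D0" using minor_contracts_to[OF D0(1) ends'] by blast
  obtain \<phi> \<psi> where iso: "bij_betw \<phi> (dV D0) (dV D)" "bij_betw \<psi> (dE D0) (dE D)"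
     "\<And>v. v \<in> dV D0 \<Longrightarrow> dvert D (\<phi> v) = dvert D0 v"
     "\<And>x. x \<in> dE D0 \<Longrightarrow> (x \<in> dF D0 \<longleftrightarrow> \<psi> x \<in> dF D) \<and>
        dends D (\<psi> x) = map_prod \<phi> \<phi> (dends D0 x) \<and>
        (x \<in> dF D0 \<longrightarrow> dfree D (\<psi> x) = dfree D0 x) \<and>
        (x \<notin> dF D0 \<longrightarrow> darc D (\<psi> x) = darc D0 x \<and> darc0 D (\<psi> x) = darc0 D0 x
                      \<and> darc1 D (\<psi> x) = darc1 D0 x)"
    using D0(2) unfolding decomp_iso_def by blast
  have mV: "\<rho> v \<in> dV D0" "dvert D' v \<subseteq> dvert D0 (\<rho> v)" if "v \<in> dV D'" for v
    using m that by (auto simp: minor_def)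
  have mS: "S \<subseteq> dE D'" "bij_betw \<sigma> S (dE D0)" using m by (auto simp: minor_def)
  have mN: "\<rho> (fst (dends D' z)) = \<rho> (snd (dends D' z))" "eta_edge D' z \<subseteq> dvert D0 (\<rho> (fst (dends D' z)))"
    if "z \<in> dE D' - S" for z using m that unfolding minor_def by blast+
  have mE: "dends D0 (\<sigma> z) = map_prod \<rho> \<rho> (dends D' z)" "\<sigma> z \<in> dF D0 \<longleftrightarrow> z \<in> dF D'"
    "z \<in> dF D' \<Longrightarrow> dfree D0 (\<sigma> z) = dfree D' z"
    "z \<notin> dF D' \<Longrightarrow> darc D0 (\<sigma> z) = darc D' z \<and> darc0 D0 (\<sigma> z) = darc0 D' z \<and> darc1 D0 (\<sigma> z) = darc1 D' z"
    if "z \<in> S" for z using m that unfolding minor_def by blast+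
  have "minor (\<phi> \<circ> \<rho>) S (\<psi> \<circ> \<sigma>) D' D"
    unfolding minor_def
  proof (intro conjI ballI)
    fix v assume v: "v \<in> dV D'"
    show "(\<phi> \<circ> \<rho>) v \<in> dV D" using mV(1)[OF v] iso(1) by (auto simp: bij_betw_def)
    show "dvert D' v \<subseteq> dvert D ((\<phi> \<circ> \<rho>) v)" using mV[OF v] iso(3) by simp
  next
    show "S \<subseteq> dE D'" by (rule mS)
    show "bij_betw (\<psi> \<circ> \<sigma>) S (dE D)" using bij_betw_trans[OF mS(2) iso(2)] .
  next
    fix z assume z: "z \<in> dE D' - S"
    then have "fst (dends D' z) \<in> dV D'" using ends' by blast
    then show "eta_edge D' z \<subseteq> dvert D ((\<phi> \<circ> \<rho>) (fst (dends D' z)))"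
      using mN(2)[OF z] iso(3)[OF mV(1)] by simp
    show "(\<phi> \<circ> \<rho>) (fst (dends D' z)) = (\<phi> \<circ> \<rho>) (snd (dends D' z))" using mN(1)[OF z] by simp
  next
    fix z assume z: "z \<in> S"
    then have "\<sigma> z \<in> dE D0" using mS(2) by (auto simp: bij_betw_def)
    note I = iso(4)[OF this] and M = mE[OF z]
    show "dends D ((\<psi> \<circ> \<sigma>) z) = map_prod (\<phi> \<circ> \<rho>) (\<phi> \<circ> \<rho>) (dends D' z)"
      using I M(1) by (simp add: prod.map_comp)
    show "(\<psi> \<circ> \<sigma>) z \<in> dF D \<longleftrightarrow> z \<in> dF D'" using I M by auto
    show "z \<in> dF D' \<longrightarrow> dfree D ((\<psi> \<circ> \<sigma>) z) = dfree D' z" using I M by auto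
    show "z \<notin> dF D' \<longrightarrow> darc D ((\<psi> \<circ> \<sigma>) z) = darc D' z \<and> darc0 D ((\<psi> \<circ> \<sigma>) z) = darc0 D' z
        \<and> darc1 D ((\<psi> \<circ> \<sigma>) z) = darc1 D' z" using I M by auto
  qed
  then show ?thesis by blast
qed

definition dproj :: "nat set \<Rightarrow> (nat \<Rightarrow> nat) \<Rightarrow> dart list \<Rightarrow> dart list" where
  "dproj S \<sigma> as = map (\<lambda>a. (\<sigma> (fst a), snd a)) (filter (\<lambda>a. fst a \<in> S) as)"

lemma dproj_simps [simp]:
  "dproj S \<sigma> [] = []"
  "dproj S \<sigma> (a # as) = (if fst a \<in> S then (\<sigma> (fst a), snd a) # dproj S \<sigma> as else dproj S \<sigma> as)"
  by (simp_all add: dproj_def)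

text \<open>The incidence part of \<open>minor\<close>, isolated so that inductions over dart lists
  involve only an edge set \<open>E\<close> containing the darts.\<close>

definition compat :: "(nat \<Rightarrow> nat) \<Rightarrow> nat set \<Rightarrow> (nat \<Rightarrow> nat) \<Rightarrow> (nat \<Rightarrow> nat \<times> nat) \<Rightarrow> (nat \<Rightarrow> nat \<times> nat) \<Rightarrow> nat set \<Rightarrow> bool" where
  "compat \<rho> S \<sigma> en' en E \<longleftrightarrow> (\<forall>x\<in>E. if x \<in> S then en (\<sigma> x) = map_prod \<rho> \<rho> (en' x) else \<rho> (fst (en' x)) = \<rho> (snd (en' x)))"

lemma compat_dart:
  assumes "compat \<rho> S \<sigma> en' en E" "fst a \<in> E"
  shows "fst a \<in> S \<Longrightarrow> dtail en (\<sigma> (fst a), snd a) = \<rho> (dtail en' a)"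
    and "fst a \<in> S \<Longrightarrow> dhead en (\<sigma> (fst a), snd a) = \<rho> (dhead en' a)"
    and "fst a \<notin> S \<Longrightarrow> \<rho> (dtail en' a) = \<rho> (fst (en' (fst a)))"
    and "fst a \<notin> S \<Longrightarrow> \<rho> (dhead en' a) = \<rho> (fst (en' (fst a)))"
  using bspec[OF assms(1)[unfolded compat_def] assms(2)]
  by (auto simp: dtail_def dhead_def)

text \<open>A contracted dart has both ends merged into the same vertex, so deleting it leaves a
  walk.\<close>

lemma walk_dproj:
  assumes "compat \<rho> S \<sigma> en' en E" "walk en' u as w" "fst ` set as \<subseteq> E"
  shows "walk en (\<rho> u) (dproj S \<sigma> as) (\<rho> w)"
  using assms(2,3)
proof (induction as arbitrary: u)
  case (Cons a as)
  then have IH: "walk en (\<rho> (dhead en' a)) (dproj S \<sigma> as) (\<rho> w)" and u: "u = dtail en' a" and a: "fst a \<in> E"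
    by auto
  note C = compat_dart[OF assms(1) a]
  show ?case
  proof (cases "fst a \<in> S")
    case True
    then show ?thesis using IH C(1,2) u by simp
  next
    case False
    then have "\<rho> (dhead en' a) = \<rho> u" using C(3,4) u by simp
    then show ?thesis using IH False by simp
  qed
qed simp

lemma minor_compat:
  assumes "minor \<rho> S \<sigma> D' D"
  shows "compat \<rho> S \<sigma> (dends D') (dends D) (dE D')"
  using assms by (auto simp: minor_def compat_def)

lemma tour_dproj:
  assumes m: "minor \<rho> S \<sigma> D' D" and t: "tour D' u as"
  shows "tour D (\<rho> u) (dproj S \<sigma> as)"
proof -
  have bij: "inj_on \<sigma> S" "\<sigma> ` S = dE D" "S \<subseteq> dE D'" using m by (auto simp: minor_def bij_betw_def)
  have t': "u \<in> dV D'" "walk (dends D') u as u" "distinct (map fst as)" "fst ` set as = dE D'"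
    using t by (auto simp: tour_def)
  have "map fst (dproj S \<sigma> as) = map \<sigma> (filter (\<lambda>x. x \<in> S) (map fst as))"
    by (induction as) auto
  moreover have "distinct (map \<sigma> (filter (\<lambda>x. x \<in> S) (map fst as)))"
    using t'(3) bij(1) by (auto simp: distinct_map intro: inj_on_subset)
  moreover have "fst ` set (dproj S \<sigma> as) = \<sigma> ` (fst ` set as \<inter> S)"
    by (force simp: dproj_def)
  moreover have "walk (dends D) (\<rho> u) (dproj S \<sigma> as) (\<rho> u)"
    using walk_dproj[OF minor_compat[OF m] t'(2)] t'(4) by simp
  moreover have "\<rho> u \<in> dV D" using m t'(1) by (auto simp: minor_def)
  ultimately show ?thesis
    using t'(4) bij by (simp add: tour_def Int_absorb1)
qed

section \<open>Koenig's lemma and compatible timetables\<close>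

text \<open>An element is good if it has descendants at every later level. Finiteness gives a good
  element at level 0 and a good preimage of every good element, by the same pigeonhole argument
  \<open>pick\<close>.\<close>

lemma inverse_limit_finite:
  fixes T :: "nat \<Rightarrow> 'a set" and f :: "nat \<Rightarrow> 'a \<Rightarrow> 'a"
  assumes fin: "\<And>n. finite (T n)" and ne: "\<And>n. T n \<noteq> {}" and f: "\<And>n x. x \<in> T (Suc n) \<Longrightarrow> f n x \<in> T n"
  obtains s where "\<And>n. s n \<in> T n" "\<And>n. f n (s (Suc n)) = s n"
proof -
  define anc where "anc n = rec_nat id (\<lambda>k g. g \<circ> f (n + k))" for n
  have anc0: "anc n 0 = id" and ancS: "anc n (Suc k) x = anc n k (f (n + k) x)" for n k x
    by (simp_all add: anc_def)
  have ancS': "anc n (Suc k) x = f n (anc (Suc n) k x)" for n k x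
    by (induction k arbitrary: x) (simp_all add: anc0 ancS)
  have ancT: "anc n k x \<in> T n" if "x \<in> T (n + k)" for n k x
    using that f by (induction k arbitrary: x) (simp_all add: anc0 ancS)
  define good where "good n x \<longleftrightarrow> (\<forall>k. \<exists>y\<in>T (n + k). anc n k y = x)" for n x
  have anti: "\<exists>y\<in>T (n + k). anc n k y = x" if "\<exists>y\<in>T (n + l). anc n l y = x" "k \<le> l" for n k l x
    using that(2,1)
  proof (induction l rule: dec_induct)
    case (step l)
    then obtain y where "y \<in> T (n + Suc l)" "anc n (Suc l) y = x" by blast
    then have "\<exists>y\<in>T (n + l). anc n l y = x" using f[of y "n + l"] by (intro bexI[of _ "f (n + l) y"]) (simp_all add: ancS)
    then show ?case using step by blast
  qed
  \<comment> \<open>If each condition of a decreasing family is met somewhere in a finite set, one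
    element meets them all: otherwise every element fails at the largest of finitely many
    indices.\<close>
  have pick: "\<exists>x\<in>A. \<forall>k. Q x k" if "finite A" "\<And>k. \<exists>x\<in>A. Q x k" "\<And>x k l. Q x l \<Longrightarrow> k \<le> l \<Longrightarrow> Q x k" for A :: "'a set" and Q :: "'a \<Rightarrow> nat \<Rightarrow> bool"
  proof (rule ccontr)
    assume "\<not> ?thesis"
    then have "\<forall>x\<in>A. \<exists>k. \<not> Q x k" by blast
    then obtain k where k: "\<And>x. x \<in> A \<Longrightarrow> \<not> Q x (k x)" by metis
    from that(2) obtain x where x: "x \<in> A" "Q x (Max (k ` A))" by blast
    then have "k x \<le> Max (k ` A)" using that(1) by simp
    then show False using that(3) x k by blast
  qed
  have good0: "\<exists>x\<in>T 0. good 0 x"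
    unfolding good_def
  proof (rule pick[OF fin])
    show "\<exists>x\<in>T 0. \<exists>y\<in>T (0 + k). anc 0 k y = x" for k
      using ne[of "0 + k"] ancT[of _ 0 k] by blast
  qed (rule anti)
  have goodS: "\<exists>z. (z \<in> T (Suc n) \<and> good (Suc n) z) \<and> f n z = x" if "x \<in> T n" "good n x" for n x
  proof -
    have "\<exists>z\<in>{z \<in> T (Suc n). f n z = x}. \<forall>k. \<exists>y\<in>T (Suc n + k). anc (Suc n) k y = z"
    proof (rule pick)
      show "\<exists>z\<in>{z \<in> T (Suc n). f n z = x}. \<exists>y\<in>T (Suc n + k). anc (Suc n) k y = z" for k
      proof -
        obtain y where "y \<in> T (n + Suc k)" "anc n (Suc k) y = x" using \<open>good n x\<close> unfolding good_def by blast
        then show ?thesis using ancT[of y "Suc n" k] ancS'[of n k y] by auto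
      qed
    qed (use fin in simp, rule anti)
    then show ?thesis unfolding good_def by blast
  qed
  have "\<exists>s. \<forall>n. (s n \<in> T n \<and> good n (s n)) \<and> f n (s (Suc n)) = s n"
    by (rule dependent_nat_choice) (use good0 goodS in blast)+
  then show thesis using that by blast
qed

type_synonym tdart = "dart \<times> real \<times> real"

text \<open>The strict inequalities leave a rest of positive length before, between and after the
  darts. This is the room in which finer levels insert the darts that are contracted at the present
  level.\<close>

fun timed :: "real \<Rightarrow> real \<Rightarrow> tdart list \<Rightarrow> bool" where
  "timed a b [] \<longleftrightarrow> a < b"
| "timed a b ((d, s, t) # r) \<longleftrightarrow> a < s \<and> s < t \<and> timed t b r"

text \<open>An entry \<open>(d, s, t)\<close> of a timed tour traverses the dart \<open>d\<close> during \<open>{s..t}\<close>; at all other times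
  the tour rests at a vertex. At the endpoints of \<open>{s..t}\<close> both descriptions apply.\<close>
fun gapAt :: "(nat \<Rightarrow> nat \<times> nat) \<Rightarrow> nat \<Rightarrow> real \<Rightarrow> real \<Rightarrow> tdart list \<Rightarrow> real \<Rightarrow> nat \<Rightarrow> bool" where
  "gapAt en u a b [] \<tau> v \<longleftrightarrow> a \<le> \<tau> \<and> \<tau> \<le> b \<and> v = u"
| "gapAt en u a b ((d, s, t) # r) \<tau> v \<longleftrightarrow> a \<le> \<tau> \<and> \<tau> \<le> s \<and> v = u \<or> gapAt en (dhead en d) t b r \<tau> v"

definition tproj :: "nat set \<Rightarrow> (nat \<Rightarrow> nat) \<Rightarrow> tdart list \<Rightarrow> tdart list" where
  "tproj S \<sigma> ts = map (\<lambda>((x, d), s, t). ((\<sigma> x, d), s, t)) (filter (\<lambda>e. fst (fst e) \<in> S) ts)"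

lemma tproj_simps [simp]:
  "tproj S \<sigma> [] = []"
  "tproj S \<sigma> ((a, s, t) # ts) = (if fst a \<in> S then ((\<sigma> (fst a), snd a), s, t) # tproj S \<sigma> ts else tproj S \<sigma> ts)"
  by (simp_all add: tproj_def split: prod.split)

lemma timed_less: "timed a b ts \<Longrightarrow> a < b"
  by (induction ts arbitrary: a) force+

lemma timed_mono: "timed a b ts \<Longrightarrow> a' \<le> a \<Longrightarrow> timed a' b ts"
  by (cases ts) auto

text \<open>A new dart in the middle third of the first rest leaves rests on both sides of
  it.\<close>

lemma timed_shrink: "timed a b ts \<Longrightarrow> \<exists>s t. a < s \<and> s < t \<and> timed t b ts"
proof (cases ts)
  case Nil
  assume "timed a b ts"
  then show ?thesis using Nil by (intro exI[of _ "a + (b - a) / 3"] exI[of _ "a + 2 * (b - a) / 3"]) (simp add: field_simps)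
next
  case (Cons e r)
  obtain d s0 t0 where "e = (d, s0, t0)" by (cases e)
  moreover assume "timed a b ts"
  ultimately show ?thesis
    using Cons by (intro exI[of _ "a + (s0 - a) / 3"] exI[of _ "a + 2 * (s0 - a) / 3"]) (simp add: field_simps)
qed

lemma timed_exists: "a < b \<Longrightarrow> \<exists>ts. timed a b ts \<and> map fst ts = as"
proof (induction as arbitrary: a)
  case (Cons d as)
  define s where "s = a + (b - a) / 3"
  define t where "t = a + 2 * (b - a) / 3"
  have st: "a < s" "s < t" "t < b" using Cons.prems by (simp_all add: s_def t_def field_simps)
  obtain ts where "timed t b ts" "map fst ts = as" using Cons.IH[OF st(3)] by blast
  then show ?case using st by (intro exI[of _ "(d, s, t) # ts"]) simp
qed (auto intro: exI[of _ "[]"])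

text \<open>Surviving darts inherit their time interval from the coarser timetable, and a contracted
  dart is inserted into the rest that precedes the next surviving one or the end. Hence no time
  interval is ever revised, and the limit loop is already determined at these times.\<close>

lemma timed_refine:
  assumes "timed a b ts" "map fst ts = dproj S \<sigma> as"
  shows "\<exists>ts'. timed a b ts' \<and> map fst ts' = as \<and> tproj S \<sigma> ts' = ts"
  using assms
proof (induction as arbitrary: a ts)
  case (Cons d as)
  show ?case
  proof (cases "fst d \<in> S")
    case True
    then obtain s t r where ts: "ts = ((\<sigma> (fst d), snd d), s, t) # r" "map fst r = dproj S \<sigma> as"
      using Cons.prems(2) by (auto simp: map_eq_Cons_conv)
    obtain r' where "timed t b r'" "map fst r' = as" "tproj S \<sigma> r' = r"
      using Cons.IH[of t r] Cons.prems(1) ts by auto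
    then show ?thesis using ts Cons.prems(1) True by (intro exI[of _ "(d, s, t) # r'"]) simp
  next
    case False
    obtain s t where st: "a < s" "s < t" "timed t b ts" using timed_shrink[OF Cons.prems(1)] by blast
    obtain r' where "timed t b r'" "map fst r' = as" "tproj S \<sigma> r' = ts"
      using Cons.IH[OF st(3)] Cons.prems(2) False by auto
    then show ?thesis using st False by (intro exI[of _ "(d, s, t) # r'"]) simp
  qed
qed simp

lemma timed_tproj: "timed a b ts \<Longrightarrow> timed a b (tproj S \<sigma> ts)"
proof (induction ts arbitrary: a)
  case (Cons e r)
  obtain d s t where e: "e = (d, s, t)" by (cases e)
  then have "timed t b (tproj S \<sigma> r)" "a < s" "s < t" using Cons by auto
  then show ?case using timed_mono[of t b "tproj S \<sigma> r" a] by (simp add: e)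
qed simp

lemma timed_entry:
  assumes "timed a b ts" "(d, s, t) \<in> set ts"
  shows "a < s \<and> s < t \<and> t < b"
  using assms
proof (induction ts arbitrary: a)
  case (Cons e r)
  obtain d' s' t' where e: "e = (d', s', t')" by (cases e)
  have r: "timed t' b r" "a < s'" "s' < t'" using Cons.prems by (auto simp: e)
  show ?case
  proof (cases "(d, s, t) \<in> set r")
    case True
    then show ?thesis using Cons.IH[OF r(1)] r by auto
  next
    case False
    then show ?thesis using Cons.prems(2) r timed_less[OF r(1)] by (auto simp: e)
  qed
qed simp

lemma gapAt_bounds:
  assumes "timed a b ts" "gapAt en u a b ts \<tau> v"
  shows "a \<le> \<tau> \<and> \<tau> \<le> b"
  using assms
proof (induction ts arbitrary: a u)
  case (Cons e r)
  obtain d s t where e: "e = (d, s, t)" by (cases e)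
  have r: "timed t b r" "a < s" "s < t" "t < b" using Cons.prems timed_less[of t b r] by (auto simp: e)
  show ?case using Cons.prems(2) Cons.IH[OF r(1), of "dhead en d"] r by (fastforce simp: e)
qed simp

lemma gapAt_cover:
  assumes "timed a b ts" "a \<le> \<tau>" "\<tau> \<le> b"
  shows "(\<exists>v. gapAt en u a b ts \<tau> v) \<or> (\<exists>d s t. (d, s, t) \<in> set ts \<and> s \<le> \<tau> \<and> \<tau> \<le> t)"
  using assms
proof (induction ts arbitrary: a u)
  case (Cons e r)
  obtain d s t where e: "e = (d, s, t)" by (cases e)
  have r: "timed t b r" using Cons.prems by (simp add: e)
  consider "\<tau> \<le> s" | "s \<le> \<tau>" "\<tau> \<le> t" | "t \<le> \<tau>" by linarith
  then show ?case
  proof cases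
    case 3
    then show ?thesis using Cons.IH[OF r 3 Cons.prems(3), of "dhead en d"] by (simp add: e) blast
  next
    case 1
    then have "gapAt en u a b (e # r) \<tau> u" using Cons.prems(2) by (simp add: e)
    then show ?thesis by blast
  next
    case 2
    then have "(d, s, t) \<in> set (e # r) \<and> s \<le> \<tau> \<and> \<tau> \<le> t" by (simp add: e)
    then show ?thesis by blast
  qed
qed (auto intro!: exI)

lemma gapAt_unique:
  assumes "timed a b ts" "gapAt en u a b ts \<tau> v" "gapAt en u a b ts \<tau> w"
  shows "v = w"
  using assms
proof (induction ts arbitrary: a u)
  case (Cons e r)
  obtain d s t where e: "e = (d, s, t)" by (cases e)
  have r: "timed t b r" "s < t" using Cons.prems by (auto simp: e)
  show ?case
    using Cons.prems(2,3) Cons.IH[OF r(1)] gapAt_bounds[OF r(1), of en "dhead en d" \<tau>] r(2) by (fastforce simp: e)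
qed simp

lemma entry_unique:
  assumes "timed a b ts" "(d, s, t) \<in> set ts" "(d', s', t') \<in> set ts" "s \<le> \<tau>" "\<tau> \<le> t" "s' \<le> \<tau>" "\<tau> \<le> t'"
  shows "(d, s, t) = (d', s', t')"
  using assms
proof (induction ts arbitrary: a)
  case (Cons e r)
  obtain d0 s0 t0 where e: "e = (d0, s0, t0)" by (cases e)
  have r: "timed t0 b r" using Cons.prems by (simp add: e)
  show ?case
    using Cons.prems(2-) Cons.IH[OF r] timed_entry[OF r] by (fastforce simp: e)
qed simp

lemma gapAt_entry:
  assumes "timed a b ts" "walk en u (map fst ts) w" "gapAt en u a b ts \<tau> v" "(d, s, t) \<in> set ts" "s \<le> \<tau>" "\<tau> \<le> t"
  shows "\<tau> = s \<and> v = dtail en d \<or> \<tau> = t \<and> v = dhead en d"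
  using assms
proof (induction ts arbitrary: a u)
  case (Cons e r)
  obtain d0 s0 t0 where e: "e = (d0, s0, t0)" by (cases e)
  have r: "timed t0 b r" "a < s0" "s0 < t0" "walk en (dhead en d0) (map fst r) w" "u = dtail en d0"
    using Cons.prems by (auto simp: e)
  consider "(d, s, t) = (d0, s0, t0)" | "(d, s, t) \<in> set r" using Cons.prems(4) by (auto simp: e)
  then show ?case
  proof cases
    case 1
    have "\<tau> \<le> s0 \<and> v = u \<or> gapAt en (dhead en d0) t0 b r \<tau> v" using Cons.prems(3) by (auto simp: e)
    then show ?thesis
    proof
      assume "gapAt en (dhead en d0) t0 b r \<tau> v"
      moreover then have "\<tau> = t0" using gapAt_bounds[OF r(1)] 1 Cons.prems(6) by force
      moreover have "gapAt en (dhead en d0) t0 b r t0 (dhead en d0)"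
        using r(1) timed_less[OF r(1)] by (cases r) auto
      ultimately show ?thesis using gapAt_unique[OF r(1)] 1 by blast
    qed (use 1 r Cons.prems in auto)
  next
    case 2
    have "t0 < \<tau>" using timed_entry[OF r(1) 2] Cons.prems(5) by auto
    then have "gapAt en (dhead en d0) t0 b r \<tau> v" using Cons.prems(3) r by (auto simp: e)
    then show ?thesis using Cons.IH[OF r(1,4) _ 2] Cons.prems by auto
  qed
qed simp

lemma gapAt_start: "timed t b ts \<Longrightarrow> a \<le> \<tau> \<Longrightarrow> \<tau> \<le> t \<Longrightarrow> gapAt en u a b ts \<tau> u"
  using timed_less[of t b ts] by (cases ts) auto

lemma gapAt_earlier: "gapAt en u t b ts \<tau> v \<Longrightarrow> a \<le> t \<Longrightarrow> gapAt en u a b ts \<tau> v"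
  by (cases ts) auto

lemma gapAt_end: "timed a b ts \<Longrightarrow> walk en u (map fst ts) w \<Longrightarrow> gapAt en u a b ts b w"
  by (induction ts arbitrary: a u) auto

text \<open>Deleting a dart from the timetable joins the rests on both sides of it with its time
  interval, so the coarser rests contain the finer ones.\<close>

lemma gapAt_tproj:
  assumes "timed a b ts" "compat \<rho> S \<sigma> en' en E" "fst ` fst ` set ts \<subseteq> E" "gapAt en' u a b ts \<tau> v"
    "walk en' u (map fst ts) w"
  shows "gapAt en (\<rho> u) a b (tproj S \<sigma> ts) \<tau> (\<rho> v)"
  using assms(1,3-)
proof (induction ts arbitrary: a u)
  case (Cons e r)
  obtain d s t where e: "e = (d, s, t)" by (cases e)
  have r: "timed t b r" "a < s" "s < t" "fst ` fst ` set r \<subseteq> E" "fst d \<in> E" "walk en' (dhead en' d) (map fst r) w"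
      "u = dtail en' d"
    using Cons.prems by (auto simp: e)
  note C = compat_dart[OF assms(2) r(5)]
  have "(a \<le> \<tau> \<and> \<tau> \<le> s \<and> v = u) \<or> gapAt en' (dhead en' d) t b r \<tau> v" using Cons.prems(3) by (simp add: e)
  moreover have "gapAt en (\<rho> (dhead en' d)) t b (tproj S \<sigma> r) \<tau> (\<rho> v)" if "gapAt en' (dhead en' d) t b r \<tau> v"
    using Cons.IH[OF r(1,4) that r(6)] .
  moreover have "gapAt en (\<rho> u) a b (tproj S \<sigma> r) \<tau> (\<rho> u)" if "a \<le> \<tau>" "\<tau> \<le> s"
    using gapAt_start[OF timed_tproj[OF r(1)] that(1)] that(2) r(3) by simp
  ultimately show ?case
    using C r(2,3,7) gapAt_earlier[of en "\<rho> u" t b "tproj S \<sigma> r" \<tau> "\<rho> v" a] by (cases "fst d \<in> S") (auto simp: e)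
qed simp

text \<open>The time interval of a deleted dart is absorbed by a coarser rest, namely at the vertex
  into which both of its ends are merged.\<close>

lemma gapAt_contracted:
  assumes "timed a b ts" "compat \<rho> S \<sigma> en' en E" "fst ` fst ` set ts \<subseteq> E"
    "walk en' u (map fst ts) w" "(d, s, t) \<in> set ts" "fst d \<notin> S" "s \<le> \<tau>" "\<tau> \<le> t"
  shows "gapAt en (\<rho> u) a b (tproj S \<sigma> ts) \<tau> (\<rho> (fst (en' (fst d))))"
  using assms(1,3-)
proof (induction ts arbitrary: a u)
  case (Cons e r)
  obtain d0 s0 t0 where e: "e = (d0, s0, t0)" by (cases e)
  have r: "timed t0 b r" "a < s0" "s0 < t0" "fst ` fst ` set r \<subseteq> E" "fst d0 \<in> E" "walk en' (dhead en' d0) (map fst r) w"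
      "u = dtail en' d0"
    using Cons.prems by (auto simp: e)
  note C = compat_dart[OF assms(2) r(5)]
  consider "(d, s, t) = (d0, s0, t0)" | "(d, s, t) \<in> set r" using Cons.prems(4) by (auto simp: e)
  then show ?case
  proof cases
    case 1
    have "gapAt en (\<rho> u) a b (tproj S \<sigma> r) \<tau> (\<rho> u)"
      using gapAt_start[OF timed_tproj[OF r(1)], of a \<tau>] Cons.prems(6,7) 1 r by auto
    then show ?thesis using 1 C(3) r(7) Cons.prems(5) by (simp add: e)
  next
    case 2
    have "gapAt en (\<rho> (dhead en' d0)) t0 b (tproj S \<sigma> r) \<tau> (\<rho> (fst (en' (fst d))))"
      using Cons.IH[OF r(1,4,6) 2] Cons.prems by simp
    then show ?thesis
      using C r(2,3,7) gapAt_earlier[of en "\<rho> u" t0 b "tproj S \<sigma> r" \<tau> _ a] by (cases "fst d0 \<in> S") (auto simp: e)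
  qed
qed simp

lemma gapAt_visits:
  assumes "timed a b ts" "v = u \<or> (\<exists>d\<in>fst ` set ts. dtail en d = v \<or> dhead en d = v)" "walk en u (map fst ts) w"
  shows "\<exists>\<tau>. a \<le> \<tau> \<and> \<tau> \<le> b \<and> gapAt en u a b ts \<tau> v"
  using assms
proof (induction ts arbitrary: a u)
  case Nil
  then show ?case by (intro exI[of _ a]) simp
next
  case (Cons e r)
  obtain d s t where e: "e = (d, s, t)" by (cases e)
  have r: "timed t b r" "a < s" "s < t" "t < b" "walk en (dhead en d) (map fst r) w" "u = dtail en d"
    using Cons.prems timed_less[of t b r] by (auto simp: e)
  show ?case
  proof (cases "v = u")
    case True
    then show ?thesis using r by (intro exI[of _ a]) (simp add: e)
  next
    case False
    then have "v = dhead en d \<or> (\<exists>d\<in>fst ` set r. dtail en d = v \<or> dhead en d = v)"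
      using Cons.prems(2) r(6) by (auto simp: e)
    from Cons.IH[OF r(1) this r(5)] obtain \<tau> where "t \<le> \<tau>" "\<tau> \<le> b" "gapAt en (dhead en d) t b r \<tau> v" by blast
    then show ?thesis using r by (intro exI[of _ \<tau>]) (simp add: e)
  qed
qed

text \<open>Closed rests form, together with the time intervals of the darts, a finite closed cover
  of the unit interval, from which continuity of the limit loop is derived.\<close>

lemma closed_gapAt: "closed {\<tau>. gapAt en u a b ts \<tau> v}"
proof (induction ts arbitrary: a u)
  case Nil
  have "{\<tau>. gapAt en u a b [] \<tau> v} = (if v = u then {a..b} else {})" by auto
  then show ?case by simp
next
  case (Cons e r)
  obtain d s t where e: "e = (d, s, t)" by (cases e)
  have "{\<tau>. gapAt en u a b (e # r) \<tau> v} = (if v = u then {a..s} else {}) \<union> {\<tau>. gapAt en (dhead en d) t b r \<tau> v}"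
    by (auto simp: e)
  then show ?case using Cons.IH by (simp add: closed_Un)
qed

lemma gapAt_vertex:
  assumes "gapAt en u a b ts \<tau> v" "u \<in> V" "\<And>d. d \<in> fst ` set ts \<Longrightarrow> dhead en d \<in> V"
  shows "v \<in> V"
  using assms
proof (induction ts arbitrary: a u)
  case (Cons e r)
  obtain d s t where e: "e = (d, s, t)" by (cases e)
  show ?case using Cons.prems Cons.IH[of "dhead en d" t] by (auto simp: e)
qed simp

section \<open>The loop of an approximating sequence\<close>

lemma is_decompD:
  assumes "is_decomp X p D"
  shows "finite (dV D)" "finite (dE D)" "dF D \<subseteq> dE D"
    and "\<And>x. x \<in> dE D \<Longrightarrow> fst (dends D x) \<in> dV D \<and> snd (dends D x) \<in> dV D"
    and "\<And>v. v \<in> dV D \<Longrightarrow> dvert D v \<noteq> {}" "\<And>v. v \<in> dV D \<Longrightarrow> dvert D v \<subseteq> X"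
      "\<And>v. v \<in> dV D \<Longrightarrow> compact (dvert D v)" "\<And>v. v \<in> dV D \<Longrightarrow> standard X (dvert D v)"
    and "\<And>f. f \<in> dF D \<Longrightarrow> dfree D f \<in> edges X"
    and "\<And>d. d \<in> dE D \<Longrightarrow> d \<notin> dF D \<Longrightarrow> darc D d \<subseteq> ground X"
      "\<And>d. d \<in> dE D \<Longrightarrow> d \<notin> dF D \<Longrightarrow> arc_or_point (darc D d) (darc0 D d) (darc1 D d)"
    and "X \<subseteq> (\<Union>v\<in>dV D. dvert D v) \<union> (\<Union>f\<in>dF D. dfree D f)"
  using assms by (simp_all add: is_decomp_def peano_continuum_def)

lemma is_decomp_disjoint:
  assumes "is_decomp X p D" "e \<in> edges X"
  shows "\<And>v w. v \<in> dV D \<Longrightarrow> w \<in> dV D \<Longrightarrow> e \<subseteq> dvert D v \<Longrightarrow> e \<subseteq> dvert D w \<Longrightarrow> v = w"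
    and "\<And>f g. f \<in> dF D \<Longrightarrow> g \<in> dF D \<Longrightarrow> e \<subseteq> dfree D f \<Longrightarrow> e \<subseteq> dfree D g \<Longrightarrow> f = g"
    and "\<And>v f. v \<in> dV D \<Longrightarrow> f \<in> dF D \<Longrightarrow> e \<subseteq> dvert D v \<Longrightarrow> \<not> e \<subseteq> dfree D f"
  using assms unfolding is_decomp_def by meson+

lemma is_decomp_ends:
  assumes "is_decomp X p D"
  shows "\<And>f. f \<in> dF D \<Longrightarrow> p (dfree D f) 0 \<in> dvert D (fst (dends D f)) \<and> p (dfree D f) 1 \<in> dvert D (snd (dends D f))"
    and "\<And>d. d \<in> dE D \<Longrightarrow> d \<notin> dF D \<Longrightarrow> darc0 D d \<in> dvert D (fst (dends D d)) \<and> darc1 D d \<in> dvert D (snd (dends D d))"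
  using assms by (simp_all add: is_decomp_def)

lemma edge_paramD:
  assumes "edge_param X p" "e \<in> edges X"
  shows "continuous_on {0..1} (p e)" "p e ` {0<..<1} = e" "inj_on (p e) {0<..<1}"
proof -
  show "continuous_on {0..1} (p e)" using assms by (simp add: edge_param_def)
  obtain q where q: "homeomorphism {0<..<1} e (p e) q" using assms by (auto simp: edge_param_def)
  show "p e ` {0<..<1} = e" using q by (simp add: homeomorphism_def)
  show "inj_on (p e) {0<..<1}" using q by (metis homeomorphism_apply1 inj_on_inverseI)
qed

lemma edge_basics:
  assumes "e \<in> edges X"
  shows "openin (top_of_set X) e" "e \<subseteq> X" "connected e" "\<exists>x\<in>e. \<exists>y\<in>e. x \<noteq> y" "e \<noteq> {}"
proof -
  have e: "openin (top_of_set X) e" "e homeomorphic {0<..<1::real}"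
    using assms by (simp_all add: edges_def open_arc_in_def)
  show "openin (top_of_set X) e" by (rule e)
  then show "e \<subseteq> X" by (rule openin_imp_subset)
  show "connected e" using homeomorphic_connectedness[OF e(2)] by simp
  obtain h k where hk: "homeomorphism {0<..<1::real} e h k"
    using e(2) homeomorphic_sym unfolding homeomorphic_def by metis
  have I: "1/3 \<in> {0<..<1::real}" "1/2 \<in> {0<..<1::real}" by auto
  have "h (1/3) \<noteq> h (1/2)" using homeomorphism_apply1[OF hk I(1)] homeomorphism_apply1[OF hk I(2)] by auto
  moreover have "h (1/3) \<in> e" "h (1/2) \<in> e" using homeomorphism_image1[OF hk] I by blast+
  ultimately show "\<exists>x\<in>e. \<exists>y\<in>e. x \<noteq> y" by blast
  then show "e \<noteq> {}" by blast
qed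

text \<open>The \<open>F\<close>-edges are clopen in the complement of the vertex pieces, since their endpoints lie
  in vertex pieces.\<close>
lemma edge_meets_free:
  assumes D: "is_decomp X p D" and p: "edge_param X p" and f: "f \<in> dF D"
  shows "v \<in> dV D \<Longrightarrow> dfree D f \<inter> dvert D v = {}"
    and "e \<in> edges X \<Longrightarrow> e \<inter> dfree D f \<noteq> {} \<Longrightarrow> e = dfree D f"
proof -
  note dd = is_decompD[OF D]
  have fe: "dfree D f \<in> edges X" using dd(9) f .
  show disj: "dfree D f \<inter> dvert D v = {}" if "v \<in> dV D" for v
  proof (rule ccontr)
    assume "dfree D f \<inter> dvert D v \<noteq> {}"
    then have "dfree D f \<subseteq> dvert D v" using dd(8)[OF that] fe by (auto simp: standard_def)
    then show False using is_decomp_disjoint(3)[OF D fe that f] by simp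
  qed
  assume e: "e \<in> edges X" "e \<inter> dfree D f \<noteq> {}"
  define h where "h = dfree D f"
  have eV: "e \<inter> dvert D v = {}" if "v \<in> dV D" for v
  proof (rule ccontr)
    assume "e \<inter> dvert D v \<noteq> {}"
    then have "e \<subseteq> dvert D v" using dd(8)[OF that] e(1) by (auto simp: standard_def)
    then show False using disj[OF that] e(2) by blast
  qed
  note P = edge_paramD[OF p fe[folded h_def]]
  have V: "fst (dends D f) \<in> dV D" "snd (dends D f) \<in> dV D" using dd(3,4) f by blast+
  have E01: "p h 0 \<notin> e" "p h 1 \<notin> e"
    using is_decomp_ends(1)[OF D f] eV[OF V(1)] eV[OF V(2)] by (auto simp: h_def)
  have I: "{0..1} = {0<..<1} \<union> {0, 1::real}" by auto
  have "p h ` {0..1} = h \<union> {p h 0, p h 1}" unfolding I image_Un P(2) by simp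
  \<comment> \<open>The endpoints of \<open>h\<close> lie in vertex pieces and hence off
    \<open>e\<close>, so within \<open>e\<close> the open arc \<open>h\<close> coincides with the
    compact image of the whole parameter interval.\<close>
  then have "e \<inter> h = e \<inter> p h ` {0..1}" using E01 by (simp add: Int_Un_distrib)
  moreover have "closed (p h ` {0..1})"
    using P(1) by (intro compact_imp_closed compact_continuous_image) auto
  ultimately have "closedin (top_of_set e) (e \<inter> h)" by (metis closedin_closed_Int)
  moreover have "openin (top_of_set e) (e \<inter> h)"
  proof -
    obtain O' where O': "open O'" "h = X \<inter> O'" using edge_basics(1)[OF fe] by (auto simp: openin_open h_def)
    have "e \<inter> h = e \<inter> O'" unfolding O'(2) using edge_basics(2)[OF e(1)] by (metis inf.absorb1 inf_assoc)
    then show ?thesis using O'(1) by (simp add: openin_open_Int)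
  qed
  ultimately have "e \<inter> h = e"
    using edge_basics(3)[OF e(1)] e(2) unfolding connected_clopen h_def by blast
  then have "e \<subseteq> h" by blast
  moreover have "open_arc_in X h" using fe by (simp add: edges_def h_def)
  ultimately have "h = e" using e(1) by (simp add: edges_def)
  then show "e = dfree D f" by (simp add: h_def)
qed

text \<open>For an edge outside \<open>dF D\<close> the choice depends only on its image and
  endpoints, so an edge and its renamed copy in a contracted decomposition receive the same
  path.\<close>

definition dpath :: "('a set \<Rightarrow> real \<Rightarrow> 'a) \<Rightarrow> 'a::metric_space decomp \<Rightarrow> nat \<Rightarrow> real \<Rightarrow> 'a" where
  "dpath p D x = (if x \<in> dF D then p (dfree D x) else
     (SOME q. continuous_on {0..1} q \<and> q ` {0..1} = darc D x \<and> q 0 = darc0 D x \<and> q 1 = darc1 D x))"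

definition epath :: "('a set \<Rightarrow> real \<Rightarrow> 'a) \<Rightarrow> 'a::metric_space decomp \<Rightarrow> dart \<Rightarrow> real \<Rightarrow> 'a" where
  "epath p D a r = dpath p D (fst a) (if snd a then r else 1 - r)"

lemma dpath_arc:
  assumes D: "is_decomp X p D" and x: "x \<in> dE D" "x \<notin> dF D"
  shows "continuous_on {0..1} (dpath p D x)" "dpath p D x ` {0..1} = darc D x"
    "dpath p D x 0 = darc0 D x" "dpath p D x 1 = darc1 D x"
proof -
  define Q where "Q q \<longleftrightarrow> continuous_on {0..1} q \<and> q ` {0..1} = darc D x \<and> q 0 = darc0 D x \<and> q 1 = darc1 D x" for q :: "real \<Rightarrow> 'a"
  have "\<exists>q. Q q"
    using is_decompD(11)[OF D x] unfolding arc_or_point_def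
  proof (elim disjE exE conjE)
    fix g :: "real \<Rightarrow> 'a" assume "arc g" "path_image g = darc D x" "pathstart g = darc0 D x" "pathfinish g = darc1 D x"
    then have "Q g" by (simp add: Q_def arc_def path_def path_image_def pathstart_def pathfinish_def)
    then show ?thesis by blast
  next
    assume "darc D x = {darc0 D x}" "darc1 D x = darc0 D x"
    then have "Q (\<lambda>_. darc0 D x)" by (simp add: Q_def image_constant_conv)
    then show ?thesis by blast
  qed
  then have "Q (SOME q. Q q)" by (rule someI_ex)
  moreover have "dpath p D x = (SOME q. Q q)" using x by (simp add: dpath_def Q_def)
  ultimately have "Q (dpath p D x)" by simp
  then show "continuous_on {0..1} (dpath p D x)" "dpath p D x ` {0..1} = darc D x"
    "dpath p D x 0 = darc0 D x" "dpath p D x 1 = darc1 D x" by (simp_all add: Q_def)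
qed

lemma epath_props:
  assumes D: "is_decomp X p D" and p: "edge_param X p" and a: "fst a \<in> dE D"
  shows "continuous_on {0..1} (epath p D a)" "epath p D a 0 \<in> dvert D (dtail (dends D) a)"
    "epath p D a 1 \<in> dvert D (dhead (dends D) a)"
    "r \<in> {0<..<1} \<Longrightarrow> epath p D a r \<in> eta_edge D (fst a)"
proof -
  define x where "x = fst a"
  have A: "continuous_on {0..1} (dpath p D x) \<and> dpath p D x 0 \<in> dvert D (fst (dends D x)) \<and>
     dpath p D x 1 \<in> dvert D (snd (dends D x)) \<and> (\<forall>r\<in>{0<..<1}. dpath p D x r \<in> eta_edge D x)"
  proof (cases "x \<in> dF D")
    case True
    note P = edge_paramD[OF p is_decompD(9)[OF D True]]
    have "dpath p D x = p (dfree D x)" "eta_edge D x = dfree D x" using True by (simp_all add: dpath_def eta_edge_def)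
    then show ?thesis using P(1,2) is_decomp_ends(1)[OF D True] by auto
  next
    case False
    note P = dpath_arc[OF D a[folded x_def] False]
    have "eta_edge D x = darc D x" using False by (simp add: eta_edge_def)
    moreover have "dpath p D x r \<in> darc D x" if "r \<in> {0<..<1}" for r
      unfolding P(2)[symmetric] using that by (intro imageI) simp
    ultimately show ?thesis using P is_decomp_ends(2)[OF D a[folded x_def] False] by simp
  qed
  show "continuous_on {0..1} (epath p D a)"
    unfolding epath_def x_def[symmetric]
  proof (rule continuous_on_compose2[where t = "{0..1}" and g = "dpath p D x"])
    show "continuous_on {0..1} (\<lambda>r::real. if snd a then r else 1 - r)"
      by (cases "snd a") (auto intro!: continuous_intros)
  qed (use A in auto)
  show "epath p D a 0 \<in> dvert D (dtail (dends D) a)" "epath p D a 1 \<in> dvert D (dhead (dends D) a)"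
    using A by (auto simp: epath_def dtail_def dhead_def x_def)
  show "epath p D a r \<in> eta_edge D (fst a)" if "r \<in> {0<..<1}"
    using A that by (auto simp: epath_def x_def)
qed

lemma epath_minor:
  assumes "minor \<rho> S \<sigma> D' D" "x \<in> S"
  shows "epath p D (\<sigma> x, d) = epath p D' (x, d)"
proof -
  have "(\<sigma> x \<in> dF D \<longleftrightarrow> x \<in> dF D') \<and> (x \<in> dF D' \<longrightarrow> dfree D (\<sigma> x) = dfree D' x) \<and>
        (x \<notin> dF D' \<longrightarrow> darc D (\<sigma> x) = darc D' x \<and> darc0 D (\<sigma> x) = darc0 D' x \<and> darc1 D (\<sigma> x) = darc1 D' x)"
    using assms unfolding minor_def by blast
  then have "dpath p D (\<sigma> x) = dpath p D' x" unfolding dpath_def by auto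
  then show ?thesis by (simp add: epath_def fun_eq_iff)
qed

lemma compact_decreasing_Inter:
  fixes K :: "nat \<Rightarrow> 'a::metric_space set"
  assumes K: "\<And>n. compact (K n)" "\<And>n. K n \<noteq> {}" and anti: "\<And>m n. m \<le> n \<Longrightarrow> K n \<subseteq> K m"
  shows "\<exists>y. \<forall>n. y \<in> K n"
proof -
  have "\<forall>n. \<exists>x. x \<in> K n" using K(2) by blast
  then obtain x where x: "\<And>n. x n \<in> K n" by metis
  then have "\<And>n. x n \<in> K 0" using anti[of 0] by blast
  then obtain l r where r: "strict_mono r" "(x \<circ> r) \<longlonglongrightarrow> l"
    using compact_imp_seq_compact[OF K(1)[of 0]] unfolding seq_compact_def by meson
  have "l \<in> K n" for n
  proof (rule Lim_in_closed_set[OF compact_imp_closed[OF K(1)] _ sequentially_bot r(2)])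
    show "\<forall>\<^sub>F i in sequentially. (x \<circ> r) i \<in> K n"
    proof (rule eventually_sequentiallyI)
      fix i assume "n \<le> i"
      then have "n \<le> r i" using seq_suble[OF r(1), of i] by linarith
      then show "(x \<circ> r) i \<in> K n" using x[of "r i"] anti by auto
    qed
  qed
  then show ?thesis by blast
qed

lemma dist_le_width:
  assumes D: "is_decomp X p D" and v: "v \<in> dV D" "x \<in> dvert D v" "y \<in> dvert D v"
  shows "dist x y \<le> width D"
proof -
  have "dist x y \<le> diameter (dvert D v)"
    using diameter_bounded_bound[OF compact_imp_bounded[OF is_decompD(7)[OF D v(1)]] v(2,3)] .
  also have "\<dots> \<le> width D"
    unfolding width_def using is_decompD(1)[OF D] v(1) by (intro Max_ge) auto
  finally show ?thesis .
qed

section \<open>The limit of compatible timed tours\<close>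

locale timed_tours =
  fixes X :: "'a::metric_space set" and p :: "'a set \<Rightarrow> real \<Rightarrow> 'a" and D :: "nat \<Rightarrow> 'a decomp"
    and u :: "nat \<Rightarrow> nat" and \<rho> :: "nat \<Rightarrow> nat \<Rightarrow> nat" and S :: "nat \<Rightarrow> nat set" and \<sigma> :: "nat \<Rightarrow> nat \<Rightarrow> nat"
    and ts :: "nat \<Rightarrow> tdart list"
  assumes X: "compact X" and p: "edge_param X p" and dec: "\<And>n. is_decomp X p (D n)"
    and conn: "\<And>n. graph_connected (D n)" and wid: "(\<lambda>n. width (D n)) \<longlonglongrightarrow> 0"
    and mnr: "\<And>n. minor (\<rho> n) (S n) (\<sigma> n) (D (Suc n)) (D n)"
    and tour: "\<And>n. tour (D n) (u n) (map fst (ts n))"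
    and time: "\<And>n. timed 0 1 (ts n)"
    and tproj: "\<And>n. tproj (S n) (\<sigma> n) (ts (Suc n)) = ts n"
    and base: "\<And>n. \<rho> n (u (Suc n)) = u n"
begin

abbreviation gap where "gap n \<equiv> gapAt (dends (D n)) (u n) 0 1 (ts n)"

text \<open>Collects the constraints that all levels put on the value at time \<open>\<tau>\<close>.
  At the ends of a time interval both kinds apply, and different levels describe the same time
  differently, so consistency has to be proved.\<close>

definition val :: "real \<Rightarrow> 'a \<Rightarrow> bool" where
  "val \<tau> y \<longleftrightarrow> (\<forall>n v. gap n \<tau> v \<longrightarrow> y \<in> dvert (D n) v) \<and>
     (\<forall>n a s t. (a, s, t) \<in> set (ts n) \<and> s \<le> \<tau> \<and> \<tau> \<le> t \<longrightarrow> y = epath p (D n) a ((\<tau> - s) / (t - s)))"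

lemma tourD: "u n \<in> dV (D n)" "walk (dends (D n)) (u n) (map fst (ts n)) (u n)"
    "distinct (map fst (map fst (ts n)))" "fst ` fst ` set (ts n) = dE (D n)"
  using tour[of n] by (simp_all add: tour_def image_image)

lemma entry_edge: "(a, s, t) \<in> set (ts n) \<Longrightarrow> fst a \<in> dE (D n)"
  using tourD(4)[of n] by (metis fst_conv imageI)

lemma entry_ends: 
  assumes "(a, s, t) \<in> set (ts n)"
  shows "dtail (dends (D n)) a \<in> dV (D n)" "dhead (dends (D n)) a \<in> dV (D n)"
  using is_decompD(4)[OF dec entry_edge[OF assms]] by (auto simp: dtail_def dhead_def)

lemma gap_vertex: "gap n \<tau> v \<Longrightarrow> v \<in> dV (D n)"
  by (rule gapAt_vertex[of "dends (D n)" "u n" 0 1 "ts n"]) (use tourD(1) entry_ends in auto)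

lemma gap_Suc: "gap (Suc n) \<tau> v \<Longrightarrow> gap n \<tau> (\<rho> n v)"
  using gapAt_tproj[OF time minor_compat[OF mnr] _ _ tourD(2), of n \<tau> v] tourD(4)[of "Suc n"]
  by (simp add: tproj base)

lemma entry_contracted:
  assumes "(a, s, t) \<in> set (ts (Suc n))" "fst a \<notin> S n" "s \<le> \<tau>" "\<tau> \<le> t"
  shows "gap n \<tau> (\<rho> n (fst (dends (D (Suc n)) (fst a))))"
  using gapAt_contracted[OF time minor_compat[OF mnr] _ tourD(2) assms] tourD(4)[of "Suc n"]
  by (simp add: tproj base)

lemma entry_proj:
  assumes "(a, s, t) \<in> set (ts (Suc n))" "fst a \<in> S n"
  shows "((\<sigma> n (fst a), snd a), s, t) \<in> set (ts n)" "epath p (D n) (\<sigma> n (fst a), snd a) = epath p (D (Suc n)) a"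
proof -
  show "((\<sigma> n (fst a), snd a), s, t) \<in> set (ts n)"
    unfolding tproj[of n, symmetric] tproj_def set_map set_filter
    using assms by (intro image_eqI[of _ _ "(a, s, t)"]) (auto split: prod.split)
  show "epath p (D n) (\<sigma> n (fst a), snd a) = epath p (D (Suc n)) a"
    using epath_minor[OF mnr assms(2), of p "snd a"] by simp
qed

lemma entry_lift:
  assumes "n \<le> m" "(a, s, t) \<in> set (ts n)"
  shows "\<exists>a'. (a', s, t) \<in> set (ts m) \<and> epath p (D m) a' = epath p (D n) a"
  using assms(1)
proof (induction m rule: dec_induct)
  case (step m)
  then obtain a' where a': "(a', s, t) \<in> set (ts m)" "epath p (D m) a' = epath p (D n) a" by blast
  then have "(a', s, t) \<in> set (tproj (S m) (\<sigma> m) (ts (Suc m)))" by (simp add: tproj)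
  then obtain b where b: "(b, s, t) \<in> set (ts (Suc m))" "fst b \<in> S m" "a' = (\<sigma> m (fst b), snd b)"
    unfolding tproj_def by auto
  then have "epath p (D (Suc m)) b = epath p (D n) a" using entry_proj(2)[OF b(1,2)] a'(2) by simp
  then show ?case using b(1) by blast
qed (use assms(2) in blast)

text \<open>Both entries survive to a common finer level, where at most one entry contains a given
  time.\<close>

lemma entry_value_unique:
  assumes "(a, s, t) \<in> set (ts n)" "s \<le> \<tau>" "\<tau> \<le> t" "(b, s', t') \<in> set (ts m)" "s' \<le> \<tau>" "\<tau> \<le> t'"
  shows "epath p (D n) a ((\<tau> - s) / (t - s)) = epath p (D m) b ((\<tau> - s') / (t' - s'))"
proof -
  define k where "k = max n m"
  obtain a' b' where a': "(a', s, t) \<in> set (ts k)" "epath p (D k) a' = epath p (D n) a"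
    and b': "(b', s', t') \<in> set (ts k)" "epath p (D k) b' = epath p (D m) b"
    using entry_lift[OF _ assms(1), of k] entry_lift[OF _ assms(4), of k] by (auto simp: k_def)
  then show ?thesis using entry_unique[OF time a'(1) b'(1)] assms by auto
qed

text \<open>Inner values of the path lie in the merged vertex piece because contraction adds the
  image of the edge to it, and end values because the pieces of both ends are contained in
  it.\<close>

lemma contracted_value:
  assumes a: "(a, s, t) \<in> set (ts (Suc n))" "fst a \<notin> S n" and r: "r \<in> {0..1}"
  shows "epath p (D (Suc n)) a r \<in> dvert (D n) (\<rho> n (fst (dends (D (Suc n)) (fst a))))"
proof -
  define x where "x = fst a"
  have x: "x \<in> dE (D (Suc n)) - S n" using entry_edge[OF a(1)] a(2) by (simp add: x_def)
  have m: "\<rho> n (fst (dends (D (Suc n)) x)) = \<rho> n (snd (dends (D (Suc n)) x))"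
    "eta_edge (D (Suc n)) x \<subseteq> dvert (D n) (\<rho> n (fst (dends (D (Suc n)) x)))"
    using mnr[of n] x unfolding minor_def by blast+
  have sub: "dvert (D (Suc n)) v \<subseteq> dvert (D n) (\<rho> n v)" if "v \<in> dV (D (Suc n))" for v
    using mnr[of n] that unfolding minor_def by blast
  note E = epath_props[OF dec p entry_edge[OF a(1)]]
  have tl: "\<rho> n (dtail (dends (D (Suc n))) a) = \<rho> n (fst (dends (D (Suc n)) x))"
    "\<rho> n (dhead (dends (D (Suc n))) a) = \<rho> n (fst (dends (D (Suc n)) x))"
    using m(1) by (auto simp: dtail_def dhead_def x_def)
  consider "r = 0" | "r = 1" | "r \<in> {0<..<1}" using r by fastforce
  then show ?thesis
    unfolding x_def[symmetric]
  proof cases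
    case 1
    then show "epath p (D (Suc n)) a r \<in> dvert (D n) (\<rho> n (fst (dends (D (Suc n)) x)))"
      using sub[OF entry_ends(1)[OF a(1)]] E(2) tl(1) by auto
  next
    case 2
    then show "epath p (D (Suc n)) a r \<in> dvert (D n) (\<rho> n (fst (dends (D (Suc n)) x)))"
      using sub[OF entry_ends(2)[OF a(1)]] E(3) tl(2) by auto
  next
    case 3
    then show "epath p (D (Suc n)) a r \<in> dvert (D n) (\<rho> n (fst (dends (D (Suc n)) x)))"
      using E(4) m(2) by (auto simp: x_def)
  qed
qed

lemma entry_gap_value:
  assumes "(a, s, t) \<in> set (ts n)" "s \<le> \<tau>" "\<tau> \<le> t" "gap n \<tau> v"
  shows "epath p (D n) a ((\<tau> - s) / (t - s)) \<in> dvert (D n) v"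
proof -
  have st: "s < t" using timed_entry[OF time assms(1)] by simp
  note E = epath_props[OF dec p entry_edge[OF assms(1)]]
  show ?thesis
    using gapAt_entry[OF time tourD(2) assms(4,1-3)] E(2,3) st by auto
qed

text \<open>At levels \<open>m \<ge> n\<close> the dart survives, and a rest can coincide with it
  only at its ends. At coarser levels the claim descends one level at a time: a rest or a contracted
  dart at level \<open>k + 1\<close> lies in a rest at level \<open>k\<close> with a larger vertex
  piece, and a surviving dart is treated as before.\<close>

lemma entry_val:
  assumes e: "(a, s, t) \<in> set (ts n)" "s \<le> \<tau>" "\<tau> \<le> t"
  shows "val \<tau> (epath p (D n) a ((\<tau> - s) / (t - s)))"
proof -
  define y where "y = epath p (D n) a ((\<tau> - s) / (t - s))"
  have \<tau>: "0 \<le> \<tau>" "\<tau> \<le> 1" using timed_entry[OF time e(1)] e by auto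
  have late: "y \<in> dvert (D m) v" if nm: "n \<le> m" and g: "gap m \<tau> v" for m v
  proof -
    obtain a' where a': "(a', s, t) \<in> set (ts m)" "epath p (D m) a' = epath p (D n) a"
      using entry_lift[OF nm e(1)] by blast
    then show ?thesis using entry_gap_value[OF a'(1) e(2,3) g] by (simp add: y_def)
  qed
  have "\<forall>v. gap k \<tau> v \<longrightarrow> y \<in> dvert (D k) v" if "k \<le> n" for k
    using that
  proof (induction k rule: inc_induct)
    case base
    then show ?case using late[of n] by blast
  next
    case (step k)
    show ?case
    proof (intro allI impI)
      fix v assume v: "gap k \<tau> v"
      consider w where "gap (Suc k) \<tau> w" | b s' t' where "(b, s', t') \<in> set (ts (Suc k))" "s' \<le> \<tau>" "\<tau> \<le> t'"
        using gapAt_cover[OF time \<tau>] by blast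
      then show "y \<in> dvert (D k) v"
      proof cases
        case 1
        have "v = \<rho> k w" using gapAt_unique[OF time v gap_Suc[OF 1]] .
        moreover have "dvert (D (Suc k)) w \<subseteq> dvert (D k) (\<rho> k w)"
          using mnr[of k] gap_vertex[OF 1] unfolding minor_def by blast
        ultimately show ?thesis using step.IH 1 by blast
      next
        case 2
        have y: "y = epath p (D (Suc k)) b ((\<tau> - s') / (t' - s'))"
          unfolding y_def using entry_value_unique[OF e 2] .
        show ?thesis
        proof (cases "fst b \<in> S k")
          case True
          note ep = entry_proj[OF 2(1) True]
          show ?thesis using entry_gap_value[OF ep(1) 2(2,3) v] ep(2) y by simp
        next
          case False
          have "s' < t'" using timed_entry[OF time 2(1)] by simp
          then have "(\<tau> - s') / (t' - s') \<in> {0..1}" using 2 by simp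
          then have "y \<in> dvert (D k) (\<rho> k (fst (dends (D (Suc k)) (fst b))))"
            using contracted_value[OF 2(1) False] y by simp
          moreover have "v = \<rho> k (fst (dends (D (Suc k)) (fst b)))"
            using gapAt_unique[OF time v entry_contracted[OF 2(1) False 2(2,3)]] .
          ultimately show ?thesis by simp
        qed
      qed
    qed
  qed
  then have "y \<in> dvert (D m) v" if "gap m \<tau> v" for m v
    using late that by (cases "m \<le> n") auto
  moreover have "y = epath p (D m) b ((\<tau> - s') / (t' - s'))"
    if "(b, s', t') \<in> set (ts m)" "s' \<le> \<tau>" "\<tau> \<le> t'" for m b s' t'
    unfolding y_def using entry_value_unique[OF e that] .
  ultimately show ?thesis unfolding val_def y_def[symmetric] by blast
qed

text \<open>If no level traverses a dart at this time, every level rests, and the vertex pieces form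
  a decreasing sequence of nonempty compact sets.\<close>

lemma val_exists:
  assumes \<tau>: "0 \<le> \<tau>" "\<tau> \<le> 1"
  shows "\<exists>y. val \<tau> y"
proof (cases "\<exists>n a s t. (a, s, t) \<in> set (ts n) \<and> s \<le> \<tau> \<and> \<tau> \<le> t")
  case True
  then show ?thesis using entry_val by blast
next
  case False
  then have "\<exists>v. gap n \<tau> v" for n using gapAt_cover[OF time \<tau>] by blast
  then obtain v where v: "\<And>n. gap n \<tau> (v n)" by metis
  have "dvert (D (Suc n)) (v (Suc n)) \<subseteq> dvert (D n) (v n)" for n
  proof -
    have "v n = \<rho> n (v (Suc n))" using gapAt_unique[OF time v gap_Suc[OF v]] .
    then show ?thesis using mnr[of n] gap_vertex[OF v[of "Suc n"]] unfolding minor_def by auto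
  qed
  then have anti: "dvert (D n) (v n) \<subseteq> dvert (D m) (v m)" if "m \<le> n" for m n
    using lift_Suc_antimono_le[of "\<lambda>n. dvert (D n) (v n)"] that by blast
  have "\<exists>y. \<forall>n. y \<in> dvert (D n) (v n)"
    using compact_decreasing_Inter[of "\<lambda>n. dvert (D n) (v n)"] is_decompD(5,7)[OF dec gap_vertex[OF v]] anti
    by blast
  then obtain y where y: "\<And>n. y \<in> dvert (D n) (v n)" by blast
  have "y \<in> dvert (D n) w" if "gap n \<tau> w" for n w
    using gapAt_unique[OF time that v] y by simp
  then have "val \<tau> y" using False unfolding val_def by blast
  then show ?thesis by blast
qed

definition loop :: "real \<Rightarrow> 'a" where "loop \<tau> = (SOME y. val \<tau> y)"

lemma loop_val:
  assumes "\<tau> \<in> {0..1}"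
  shows "\<And>n v. gap n \<tau> v \<Longrightarrow> loop \<tau> \<in> dvert (D n) v"
    and "\<And>n a s t. (a, s, t) \<in> set (ts n) \<Longrightarrow> s \<le> \<tau> \<Longrightarrow> \<tau> \<le> t \<Longrightarrow> loop \<tau> = epath p (D n) a ((\<tau> - s) / (t - s))"
proof -
  have "val \<tau> (loop \<tau>)" unfolding loop_def by (rule someI_ex, rule val_exists) (use assms in simp_all)
  then show "\<And>n v. gap n \<tau> v \<Longrightarrow> loop \<tau> \<in> dvert (D n) v"
    "\<And>n a s t. (a, s, t) \<in> set (ts n) \<Longrightarrow> s \<le> \<tau> \<Longrightarrow> \<tau> \<le> t \<Longrightarrow> loop \<tau> = epath p (D n) a ((\<tau> - s) / (t - s))"
    unfolding val_def by blast+
qed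

lemma width_small: "\<epsilon> > 0 \<Longrightarrow> \<exists>n. width (D n) < \<epsilon>"
  using order_tendstoD(2)[OF wid] eventually_happens'[OF sequentially_bot] by blast

text \<open>At a level of width below \<open>\<epsilon>\<close> the loop moves by less than
  \<open>\<epsilon>\<close> during the rests at one vertex and is an explicit path on each dart
  interval. These finitely many closed sets cover the unit interval, and those not containing
  \<open>\<tau>\<close> can be ignored near \<open>\<tau>\<close>.\<close>

lemma loop_continuous: "continuous_on {0..1} loop"
  unfolding continuous_on_def
proof (intro ballI tendstoI)
  fix \<tau> \<epsilon> :: real assume \<tau>: "\<tau> \<in> {0..1}" and "\<epsilon> > 0"
  then obtain n where n: "width (D n) < \<epsilon>" using width_small by blast
  define K where "K v = {x. gap n x v}" for v
  define J where "J e = {fst (snd e)..snd (snd e)}" for e :: tdart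
  define \<P> where "\<P> = K ` dV (D n) \<union> J ` set (ts n)"
  have fin: "finite \<P>" using is_decompD(1)[OF dec] by (simp add: \<P>_def)
  have cover: "{0..1} \<subseteq> \<Union>\<P>"
  proof
    fix x :: real assume "x \<in> {0..1}"
    then have "(\<exists>v. gap n x v) \<or> (\<exists>a s t. (a, s, t) \<in> set (ts n) \<and> s \<le> x \<and> x \<le> t)"
      using gapAt_cover[OF time] by simp
    then show "x \<in> \<Union>\<P>"
    proof
      assume "\<exists>v. gap n x v"
      then show ?thesis using gap_vertex by (auto simp: \<P>_def K_def)
    next
      assume "\<exists>a s t. (a, s, t) \<in> set (ts n) \<and> s \<le> x \<and> x \<le> t"
      then show ?thesis by (force simp: \<P>_def J_def)
    qed
  qed
  have "\<forall>\<^sub>F x in at \<tau>. x \<in> P \<longrightarrow> dist (loop x) (loop \<tau>) < \<epsilon>" if "P \<in> \<P>" for P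
  proof (cases "\<tau> \<in> P")
    case False
    have "closed P" using that closed_gapAt by (auto simp: \<P>_def K_def J_def)
    then have "\<forall>\<^sub>F x in nhds \<tau>. x \<in> - P" using False by (intro eventually_nhds_in_open) auto
    then show ?thesis unfolding eventually_at_filter by eventually_elim auto
  next
    case True
    from that consider v where "v \<in> dV (D n)" "P = K v" | a s t where "(a, s, t) \<in> set (ts n)" "P = {s..t}"
      by (force simp: \<P>_def J_def)
    then show ?thesis
    proof cases
      case 1
      have K01: "x \<in> {0..1}" if "x \<in> K v" for x using gapAt_bounds[OF time] that by (auto simp: K_def)
      have "dist (loop x) (loop \<tau>) < \<epsilon>" if "x \<in> P" for x
      proof -
        have "loop x \<in> dvert (D n) v" "loop \<tau> \<in> dvert (D n) v"
          using loop_val(1) K01 that True 1(2) by (auto simp: K_def)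
        then show ?thesis using dist_le_width[OF dec 1(1)] n by fastforce
      qed
      then show ?thesis by (simp add: always_eventually)
    next
      case 2
      have st: "0 < s" "s < t" "t < 1" using timed_entry[OF time 2(1)] by auto
      have "continuous_on {s..t} (\<lambda>x. epath p (D n) a ((x - s) / (t - s)))"
        by (rule continuous_on_compose2[OF epath_props(1)[OF dec p entry_edge[OF 2(1)]]])
           (use st in \<open>auto intro!: continuous_intros\<close>)
      moreover have "loop x = epath p (D n) a ((x - s) / (t - s))" if "x \<in> {s..t}" for x
        using loop_val(2)[OF _ 2(1), of x] that st by simp
      ultimately have "continuous_on {s..t} loop" by (metis (no_types, lifting) continuous_on_cong)
      then have "\<forall>\<^sub>F x in at \<tau> within {s..t}. dist (loop x) (loop \<tau>) < \<epsilon>"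
        using True[unfolded 2(2)] \<open>\<epsilon> > 0\<close> unfolding continuous_on_def by (blast intro: tendstoD)
      then show ?thesis unfolding 2(2) eventually_at_filter by eventually_elim auto
    qed
  qed
  then have "\<forall>\<^sub>F x in at \<tau>. \<forall>P\<in>\<P>. x \<in> P \<longrightarrow> dist (loop x) (loop \<tau>) < \<epsilon>"
    using fin by (intro eventually_ball_finite) auto
  then have "\<forall>\<^sub>F x in at \<tau>. x \<in> {0..1} \<longrightarrow> dist (loop x) (loop \<tau>) < \<epsilon>"
    by eventually_elim (use cover in blast)
  then show "\<forall>\<^sub>F x in at \<tau> within {0..1}. dist (loop x) (loop \<tau>) < \<epsilon>"
    unfolding eventually_at_filter by eventually_elim auto
qed

text \<open>Both times are rests at the base vertex on every level, and the widths tend to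
  0.\<close>

lemma loop_closed: "loop 0 = loop 1"
proof (rule ccontr)
  assume "loop 0 \<noteq> loop 1"
  then obtain n where n: "width (D n) < dist (loop 0) (loop 1)" using width_small[of "dist (loop 0) (loop 1)"] by auto
  have "gap n 0 (u n)" using time[of n] by (cases "ts n") auto
  moreover have "gap n 1 (u n)" using gapAt_end[OF time tourD(2)] .
  ultimately have "loop 0 \<in> dvert (D n) (u n)" "loop 1 \<in> dvert (D n) (u n)"
    using loop_val(1)[of 0] loop_val(1)[of 1] by auto
  then show False using dist_le_width[OF dec tourD(1)] n by fastforce
qed

lemma loop_on_free:
  assumes e: "((f, d), s, t) \<in> set (ts n)" and f: "f \<in> dF (D n)" and r: "r \<in> {0..1}"
  shows "loop (s + (if d then r else 1 - r) * (t - s)) = p (dfree (D n) f) r"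
proof -
  define r' where "r' = (if d then r else 1 - r)"
  have st: "0 < s" "s < t" "t < 1" using timed_entry[OF time e] by auto
  have r': "0 \<le> r'" "r' \<le> 1" using r by (auto simp: r'_def)
  have "0 \<le> r' * (t - s)" "r' * (t - s) \<le> 1 * (t - s)"
    using r' st by (intro mult_right_mono mult_nonneg_nonneg; simp)+
  then have "s \<le> s + r' * (t - s)" "s + r' * (t - s) \<le> t" by simp_all
  then have "loop (s + r' * (t - s)) = epath p (D n) (f, d) ((s + r' * (t - s) - s) / (t - s))"
    using st by (intro loop_val(2)[OF _ e]) simp_all
  also have "\<dots> = epath p (D n) (f, d) r'" using st by simp
  also have "\<dots> = p (dfree (D n) f) r" using f by (auto simp: epath_def dpath_def r'_def)
  finally show ?thesis by (simp add: r'_def)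
qed

lemma loop_image: "loop ` {0..1} = X"
proof (intro equalityI subsetI)
  fix x assume "x \<in> loop ` {0..1}"
  then obtain \<tau> where \<tau>: "\<tau> \<in> {0..1}" "x = loop \<tau>" by blast
  have "p e ` {0..1} \<subseteq> X" if "e \<in> edges X" for e
  proof -
    have "p e ` {0..1} \<subseteq> closure e" using p that by (simp add: edge_param_def)
    also have "\<dots> \<subseteq> X" using edge_basics(2)[OF that] X by (simp add: closure_minimal compact_imp_closed)
    finally show ?thesis .
  qed note pX = this
  have "0 \<le> \<tau>" "\<tau> \<le> 1" using \<tau>(1) by simp_all
  then consider v where "gap 0 \<tau> v" | a s t where "(a, s, t) \<in> set (ts 0)" "s \<le> \<tau>" "\<tau> \<le> t"
    using gapAt_cover[OF time[of 0]] by metis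
  then show "x \<in> X"
  proof cases
    case 1
    then show ?thesis using loop_val(1)[OF \<tau>(1) 1] is_decompD(6)[OF dec gap_vertex[OF 1]] \<tau> by blast
  next
    case 2
    have "s < t" using timed_entry[OF time 2(1)] by simp
    then have "(\<tau> - s) / (t - s) \<in> {0..1}" using 2 by simp
    define r where "r = (if snd a then (\<tau> - s) / (t - s) else 1 - (\<tau> - s) / (t - s))"
    have r: "r \<in> {0..1}" "x = dpath p (D 0) (fst a) r"
      using loop_val(2)[OF \<tau>(1) 2] \<tau>(2) \<open>(\<tau> - s) / (t - s) \<in> {0..1}\<close> by (simp_all add: epath_def r_def)
    show ?thesis
    proof (cases "fst a \<in> dF (D 0)")
      case True
      then show ?thesis using r pX[OF is_decompD(9)[OF dec True]] by (auto simp: dpath_def)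
    next
      case False
      have "x \<in> darc (D 0) (fst a)" using dpath_arc(2)[OF dec entry_edge[OF 2(1)] False] r by blast
      then show ?thesis using is_decompD(10)[OF dec entry_edge[OF 2(1)] False] by (auto simp: ground_def)
    qed
  qed
next
  fix x assume x: "x \<in> X"
  show "x \<in> loop ` {0..1}"
  proof (cases "\<exists>n. \<exists>f\<in>dF (D n). x \<in> dfree (D n) f")
    case True
    then obtain n f where f: "f \<in> dF (D n)" "x \<in> dfree (D n) f" by blast
    then have "f \<in> fst ` fst ` set (ts n)" using tourD(4) is_decompD(3)[OF dec] by blast
    then obtain d s t where e: "((f, d), s, t) \<in> set (ts n)" by force
    have "x \<in> p (dfree (D n) f) ` {0<..<1}" using edge_paramD(2)[OF p is_decompD(9)[OF dec f(1)]] f(2) by simp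
    then obtain r where r: "r \<in> {0<..<1}" "x = p (dfree (D n) f) r" by blast
    define r' where "r' = (if d then r else 1 - r)"
    have st: "0 < s" "s < t" "t < 1" using timed_entry[OF time e] by auto
    have r': "0 \<le> r'" "r' \<le> 1" using r by (auto simp: r'_def)
    have "0 \<le> r' * (t - s)" "r' * (t - s) \<le> 1 * (t - s)"
      using r' st by (intro mult_right_mono mult_nonneg_nonneg; simp)+
    then have "s \<le> s + r' * (t - s)" "s + r' * (t - s) \<le> t" by simp_all
    then have "0 \<le> s + r' * (t - s)" "s + r' * (t - s) \<le> 1" using st by (blast intro: order_trans less_imp_le)+
    then have "s + r' * (t - s) \<in> {0..1}" by simp
    moreover have "loop (s + r' * (t - s)) = x" using loop_on_free[OF e f(1), of r] r by (simp add: r'_def)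
    ultimately show ?thesis by blast
  next
    case False
    \<comment> \<open>The point lies on no free edge at any level, so at each level it shares a
      vertex piece with a value of the loop. As the image is closed, the point belongs to
      it.\<close>
    have "compact (loop ` {0..1})" using loop_continuous by (intro compact_continuous_image) auto
    then have "closed (loop ` {0..1})" by (rule compact_imp_closed)
    moreover have "x \<in> closure (loop ` {0..1})"
      unfolding closure_approachable
    proof (intro allI impI)
      fix \<epsilon> :: real assume "\<epsilon> > 0"
      then obtain n where n: "width (D n) < \<epsilon>" using width_small by blast
      obtain v where v: "v \<in> dV (D n)" "x \<in> dvert (D n) v"
        using is_decompD(12)[OF dec[of n]] x False by blast
      have "v = u n \<or> (\<exists>d\<in>fst ` set (ts n). dtail (dends (D n)) d = v \<or> dhead (dends (D n)) d = v)"
        using tour_visits[OF tour conn v(1)] by simp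
      from gapAt_visits[OF time this tourD(2)] obtain \<tau> where \<tau>: "0 \<le> \<tau>" "\<tau> \<le> 1" "gap n \<tau> v" by blast
      then have "loop \<tau> \<in> dvert (D n) v" using loop_val(1) by simp
      then have "dist (loop \<tau>) x < \<epsilon>" using dist_le_width[OF dec v(1) _ v(2)] n by fastforce
      then show "\<exists>y\<in>loop ` {0..1}. dist y x < \<epsilon>" using \<tau> by force
    qed
    ultimately show ?thesis by (simp add: closure_closed)
  qed
qed

text \<open>Otherwise the edge lies, by standardness, in a single vertex piece at every level, which
  is impossible once the width is below the distance of two of its points.\<close>

lemma edge_is_free:
  assumes e: "e \<in> edges X"
  shows "\<exists>n. \<exists>f\<in>dF (D n). e = dfree (D n) f"
proof (rule ccontr)
  assume no: "\<not> ?thesis"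
  obtain x y where xy: "x \<in> e" "y \<in> e" "x \<noteq> y" using edge_basics(4)[OF e] by blast
  obtain n where n: "width (D n) < dist x y" using width_small[of "dist x y"] xy by auto
  have "x \<in> X" using edge_basics(2)[OF e] xy by blast
  moreover have "x \<notin> dfree (D n) f" if "f \<in> dF (D n)" for f
    using edge_meets_free(2)[OF dec p that e] no that xy(1) by blast
  ultimately obtain v where v: "v \<in> dV (D n)" "x \<in> dvert (D n) v"
    using is_decompD(12)[OF dec[of n]] by blast
  then have "e \<subseteq> dvert (D n) v"
    using is_decompD(8)[OF dec v(1)] e xy(1) by (auto simp: standard_def)
  then show False using dist_le_width[OF dec v] xy n by fastforce
qed

text \<open>At a level where \<open>e\<close> is free its points lie in no vertex piece, so they are
  reached only while a dart is traversed. Paths of edges outside \<open>dF\<close> stay in the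
  ground space, another free edge is disjoint from \<open>e\<close>, and the tour uses each edge
  once.\<close>

lemma loop_inj_on_edge:
  assumes e: "e \<in> edges X" "x \<in> e" and \<tau>: "\<tau> \<in> {0..1}" "loop \<tau> = x" and \<tau>': "\<tau>' \<in> {0..1}" "loop \<tau>' = x"
  shows "\<tau> = \<tau>'"
proof -
  obtain n f where f: "f \<in> dF (D n)" "e = dfree (D n) f" using edge_is_free[OF e(1)] by blast
  have disj: "x \<notin> dvert (D n) v" if "v \<in> dV (D n)" for v
    using edge_meets_free(1)[OF dec p f(1) that] e(2) f(2) by blast
  note P = edge_paramD[OF p e(1)]
  have main: "\<exists>d s t r. ((f, d), s, t) \<in> set (ts n) \<and> r \<in> {0<..<1} \<and> p e r = x \<and> z = s + (if d then r else 1 - r) * (t - s)"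
    if z: "z \<in> {0..1}" "loop z = x" for z
  proof -
    have "\<not> gap n z v" for v using loop_val(1)[OF z(1), of n v] gap_vertex[of n z v] disj z(2) by blast
    moreover have "0 \<le> z" "z \<le> 1" using z(1) by simp_all
    ultimately obtain a s t where a: "(a, s, t) \<in> set (ts n)" "s \<le> z" "z \<le> t"
      using gapAt_cover[OF time[of n]] by metis
    define r0 where "r0 = (z - s) / (t - s)"
    define r where "r = (if snd a then r0 else 1 - r0)"
    have st: "s < t" using timed_entry[OF time a(1)] by simp
    have r0: "r0 \<in> {0..1}" using a st by (simp add: r0_def)
    then have r: "r \<in> {0..1}" by (auto simp: r_def)
    have xr: "x = dpath p (D n) (fst a) r"
      using loop_val(2)[OF z(1) a] z(2) by (simp add: epath_def r_def r0_def)
    note aE = entry_edge[OF a(1)]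
    have aF: "fst a \<in> dF (D n)"
    proof (rule ccontr)
      assume no: "fst a \<notin> dF (D n)"
      have "x \<in> darc (D n) (fst a)" using dpath_arc(2)[OF dec aE no] xr r by blast
      then have "x \<in> ground X" using is_decompD(10)[OF dec aE no] by blast
      then show False using e by (auto simp: ground_def)
    qed
    define h where "h = dfree (D n) (fst a)"
    have xh: "x = p h r" using xr aF by (simp add: dpath_def h_def)
    have V: "fst (dends (D n) (fst a)) \<in> dV (D n)" "snd (dends (D n) (fst a)) \<in> dV (D n)"
      using is_decompD(4)[OF dec aE] by blast+
    \<comment> \<open>The end values of the path lie in vertex pieces, so \<open>x\<close> is
      reached at an inner parameter.\<close>
    have "p h 0 \<noteq> x" "p h 1 \<noteq> x"
      using is_decomp_ends(1)[OF dec aF] disj[OF V(1)] disj[OF V(2)] by (auto simp: h_def)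
    then have r01: "r \<in> {0<..<1}" using r xh by (cases "r = 0"; cases "r = 1") auto
    have hE: "h \<in> edges X" using is_decompD(9)[OF dec aF] by (simp add: h_def)
    have "x \<in> h" using edge_paramD(2)[OF p hE] r01 xh by blast
    then have "e \<inter> dfree (D n) (fst a) \<noteq> {}" using e(2) unfolding h_def by blast
    then have "e = h" using edge_meets_free(2)[OF dec p aF e(1)] by (simp add: h_def)
    moreover have "e \<subseteq> dfree (D n) f" unfolding f(2) by (rule subset_refl)
    ultimately have "fst a = f" by (intro is_decomp_disjoint(2)[OF dec e(1) aF f(1)]) (simp add: h_def)
    moreover have "z = s + (if snd a then r else 1 - r) * (t - s)"
      using st by (simp add: r_def r0_def)
    moreover have "p e r = x" unfolding \<open>e = h\<close> using xh by simp
    moreover have "((fst a, snd a), s, t) \<in> set (ts n)" using a(1) by simp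
    ultimately show ?thesis using r01 by blast
  qed
  from main[OF \<tau>] obtain d s t r where 1: "((f, d), s, t) \<in> set (ts n)" "r \<in> {0<..<1}" "p e r = x" "\<tau> = s + (if d then r else 1 - r) * (t - s)"
    by (elim exE conjE)
  from main[OF \<tau>'] obtain d' s' t' r' where 2: "((f, d'), s', t') \<in> set (ts n)" "r' \<in> {0<..<1}" "p e r' = x" "\<tau>' = s' + (if d' then r' else 1 - r') * (t' - s')"
    by (elim exE conjE)
  have "inj_on (\<lambda>e. fst (fst e)) (set (ts n))"
    using tourD(3)[of n] by (simp add: distinct_map comp_def)
  then have "((f, d), s, t) = ((f, d'), s', t')" using 1(1) 2(1) by (intro inj_onD[of "\<lambda>e. fst (fst e)"]) auto
  moreover have "r = r'" using 1(3) 2(3) by (intro inj_onD[OF P(3) _ 1(2) 2(2)]) simp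
  ultimately show ?thesis using 1(4) 2(4) by simp
qed

lemma mono_loop_loop: "mono_loop X (loop 0) loop"
  unfolding mono_loop_def
proof (intro conjI ballI allI impI)
  fix x \<tau> z \<tau>' assume "x \<in> \<Union>(edges X)" and A: "0 \<le> \<tau> \<and> \<tau> \<le> z \<and> z \<le> \<tau>' \<and> \<tau>' \<le> 1 \<and> loop \<tau> = x \<and> loop \<tau>' = x"
  then obtain e where "e \<in> edges X" "x \<in> e" by blast
  then have "\<tau> = \<tau>'" using loop_inj_on_edge[of e x \<tau> \<tau>'] A by simp
  then have "z = \<tau>" using A by linarith
  then show "loop z = x" using A by simp
qed (use loop_continuous loop_image loop_closed in auto)

end

lemma approximating_sequence_imp_mono_loop:
  fixes X :: "'a::metric_space set"
  assumes X: "compact X" and p: "edge_param X p" and seq: "approximating_sequence X p D"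
  obtains b \<gamma> where "mono_loop X b \<gamma>"
proof -
  have eul: "eulerian_decomp X p (D n)" and le: "decomp_le (D n) (D (Suc n))" for n
    using seq by (simp_all add: approximating_sequence_def)
  have wid: "(\<lambda>n. width (D n)) \<longlonglongrightarrow> 0" using seq by (simp add: approximating_sequence_def)
  have dec: "is_decomp X p (D n)" and conn: "graph_connected (D n)"
    and ev: "\<And>v. v \<in> dV (D n) \<Longrightarrow> even (degree (D n) v)" for n
    using eul[of n] by (simp_all add: eulerian_decomp_def)
  note dd = is_decompD[OF dec]
  have "\<exists>\<rho> S \<sigma>. minor \<rho> S \<sigma> (D (Suc n)) (D n)" for n
    using decomp_le_minor[OF le dd(4)] .
  then obtain \<rho> S \<sigma> where mnr: "\<And>n. minor (\<rho> n) (S n) (\<sigma> n) (D (Suc n)) (D n)" by metis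
  define T where "T n = {(u, as). tour (D n) u as}" for n
  define F where "F n = (\<lambda>(u, as). (\<rho> n u, dproj (S n) (\<sigma> n) as))" for n
  \<comment> \<open>Projection maps the finite nonempty set of tours at one level into that of the
    level before, so a compatible sequence exists.\<close>
  obtain w where w: "\<And>n. w n \<in> T n" "\<And>n. F n (w (Suc n)) = w n"
  proof (rule inverse_limit_finite[of T F])
    show "finite (T n)" for n unfolding T_def using finite_tours dd(1,2) .
    show "T n \<noteq> {}" for n using euler_tour_exists[OF dd(2,4) conn ev] by (auto simp: T_def)
    show "F n x \<in> T n" if "x \<in> T (Suc n)" for n x
      using that tour_dproj[OF mnr] by (auto simp: T_def F_def)
  qed blast
  define u where "u n = fst (w n)" for n
  define as where "as n = snd (w n)" for n
  have tour: "tour (D n) (u n) (as n)" for n using w(1)[of n] by (auto simp: T_def u_def as_def)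
  have comp: "\<rho> n (u (Suc n)) = u n" "dproj (S n) (\<sigma> n) (as (Suc n)) = as n" for n
    using arg_cong[OF w(2)[of n], of fst] arg_cong[OF w(2)[of n], of snd]
    by (simp_all add: F_def u_def as_def case_prod_beta)
  have "\<exists>ts. \<forall>n. (timed 0 1 (ts n) \<and> map fst (ts n) = as n) \<and> tproj (S n) (\<sigma> n) (ts (Suc n)) = ts n"
  proof (rule dependent_nat_choice)
    show "\<exists>ts. timed 0 1 ts \<and> map fst ts = as 0" using timed_exists by simp
    show "\<exists>ts'. (timed 0 1 ts' \<and> map fst ts' = as (Suc n)) \<and> tproj (S n) (\<sigma> n) ts' = ts"
      if "timed 0 1 ts \<and> map fst ts = as n" for ts n
      using timed_refine[of 0 1 ts "S n" "\<sigma> n" "as (Suc n)"] that comp(2)[of n] by auto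
  qed
  then obtain ts where ts: "\<And>n. timed 0 1 (ts n)" "\<And>n. map fst (ts n) = as n"
    "\<And>n. tproj (S n) (\<sigma> n) (ts (Suc n)) = ts n" by blast
  interpret timed_tours X p D u \<rho> S \<sigma> ts
    by unfold_locales (use X p dec conn wid mnr tour ts comp in auto)
  show thesis using that mono_loop_loop by blast
qed

section \<open>Decompositions from an edge-wise Eulerian loop\<close>

text \<open>The loop is cut open at a ground point, so that the times over an edge form an interval
  that does not wrap around.\<close>

locale simple_loop =
  fixes X :: "'a::metric_space set" and p :: "'a set \<Rightarrow> real \<Rightarrow> 'a" and \<gamma> :: "real \<Rightarrow> 'a"
  assumes p: "edge_param X p" and cont: "continuous_on {0..1} \<gamma>" and im: "\<gamma> ` {0..1} = X"
    and closed: "\<gamma> 0 = \<gamma> 1" and base: "\<gamma> 0 \<notin> \<Union>(edges X)"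
    and simple: "\<And>s t. s \<in> {0..1} \<Longrightarrow> t \<in> {0..1} \<Longrightarrow> \<gamma> s \<in> \<Union>(edges X) \<Longrightarrow> \<gamma> s = \<gamma> t \<Longrightarrow> s = t"
begin

definition times :: "'a set \<Rightarrow> real set" where "times W = {t \<in> {0..1}. \<gamma> t \<in> W}"

text \<open>On the times over \<open>W\<close> the loop is injective. It is also a closed map there:
  the image of a relatively closed set is \<open>W\<close> intersected with the image of a compact
  set, because values in \<open>W\<close> are taken only at times over \<open>W\<close>.\<close>

lemma times_homeomorphic:
  assumes W: "openin (top_of_set X) W" "W \<subseteq> \<Union>(edges X)"
  shows "open (times W)" "times W \<subseteq> {0..1}" "times W homeomorphic W" "\<gamma> ` times W = W"
    "\<exists>k. homeomorphism (times W) W \<gamma> k"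
proof -
  have WX: "W \<subseteq> X" using W(1) openin_imp_subset by blast
  show sub: "times W \<subseteq> {0..1}" by (auto simp: times_def)
  have "0 \<notin> times W" "1 \<notin> times W" using base closed W(2) by (auto simp: times_def)
  then have sub': "times W \<subseteq> {0<..<1}"
    using sub by (force simp: subset_iff order_le_less)
  have "openin (top_of_set {0..1}) ({0..1} \<inter> \<gamma> -` W)"
    using cont im W(1) by (intro continuous_openin_preimage[of _ _ X]) auto
  moreover have tW: "times W = {0..1} \<inter> \<gamma> -` W" by (auto simp: times_def)
  ultimately have "openin (top_of_set {0..1}) (times W)" by simp
  then have "openin (top_of_set {0<..<1}) (times W)"
    by (rule openin_subset_trans) (use sub' in auto)
  then show "open (times W)" by (rule openin_open_trans) simp
  show imW: "\<gamma> ` times W = W" using im WX unfolding times_def by blast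
  have contW: "continuous_on (times W) \<gamma>" using cont sub continuous_on_subset by blast
  have injW: "inj_on \<gamma> (times W)"
  proof (rule inj_onI)
    fix s t assume "s \<in> times W" "t \<in> times W" "\<gamma> s = \<gamma> t"
    moreover then have "\<gamma> s \<in> \<Union>(edges X)" using W(2) unfolding times_def by blast
    ultimately show "s = t" using simple sub by blast
  qed
  have clW: "closedin (top_of_set W) (\<gamma> ` U)" if U: "closedin (top_of_set (times W)) U" for U
  proof -
    obtain K where K: "closed K" "U = times W \<inter> K" using U by (auto simp: closedin_closed)
    have "compact (\<gamma> ` ({0..1} \<inter> K))"
      using cont K(1) by (intro compact_continuous_image) (auto intro: continuous_on_subset compact_Int_closed)
    then have "closed (\<gamma> ` ({0..1} \<inter> K))" by (rule compact_imp_closed)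
    moreover have "\<gamma> ` U = W \<inter> \<gamma> ` ({0..1} \<inter> K)"
      unfolding K(2) times_def by blast
    ultimately show ?thesis by (simp add: closedin_closed_Int)
  qed
  show hk: "\<exists>k. homeomorphism (times W) W \<gamma> k"
    using homeomorphism_injective_closed_map[OF contW imW injW clW] by metis
  then show "times W homeomorphic W" unfolding homeomorphic_def by blast
qed

lemma connected_times:
  assumes "openin (top_of_set X) W" "W \<subseteq> \<Union>(edges X)" "connected W" "W \<noteq> {}"
  obtains l r where "0 \<le> l" "l < r" "r \<le> 1" "times W = {l<..<r}"
proof -
  note H = times_homeomorphic[OF assms(1,2)]
  have "connected (times W)" using homeomorphic_connectedness[OF H(3)] assms(3) by simp
  moreover have "times W \<noteq> {}" using H(4) assms(4) by blast
  ultimately show thesis using open_connected_bounded_real[OF H(1) _ _ H(2)] that by metis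
qed

definition lo where "lo e = Inf (times e)"
definition hi where "hi e = Sup (times e)"

lemma edge_times:
  assumes "e \<in> edges X"
  shows "0 \<le> lo e" "lo e < hi e" "hi e \<le> 1" "times e = {lo e<..<hi e}"
proof -
  have "e \<subseteq> \<Union>(edges X)" using assms by (rule Union_upper)
  then obtain l r where lr: "0 \<le> l" "l < r" "r \<le> 1" "times e = {l<..<r}"
    by (rule connected_times[OF edge_basics(1)[OF assms] _ edge_basics(3,5)[OF assms]])
  then have "lo e = l" "hi e = r" by (simp_all add: lo_def hi_def)
  then show "0 \<le> lo e" "lo e < hi e" "hi e \<le> 1" "times e = {lo e<..<hi e}" using lr by simp_all
qed

lemma mem_edge_times: "e \<in> edges X \<Longrightarrow> 0 \<le> t \<Longrightarrow> t \<le> 1 \<Longrightarrow> \<gamma> t \<in> e \<longleftrightarrow> lo e < t \<and> t < hi e"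
proof -
  assume "e \<in> edges X" "0 \<le> t" "t \<le> 1"
  then have "\<gamma> t \<in> e \<longleftrightarrow> t \<in> times e" by (simp add: times_def)
  also have "\<dots> \<longleftrightarrow> lo e < t \<and> t < hi e" unfolding edge_times(4)[OF \<open>e \<in> edges X\<close>] by simp
  finally show ?thesis .
qed

text \<open>The union of two overlapping edges is open and connected, so its times form an open
  interval and it is an open arc; maximality forces equality. On a circle this fails, but there no
  base point in the ground space exists.\<close>

lemma edges_disjoint:
  assumes e: "e \<in> edges X" "e' \<in> edges X" "x \<in> e" "x \<in> e'"
  shows "e = e'"
proof -
  define W where "W = e \<union> e'"
  have W: "openin (top_of_set X) W" "W \<subseteq> \<Union>(edges X)" "W \<noteq> {}"
    using edge_basics(1)[OF e(1)] edge_basics(1)[OF e(2)] e by (auto simp: W_def)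
  have "connected W"
    unfolding W_def using edge_basics(3)[OF e(1)] edge_basics(3)[OF e(2)] e(3,4) by (intro connected_Un) auto
  then obtain l r where lr: "l < r" "times W = {l<..<r}" using connected_times[OF W(1,2) _ W(3)] by metis
  have "W homeomorphic {0<..<1::real}"
    using times_homeomorphic(3)[OF W(1,2)] homeomorphic_Ioo[OF lr(1)] lr(2)
    by (metis homeomorphic_sym homeomorphic_trans)
  then have "open_arc_in X W" using W(1) by (simp add: open_arc_in_def)
  moreover have "e \<subseteq> W" "e' \<subseteq> W" by (auto simp: W_def)
  ultimately have "W = e" "W = e'" using e(1,2) unfolding edges_def by blast+
  then show ?thesis by simp
qed

end

text \<open>As \<open>t\<close> tends to \<open>l\<close>, \<open>\<phi> t\<close> tends to 0, so
  both continuous maps have the same limit.\<close>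

lemma reparam_left_end:
  fixes h \<gamma> :: "real \<Rightarrow> 'a::metric_space" and \<phi> :: "real \<Rightarrow> real"
  assumes h: "continuous_on {0..1} h" and \<gamma>: "continuous_on {l..r} \<gamma>" and lr: "l < r"
    and \<phi>: "\<phi> ` {l<..<r} = {0<..<1}" "strict_mono_on {l<..<r} \<phi>"
    and eq: "\<And>t. t \<in> {l<..<r} \<Longrightarrow> \<gamma> t = h (\<phi> t)"
  shows "\<gamma> l = h 0"
proof (rule ccontr)
  assume ne: "\<gamma> l \<noteq> h 0"
  define \<epsilon> where "\<epsilon> = dist (\<gamma> l) (h 0) / 2"
  have \<epsilon>: "\<epsilon> > 0" using ne by (simp add: \<epsilon>_def)
  obtain \<delta> where \<delta>: "\<delta> > 0" "\<And>t. t \<in> {l..r} \<Longrightarrow> dist t l < \<delta> \<Longrightarrow> dist (\<gamma> t) (\<gamma> l) < \<epsilon>"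
    using \<gamma> \<epsilon> lr unfolding continuous_on_iff by (metis atLeastAtMost_iff less_imp_le order_refl)
  obtain \<eta> where \<eta>: "\<eta> > 0" "\<And>s. s \<in> {0..1} \<Longrightarrow> dist s 0 < \<eta> \<Longrightarrow> dist (h s) (h 0) < \<epsilon>"
    using h \<epsilon> unfolding continuous_on_iff by (metis atLeastAtMost_iff order_refl zero_le_one)
  have "min \<eta> 1 / 2 \<in> {0<..<1}" using \<eta>(1) by auto
  then obtain t1 where t1: "t1 \<in> {l<..<r}" "\<phi> t1 = min \<eta> 1 / 2" using \<phi>(1) by (metis imageE)
  define t where "t = min t1 (l + \<delta> / 2)"
  have t: "t \<in> {l<..<r}" "t \<le> t1" "dist t l < \<delta>" using t1(1) \<delta>(1) by (auto simp: t_def dist_real_def)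
  have "\<phi> t \<le> \<phi> t1" using strict_mono_onD[OF \<phi>(2) t(1) t1(1)] t(2) by (cases "t = t1") auto
  moreover have "\<phi> t \<in> {0<..<1}" using \<phi>(1) t(1) by blast
  ultimately have "dist (h (\<phi> t)) (h 0) < \<epsilon>" using t1(2) \<eta> by (intro \<eta>(2)) auto
  moreover have "dist (\<gamma> t) (\<gamma> l) < \<epsilon>" using \<delta>(2)[of t] t by simp
  ultimately show False
    using dist_triangle3[of "\<gamma> l" "h 0" "\<gamma> t"] eq[OF t(1)] by (simp add: \<epsilon>_def)
qed

lemma reparam_ends:
  fixes h \<gamma> :: "real \<Rightarrow> 'a::metric_space" and \<phi> :: "real \<Rightarrow> real"
  assumes h: "continuous_on {0..1} h" and \<gamma>: "continuous_on {l..r} \<gamma>" and lr: "l < r"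
    and \<phi>: "\<phi> ` {l<..<r} = {0<..<1}" "strict_mono_on {l<..<r} \<phi>"
    and eq: "\<And>t. t \<in> {l<..<r} \<Longrightarrow> \<gamma> t = h (\<phi> t)"
  shows "\<gamma> l = h 0" "\<gamma> r = h 1"
proof -
  show "\<gamma> l = h 0" by (rule reparam_left_end[OF assms])
  have flip: "(\<lambda>t. l + r - t) ` {l<..<r} = {l<..<r}" "(\<lambda>t. 1 - t) ` {0<..<1::real} = {0<..<1}"
  proof -
    show "(\<lambda>t. l + r - t) ` {l<..<r} = {l<..<r}"
    proof (intro equalityI subsetI)
      fix y assume "y \<in> {l<..<r}"
      then show "y \<in> (\<lambda>t. l + r - t) ` {l<..<r}" by (intro image_eqI[of _ _ "l + r - y"]) auto
    qed auto
    show "(\<lambda>t. 1 - t) ` {0<..<1::real} = {0<..<1}"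
    proof (intro equalityI subsetI)
      fix y :: real assume "y \<in> {0<..<1}"
      then show "y \<in> (\<lambda>t. 1 - t) ` {0<..<1}" by (intro image_eqI[of _ _ "1 - y"]) auto
    qed auto
  qed
  have "(\<lambda>t. \<gamma> (l + r - t)) l = (\<lambda>s. h (1 - s)) 0"
  proof (rule reparam_left_end[where \<phi> = "\<lambda>t. 1 - \<phi> (l + r - t)" and l = l and r = r
        and h = "\<lambda>s. h (1 - s)" and \<gamma> = "\<lambda>t. \<gamma> (l + r - t)"])
    show "continuous_on {0..1} (\<lambda>s. h (1 - s))"
      by (rule continuous_on_compose2[OF h]) (auto intro!: continuous_intros)
    show "continuous_on {l..r} (\<lambda>t. \<gamma> (l + r - t))"
      by (rule continuous_on_compose2[OF \<gamma>]) (auto intro!: continuous_intros)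
    have "(\<lambda>t. 1 - \<phi> (l + r - t)) ` {l<..<r} = (\<lambda>t. 1 - t) ` \<phi> ` (\<lambda>t. l + r - t) ` {l<..<r}"
      by (simp only: image_image)
    then show "(\<lambda>t. 1 - \<phi> (l + r - t)) ` {l<..<r} = {0<..<1}" using flip \<phi>(1) by simp
    show "strict_mono_on {l<..<r} (\<lambda>t. 1 - \<phi> (l + r - t))"
      by (intro strict_mono_onI) (use strict_mono_onD[OF \<phi>(2)] in auto)
    show "\<gamma> (l + r - t) = h (1 - (1 - \<phi> (l + r - t)))" if "t \<in> {l<..<r}" for t
      using eq[of "l + r - t"] that by simp
  qed (rule lr)
  then show "\<gamma> r = h 1" by simp
qed

context simple_loop
begin

text \<open>The coordinate change between the loop on the times over \<open>e\<close> and the fixed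
  parametrisation is injective and continuous, hence monotone; increasing and decreasing give the
  two alternatives.\<close>

lemma edge_ends:
  assumes e: "e \<in> edges X"
  shows "\<gamma> (lo e) = p e 0 \<and> \<gamma> (hi e) = p e 1 \<or> \<gamma> (lo e) = p e 1 \<and> \<gamma> (hi e) = p e 0"
proof -
  note T = edge_times[OF e]
  have eE: "e \<subseteq> \<Union>(edges X)" using e by blast
  obtain k where k: "homeomorphism {lo e<..<hi e} e \<gamma> k"
    using times_homeomorphic(5)[OF edge_basics(1)[OF e] eE] T(4) by auto
  obtain q where q: "homeomorphism {0<..<1} e (p e) q" and pc: "continuous_on {0..1} (p e)"
    using p e by (auto simp: edge_param_def)
  define \<phi> where "\<phi> = q \<circ> \<gamma>"
  have ph: "homeomorphism {lo e<..<hi e} {0<..<1} \<phi> (k \<circ> p e)"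
    unfolding \<phi>_def by (rule homeomorphism_compose[OF k homeomorphism_symD[OF q]])
  have \<phi>im: "\<phi> ` {lo e<..<hi e} = {0<..<1}" by (rule homeomorphism_image1[OF ph])
  have \<gamma>c: "continuous_on {lo e..hi e} \<gamma>" by (rule continuous_on_subset[OF cont]) (use T in auto)
  have eq: "\<gamma> t = p e (\<phi> t)" if "t \<in> {lo e<..<hi e}" for t
  proof -
    have "\<gamma> t \<in> e" using homeomorphism_image1[OF k] that by blast
    then show ?thesis using homeomorphism_apply2[OF q] by (simp add: \<phi>_def)
  qed
  have "inj_on \<phi> {lo e<..<hi e}" using homeomorphism_apply1[OF ph] by (metis inj_on_inverseI)
  then consider "strict_mono_on {lo e<..<hi e} \<phi>" | "strict_antimono_on {lo e<..<hi e} \<phi>"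
    using injective_eq_monotone_map[OF _ homeomorphism_cont1[OF ph]] by (auto simp: is_interval_1)
  then show ?thesis
  proof cases
    case 1
    then show ?thesis using reparam_ends[OF pc \<gamma>c T(2) \<phi>im 1 eq] by simp
  next
    case 2
    have "\<gamma> (lo e) = (\<lambda>s. p e (1 - s)) 0 \<and> \<gamma> (hi e) = (\<lambda>s. p e (1 - s)) 1"
    proof (intro conjI reparam_ends[where \<phi> = "\<lambda>t. 1 - \<phi> t" and l = "lo e" and r = "hi e" and \<gamma> = \<gamma>
        and h = "\<lambda>s. p e (1 - s)"])
      show pr: "continuous_on {0..1} (\<lambda>s. p e (1 - s))"
        by (rule continuous_on_compose2[OF pc]) (auto intro!: continuous_intros)
      then show "continuous_on {0..1} (\<lambda>s. p e (1 - s))" .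
      have "(\<lambda>t. 1 - t) ` {0<..<1::real} = {0<..<1}"
      proof (intro equalityI subsetI)
        fix y :: real assume "y \<in> {0<..<1}"
        then show "y \<in> (\<lambda>t. 1 - t) ` {0<..<1}" by (intro image_eqI[of _ _ "1 - y"]) auto
      qed auto
      then show im: "(\<lambda>t. 1 - \<phi> t) ` {lo e<..<hi e} = {0<..<1}" using \<phi>im by (simp only: image_image[of "\<lambda>t. 1 - t" \<phi>, symmetric])
      then show "(\<lambda>t. 1 - \<phi> t) ` {lo e<..<hi e} = {0<..<1}" .
      show sm: "strict_mono_on {lo e<..<hi e} (\<lambda>t. 1 - \<phi> t)"
        using 2 by (auto simp: monotone_on_def)
      then show "strict_mono_on {lo e<..<hi e} (\<lambda>t. 1 - \<phi> t)" .
    qed (use \<gamma>c T(2) eq in auto)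
    then show ?thesis by simp
  qed
qed

end

lemma edgewise_eulerian_imp_simple_loop:
  fixes X :: "'a::metric_space set"
  assumes p: "edge_param X p" and g: "edgewise_eulerian X" and no: "\<not> X homeomorphic circle"
  shows "\<exists>\<gamma>. simple_loop X p \<gamma>"
proof -
  obtain g where g: "continuous_on circle g" "g ` circle = X" "\<And>x. x \<in> \<Union>(edges X) \<Longrightarrow> \<exists>!z. z \<in> circle \<and> g z = x"
  proof -
    obtain g0 where "edgewise_eulerian_map X g0" using g unfolding edgewise_eulerian_def by blast
    then show thesis using that[of g0] unfolding edgewise_eulerian_map_def by (elim conjE) blast
  qed
  have uniq: "z = w" if "z \<in> circle" "w \<in> circle" "g z = g w" "g z \<in> \<Union>(edges X)" for z w
    using ex1E[OF g(3)[OF that(4)], of "z = w"] that by metis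
  \<comment> \<open>If every point of the circle were mapped into an edge, \<open>g\<close> would be
    injective and hence a homeomorphism. This is where \<open>X\<close> must not be a
    circle.\<close>
  have "\<exists>z0\<in>circle. g z0 \<notin> \<Union>(edges X)"
  proof (rule ccontr)
    assume "\<not> ?thesis"
    then have "inj_on g circle" using uniq by (intro inj_onI) blast
    then have "\<exists>k. homeomorphism circle X g k" using homeomorphism_compact[OF compact_sphere g(1,2)] by blast
    then have "X homeomorphic circle" using homeomorphic_sym unfolding homeomorphic_def by blast
    then show False using no by simp
  qed
  then obtain z0 where z0: "z0 \<in> circle" "g z0 \<notin> \<Union>(edges X)" by blast
  define \<gamma> where "\<gamma> t = g (z0 * cis (2 * pi * t))" for t
  note L = circle_loop[OF g(1) z0(1), folded \<gamma>_def]
  have ends: "\<gamma> 0 = g z0" "\<gamma> 1 = g z0" by (simp_all add: \<gamma>_def)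
  have "simple_loop X p \<gamma>"
  proof
    show "continuous_on {0..1} \<gamma>" using L(1) by (simp add: \<gamma>_def[abs_def])
    show "\<gamma> ` {0..1} = X" using L(2) g(2) by (simp add: \<gamma>_def[abs_def])
    show "\<gamma> 0 = \<gamma> 1" "\<gamma> 0 \<notin> \<Union>(edges X)" using ends z0 by simp_all
    fix s t assume st: "s \<in> {0..1}" "t \<in> {0..1}" "\<gamma> s \<in> \<Union>(edges X)" "\<gamma> s = \<gamma> t"
    have "s \<noteq> 1" "t \<noteq> 1" using st(3,4) ends z0(2) by auto
    moreover have "z0 * cis (2 * pi * s) = z0 * cis (2 * pi * t)"
      using st(3,4) z0(1) unfolding \<gamma>_def by (intro uniq) (simp_all add: norm_mult)
    ultimately show "s = t" using st(1,2) by (intro circle_cis_inj[OF z0(1)]) auto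
  qed (rule p)
  then show ?thesis by blast
qed

context simple_loop
begin

section \<open>Cutting the loop at points and edges\<close>

definition isE :: "real \<Rightarrow> bool" where "isE t \<longleftrightarrow> \<gamma> t \<in> \<Union>(edges X)"
definition cedge :: "real \<Rightarrow> 'a set" where "cedge t = (THE e. e \<in> edges X \<and> \<gamma> t \<in> e)"
text \<open>A cut at a time over an edge removes the whole traversal of that edge; any other cut is
  the degenerate interval at \<open>t\<close>. Times over one edge therefore give one cut, as
  recorded by \<open>same\<close>.\<close>

definition cutL :: "real \<Rightarrow> real" where "cutL t = (if isE t then lo (cedge t) else t)"
definition cutR :: "real \<Rightarrow> real" where "cutR t = (if isE t then hi (cedge t) else t)"
definition same :: "real \<Rightarrow> real \<Rightarrow> bool" where "same s t \<longleftrightarrow> s = t \<or> isE s \<and> isE t \<and> cedge s = cedge t"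

lemma cedge_eq: "e \<in> edges X \<Longrightarrow> \<gamma> t \<in> e \<Longrightarrow> cedge t = e"
  unfolding cedge_def using edges_disjoint by (intro the_equality) blast+

lemma cedge: "isE t \<Longrightarrow> cedge t \<in> edges X" "isE t \<Longrightarrow> \<gamma> t \<in> cedge t"
  using cedge_eq by (auto simp: isE_def)

lemma not_isE_01: "\<not> isE 0" "\<not> isE 1"
  using base closed by (auto simp: isE_def)

text \<open>If an end of the time interval of \<open>e\<close> lay over an edge, the open time
  intervals of both edges would overlap and the edges would be equal, although the end is not a time
  over \<open>e\<close>.\<close>

lemma ground_ends:
  assumes e: "e \<in> edges X"
  shows "\<not> isE (lo e)" "\<not> isE (hi e)"
proof -
  note T = edge_times[OF e]
  have *: False if t: "t \<in> {lo e, hi e}" "isE t" for t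
  proof -
    have t01: "0 \<le> t" "t \<le> 1" using t(1) T by auto
    note c = cedge[OF t(2)]
    have ct: "lo (cedge t) < t" "t < hi (cedge t)" using mem_edge_times[OF c(1) t01] c(2) by auto
    have "max (lo e) (lo (cedge t)) < min (hi e) (hi (cedge t))" using T(2) ct t(1) by auto
    then obtain s where s: "max (lo e) (lo (cedge t)) < s" "s < min (hi e) (hi (cedge t))" using dense by blast
    then have "0 \<le> s" "s \<le> 1" using T by auto
    then have "\<gamma> s \<in> e" "\<gamma> s \<in> cedge t" using mem_edge_times[OF e] mem_edge_times[OF c(1)] s by auto
    then have "cedge t = e" using edges_disjoint[OF c(1) e] by blast
    then show False using ct t(1) by auto
  qed
  show "\<not> isE (lo e)" "\<not> isE (hi e)" using * by blast+
qed

lemma cut_bounds: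
  assumes "0 \<le> t" "t \<le> 1"
  shows "0 \<le> cutL t" "cutL t \<le> t" "t \<le> cutR t" "cutR t \<le> 1" "\<not> isE (cutL t)" "\<not> isE (cutR t)"
    and "isE t \<Longrightarrow> cutL t < t" "isE t \<Longrightarrow> t < cutR t"
    and "\<And>s. isE t \<Longrightarrow> 0 \<le> s \<Longrightarrow> s \<le> 1 \<Longrightarrow> \<gamma> s \<in> cedge t \<longleftrightarrow> cutL t < s \<and> s < cutR t"
proof -
  have E: "lo (cedge t) < t" "t < hi (cedge t)" if "isE t"
    using mem_edge_times[OF cedge(1)[OF that] assms] cedge(2)[OF that] by auto
  show "0 \<le> cutL t" "cutL t \<le> t" "t \<le> cutR t" "cutR t \<le> 1" "\<not> isE (cutL t)" "\<not> isE (cutR t)"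
    using E assms edge_times[OF cedge(1)] ground_ends[OF cedge(1)] by (auto simp: cutL_def cutR_def)
  show "isE t \<Longrightarrow> cutL t < t" "isE t \<Longrightarrow> t < cutR t" using E by (auto simp: cutL_def cutR_def)
  show "\<And>s. isE t \<Longrightarrow> 0 \<le> s \<Longrightarrow> s \<le> 1 \<Longrightarrow> \<gamma> s \<in> cedge t \<longleftrightarrow> cutL t < s \<and> s < cutR t"
    using mem_edge_times[OF cedge(1)] by (auto simp: cutL_def cutR_def)
qed

lemma same_cut: "same s t \<Longrightarrow> cutL s = cutL t \<and> cutR s = cutR t"
  by (auto simp: same_def cutL_def cutR_def)

lemma same_sym: "same s t \<Longrightarrow> same t s" by (auto simp: same_def)
lemma same_trans: "same s t \<Longrightarrow> same t u \<Longrightarrow> same s u" by (auto simp: same_def)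

text \<open>Traversals of distinct edges are disjoint time intervals, and a ground time lies in no
  traversal, so different cuts can at most touch.\<close>

lemma cut_order:
  assumes st: "0 \<le> s" "s < t" "t \<le> 1" and ns: "\<not> same s t"
  shows "cutR s \<le> cutL t"
proof (rule ccontr)
  assume lt: "\<not> ?thesis"
  have s1: "s \<le> 1" and t0: "0 \<le> t" using st by auto
  note S = cut_bounds[OF st(1) s1] and T = cut_bounds[OF t0 st(3)]
  have out: "\<not> (isE s \<and> cutL s < t \<and> t < cutR s)"
  proof
    assume A: "isE s \<and> cutL s < t \<and> t < cutR s"
    then have "\<gamma> t \<in> cedge s" using S(9)[OF _ t0 st(3)] by blast
    then have "isE t" "cedge t = cedge s" using cedge(1)[of s] cedge_eq A by (auto simp: isE_def)
    then show False using ns A by (auto simp: same_def)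
  qed
  have out': "\<not> (isE t \<and> cutL t < s \<and> s < cutR t)"
  proof
    assume A: "isE t \<and> cutL t < s \<and> s < cutR t"
    then have "\<gamma> s \<in> cedge t" using T(9)[OF _ st(1) s1] by blast
    then have "isE s" "cedge s = cedge t" using cedge(1)[of t] cedge_eq A by (auto simp: isE_def)
    then show False using ns A by (auto simp: same_def)
  qed
  show False
  proof (cases "isE s"; cases "isE t")
    assume E: "isE s" "isE t"
    have "max (cutL s) (cutL t) < min (cutR s) (cutR t)" using lt S T st E by auto
    then obtain u where u: "max (cutL s) (cutL t) < u" "u < min (cutR s) (cutR t)" using dense by blast
    then have u01: "0 \<le> u" "u \<le> 1" using S T by auto
    have "\<gamma> u \<in> cedge s" "\<gamma> u \<in> cedge t" using S(9)[OF E(1) u01] T(9)[OF E(2) u01] u by auto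
    then have "cedge s = cedge t" using edges_disjoint[OF cedge(1)[OF E(1)] cedge(1)[OF E(2)]] by blast
    then show False using ns E by (simp add: same_def)
  next
    assume E: "isE s" "\<not> isE t"
    then show False using out lt S(7) st by (auto simp: cutL_def)
  next
    assume E: "\<not> isE s" "isE t"
    then show False using out' lt T(8) st by (auto simp: cutR_def)
  next
    assume "\<not> isE s" "\<not> isE t"
    then show False using lt st by (auto simp: cutL_def cutR_def)
  qed
qed

lemma cut_interval_image:
  assumes t: "0 \<le> t" "t \<le> 1" "isE t"
  shows "\<gamma> ` {cutL t<..<cutR t} = cedge t"
proof -
  note e = cedge(1)[OF t(3)]
  have "{cutL t<..<cutR t} = times (cedge t)" unfolding edge_times(4)[OF e] using t(3) by (simp add: cutL_def cutR_def)
  moreover have "\<gamma> ` times (cedge t) = cedge t"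
    using times_homeomorphic(4)[OF edge_basics(1)[OF e]] e by blast
  ultimately show ?thesis by simp
qed

end

lemma peano_continuum_image_Icc:
  fixes f :: "real \<Rightarrow> 'a::metric_space"
  assumes "continuous_on {a..b} f"
  shows "peano_continuum (f ` {a..b})"
  using assms unfolding peano_continuum_def
  by (auto intro!: compact_continuous_image connected_continuous_image continuous_image_locally_connected
      convex_imp_locally_connected)

section \<open>The cyclic decomposition given by finitely many cuts\<close>

locale cut_loop = simple_loop +
  fixes q :: "nat \<Rightarrow> real"
  assumes q0: "q 0 = 0" and q01: "\<And>i. 0 \<le> q i" "\<And>i. q i < 1"
begin

definition goodC :: "nat set \<Rightarrow> bool" where
  "goodC C \<longleftrightarrow> finite C \<and> 0 \<in> C \<and> (\<forall>i\<in>C. \<forall>j\<in>C. i \<noteq> j \<longrightarrow> \<not> same (q i) (q j))"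

text \<open>The loop being closed, the cut \<open>0\<close> is also the last one: position \<open>2\<close> lies after all others.\<close>
definition lim :: "nat \<Rightarrow> real" where "lim i = (if i = 0 then 2 else q i)"
text \<open>The time at which the stretch before cut \<open>i\<close> ends; for the cut 0 this is
  the end of the loop.\<close>

definition lam :: "nat \<Rightarrow> real" where "lam i = (if i = 0 then 1 else cutL (q i))"
text \<open>The cyclic predecessor of a cut; for the cut 0 it is the last cut of all, by the choice
  of \<open>lim\<close>.\<close>

definition prv :: "nat set \<Rightarrow> nat \<Rightarrow> nat" where
  "prv C i = (THE k. k \<in> C \<and> q k < lim i \<and> (\<forall>j\<in>C. q j < lim i \<longrightarrow> q j \<le> q k))"
definition nx :: "nat set \<Rightarrow> nat \<Rightarrow> nat" where
  "nx C v = (THE i. i \<in> C \<and> prv C i = v)"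
definition piece :: "nat set \<Rightarrow> nat \<Rightarrow> 'a set" where
  "piece C v = \<gamma> ` {cutR (q v)..lam (nx C v)}"
text \<open>Marks the cut edges whose end values under \<open>p\<close> appear in the opposite order
  on the loop. The ends of the graph edge are then exchanged, so that the values of \<open>p\<close>
  at 0 and 1 lie in the pieces of the first and second end, as (E6) demands.\<close>

definition flip :: "nat \<Rightarrow> bool" where
  "flip i \<longleftrightarrow> isE (q i) \<and> \<not> (\<gamma> (cutL (q i)) = p (cedge (q i)) 0 \<and> \<gamma> (cutR (q i)) = p (cedge (q i)) 1)"

text \<open>The label \<open>i\<close> names both the cut at \<open>q i\<close>, an edge of the cycle, and the stretch of the loop
  from this cut to the next one, a vertex.\<close>
definition Dec :: "nat set \<Rightarrow> 'a decomp" where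
  "Dec C = \<lparr>dV = C, dE = C, dF = {i \<in> C. isE (q i)},
     dends = (\<lambda>i. if flip i then (i, prv C i) else (prv C i, i)), dvert = piece C,
     dfree = (\<lambda>i. cedge (q i)), darc = (\<lambda>i. {\<gamma> (q i)}), darc0 = (\<lambda>i. \<gamma> (q i)), darc1 = (\<lambda>i. \<gamma> (q i))\<rparr>"

lemma Dec_simps [simp]:
  "dV (Dec C) = C" "dE (Dec C) = C" "dF (Dec C) = {i \<in> C. isE (q i)}"
  "dends (Dec C) = (\<lambda>i. if flip i then (i, prv C i) else (prv C i, i))" "dvert (Dec C) = piece C"
  "dfree (Dec C) = (\<lambda>i. cedge (q i))" "darc (Dec C) = (\<lambda>i. {\<gamma> (q i)})"
  "darc0 (Dec C) = (\<lambda>i. \<gamma> (q i))" "darc1 (Dec C) = (\<lambda>i. \<gamma> (q i))"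
  by (simp_all add: Dec_def)

lemma qb: "0 \<le> q i" "q i \<le> 1" using q01[of i] by auto

lemmas cb = cut_bounds[OF qb]

lemma goodD:
  assumes "goodC C"
  shows "finite C" "0 \<in> C" "\<And>i j. i \<in> C \<Longrightarrow> j \<in> C \<Longrightarrow> i \<noteq> j \<Longrightarrow> \<not> same (q i) (q j)"
    "\<And>i j. i \<in> C \<Longrightarrow> j \<in> C \<Longrightarrow> q i = q j \<Longrightarrow> i = j"
    "\<And>i. i \<in> C \<Longrightarrow> i \<noteq> 0 \<Longrightarrow> 0 < q i"
proof -
  show f: "finite C" "0 \<in> C" "\<And>i j. i \<in> C \<Longrightarrow> j \<in> C \<Longrightarrow> i \<noteq> j \<Longrightarrow> \<not> same (q i) (q j)"
    using assms by (auto simp: goodC_def)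
  show inj: "i = j" if "i \<in> C" "j \<in> C" "q i = q j" for i j using f(3)[OF that(1,2)] that(3) by (auto simp: same_def)
  show "0 < q i" if "i \<in> C" "i \<noteq> 0" for i using inj[OF that(1) f(2)] that(2) qb(1)[of i] q0 by fastforce
qed

lemma prv_unique:
  assumes C: "goodC C" and k: "k \<in> C" "q k < lim i" "\<And>j. j \<in> C \<Longrightarrow> q j < lim i \<Longrightarrow> q j \<le> q k"
  shows "prv C i = k"
  unfolding prv_def
proof (rule the_equality)
  show "k \<in> C \<and> q k < lim i \<and> (\<forall>j\<in>C. q j < lim i \<longrightarrow> q j \<le> q k)" using k by blast
  fix l assume "l \<in> C \<and> q l < lim i \<and> (\<forall>j\<in>C. q j < lim i \<longrightarrow> q j \<le> q l)"
  then show "l = k" using k goodD(4)[OF C, of l k] by (meson order_antisym)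
qed

lemma prv:
  assumes C: "goodC C" and i: "i \<in> C"
  shows "prv C i \<in> C" "q (prv C i) < lim i" "\<And>j. j \<in> C \<Longrightarrow> q j < lim i \<Longrightarrow> q j \<le> q (prv C i)"
proof -
  define A where "A = {j \<in> C. q j < lim i}"
  have "0 \<in> A" using goodD(2)[OF C] goodD(5)[OF C i] q0 by (auto simp: A_def lim_def)
  moreover have fin: "finite A" using goodD(1)[OF C] by (simp add: A_def)
  ultimately have "Max (q ` A) \<in> q ` A" by (intro Max_in) auto
  then obtain k where k: "k \<in> A" "q k = Max (q ` A)" by auto
  have mx: "q j \<le> q k" if "j \<in> C" "q j < lim i" for j
    unfolding k(2) using that fin by (intro Max_ge) (auto simp: A_def)
  have "prv C i = k" using k(1) mx by (intro prv_unique[OF C]) (auto simp: A_def)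
  then show "prv C i \<in> C" "q (prv C i) < lim i" "\<And>j. j \<in> C \<Longrightarrow> q j < lim i \<Longrightarrow> q j \<le> q (prv C i)"
    using k(1) mx by (auto simp: A_def)
qed

text \<open>Two cuts cannot share a predecessor, since the earlier one would be a later candidate
  for the predecessor of the other; and an injective self-map of a finite set is bijective.\<close>

lemma prv_bij:
  assumes C: "goodC C"
  shows "bij_betw (prv C) C C"
proof -
  have less: False if "i \<in> C" "j \<in> C" "prv C i = prv C j" "lim i < lim j" for i j
  proof -
    have "i \<noteq> 0" using that(4) q01(2)[of j] by (auto simp: lim_def split: if_splits)
    then have "q i = lim i" by (simp add: lim_def)
    then have "q i \<le> q (prv C j)" using prv(3)[OF C that(2,1)] that(4) by simp
    then show False using prv(2)[OF C that(1)] that(3) \<open>q i = lim i\<close> by simp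
  qed
  have "inj_on (prv C) C"
  proof (rule inj_onI)
    fix i j assume ij: "i \<in> C" "j \<in> C" "prv C i = prv C j"
    then have "lim i = lim j" using less[of i j] less[of j i] by (metis linorder_less_linear)
    then show "i = j" using goodD(4)[OF C ij(1,2)] q01(2)[of i] q01(2)[of j] by (auto simp: lim_def split: if_splits)
  qed
  moreover have "prv C ` C \<subseteq> C" using prv(1)[OF C] by blast
  ultimately show ?thesis
    using endo_inj_surj[OF goodD(1)[OF C]] unfolding bij_betw_def by blast
qed

lemma nx_prv:
  assumes C: "goodC C" and i: "i \<in> C"
  shows "nx C (prv C i) = i"
  unfolding nx_def using prv_bij[OF C] i by (intro the_equality) (auto simp: bij_betw_def dest: inj_onD)

lemma nx:
  assumes C: "goodC C" and v: "v \<in> C"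
  shows "nx C v \<in> C" "prv C (nx C v) = v"
proof -
  obtain i where "i \<in> C" "prv C i = v" using prv_bij[OF C] v by (metis bij_betw_imp_surj_on imageE)
  then show "nx C v \<in> C" "prv C (nx C v) = v" using nx_prv[OF C] by auto
qed

lemma lam_bounds: "0 \<le> lam i" "lam i \<le> 1" "\<gamma> (lam i) = \<gamma> (cutL (q i))" "\<not> isE (lam i)"
proof -
  have "cutL 0 = 0" using not_isE_01 by (simp add: cutL_def)
  then show "\<gamma> (lam i) = \<gamma> (cutL (q i))" using closed q0 by (simp add: lam_def)
  show "0 \<le> lam i" "lam i \<le> 1" "\<not> isE (lam i)"
    using cb(1,2,5)[of i] qb(2)[of i] not_isE_01 by (auto simp: lam_def)
qed

lemma lam_mono:
  assumes C: "goodC C" and ij: "i \<in> C" "j \<in> C" "lim i \<le> lim j"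
  shows "lam i \<le> lam j"
proof (cases "i = j \<or> j = 0")
  case True
  then show ?thesis using lam_bounds(2)[of i] by (auto simp: lam_def)
next
  case False
  then have "i \<noteq> 0" using ij(3) q01(2)[of j] by (auto simp: lim_def split: if_splits)
  moreover have "q i \<noteq> q j" using goodD(4)[OF C ij(1,2)] False by blast
  ultimately have "q i < q j" using ij(3) False by (simp add: lim_def)
  then have "cutR (q i) \<le> cutL (q j)" using cut_order qb goodD(3)[OF C ij(1,2)] False by blast
  then show ?thesis using cb(2,3)[of i] False \<open>i \<noteq> 0\<close> unfolding lam_def by simp
qed

lemma cutR_lam:
  assumes C: "goodC C" and ij: "i \<in> C" "j \<in> C" "q i < lim j"
  shows "cutR (q i) \<le> lam j"
proof (cases "j = 0")
  case True
  then show ?thesis using cb(4) by (simp add: lam_def)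
next
  case False
  then have "q i < q j" using ij by (simp add: lim_def)
  then show ?thesis using cut_order[of "q i" "q j"] qb goodD(3)[OF C ij(1,2)] False by (force simp: lam_def)
qed

lemma gap_nonempty:
  assumes C: "goodC C" and v: "v \<in> C"
  shows "cutR (q v) \<le> lam (nx C v)" "q v < lim (nx C v)"
  using cutR_lam[OF C v nx(1)[OF C v]] prv(2)[OF C nx(1)[OF C v]] nx(2)[OF C v] by auto

lemma gap_later:
  assumes C: "goodC C" and v: "v \<in> C" and j: "j \<in> C" "q v < lim j"
  shows "lim (nx C v) \<le> lim j" "lam (nx C v) \<le> lam j"
proof -
  note N = nx[OF C v]
  show *: "lim (nx C v) \<le> lim j"
  proof (rule ccontr)
    assume lt: "\<not> ?thesis"
    then have "j \<noteq> 0" using q01(2)[of "nx C v"] by (auto simp: lim_def split: if_splits)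
    then have "q j = lim j" by (simp add: lim_def)
    then have "q j \<le> q v" using prv(3)[OF C N(1) j(1)] lt N(2) by simp
    then show False using j(2) \<open>q j = lim j\<close> by simp
  qed
  show "lam (nx C v) \<le> lam j" by (rule lam_mono[OF C N(1) j(1) *])
qed

text \<open>Both ends of a stretch are ground times, so the time interval of an edge cannot extend
  across them. This makes the pieces standard.\<close>

lemma piece_times:
  assumes C: "goodC C" and v: "v \<in> C" and e: "e \<in> edges X" and t: "cutR (q v) \<le> t" "t \<le> lam (nx C v)" "\<gamma> t \<in> e"
  shows "times e \<subseteq> {cutR (q v)..lam (nx C v)}"
proof -
  have b: "0 \<le> cutR (q v)" "cutR (q v) \<le> 1" using cb(3,4)[of v] qb(1)[of v] by auto
  have t01: "0 \<le> t" "t \<le> 1" using t b lam_bounds(2)[of "nx C v"] by auto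
  have te: "lo e < t" "t < hi e" using mem_edge_times[OF e t01] t(3) by auto
  have "\<gamma> (cutR (q v)) \<notin> e" using cb(6)[of v] e by (auto simp: isE_def)
  then have 1: "cutR (q v) \<le> lo e" using mem_edge_times[OF e b] te t by auto
  have "\<gamma> (lam (nx C v)) \<notin> e" using lam_bounds(4) e by (auto simp: isE_def)
  then have 2: "hi e \<le> lam (nx C v)" using mem_edge_times[OF e lam_bounds(1,2)[of "nx C v"]] te t by auto
  show ?thesis unfolding edge_times(4)[OF e] using 1 2 by auto
qed

text \<open>Edge points are visited at a single time, so membership in a piece can be tested at that
  time.\<close>

lemma piece_edge_time:
  assumes C: "goodC C" and v: "v \<in> C" and x: "x \<in> piece C v" "x \<in> e" "e \<in> edges X" and t: "0 \<le> t" "t \<le> 1" "\<gamma> t = x"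
  shows "cutR (q v) \<le> t" "t \<le> lam (nx C v)"
proof -
  obtain s where s: "cutR (q v) \<le> s" "s \<le> lam (nx C v)" "x = \<gamma> s" using x(1) by (auto simp: piece_def)
  have "0 \<le> s" "s \<le> 1" using s cb(3)[of v] qb(1)[of v] lam_bounds(2)[of "nx C v"] by auto
  moreover have "\<gamma> s \<in> \<Union>(edges X)" unfolding s(3)[symmetric] using x(2,3) by (rule UnionI[rotated])
  moreover have "\<gamma> s = \<gamma> t" using s(3) t(3) by simp
  ultimately have "s = t" using t(1,2) by (intro simple) simp_all
  then show "cutR (q v) \<le> t" "t \<le> lam (nx C v)" using s(1,2) by simp_all
qed

lemma piece_subset: "goodC C \<Longrightarrow> v \<in> C \<Longrightarrow> {cutR (q v)..lam (nx C v)} \<subseteq> {0..1}"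
  using cb(3)[of v] qb(1)[of v] lam_bounds(2)[of "nx C v"] by auto

lemma is_decomp_Dec:
  assumes C: "goodC C"
  shows "is_decomp X p (Dec C)"
proof -
  note G = goodD[OF C]
  have ends: "fst (dends (Dec C) x) \<in> C \<and> snd (dends (Dec C) x) \<in> C" if "x \<in> C" for x
    using prv(1)[OF C that] that by simp
  have E1: "piece C v \<noteq> {} \<and> piece C v \<subseteq> X \<and> peano_continuum (piece C v) \<and> standard X (piece C v)" if v: "v \<in> C" for v
  proof (intro conjI)
    show "piece C v \<noteq> {}" using gap_nonempty(1)[OF C v] by (simp add: piece_def)
    show "piece C v \<subseteq> X" using piece_subset[OF C v] im unfolding piece_def by blast
    show "peano_continuum (piece C v)"
      unfolding piece_def by (intro peano_continuum_image_Icc continuous_on_subset[OF cont] piece_subset[OF C v])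
    show "standard X (piece C v)"
      unfolding standard_def
    proof (intro ballI impI)
      fix e assume e: "e \<in> edges X" "e \<inter> piece C v \<noteq> {}"
      then obtain t where t: "cutR (q v) \<le> t" "t \<le> lam (nx C v)" "\<gamma> t \<in> e" by (auto simp: piece_def)
      have "\<gamma> ` times e = e" using times_homeomorphic(4)[OF edge_basics(1)[OF e(1)]] e(1) by blast
      then show "e \<subseteq> piece C v" using piece_times[OF C v e(1) t] unfolding piece_def by blast
    qed
  qed
  \<comment> \<open>Let \<open>v\<close> be the latest cut not after \<open>t\<close>. Then
    \<open>t\<close> lies in the right part of the edge cut at \<open>v\<close>, in the stretch
    after \<open>v\<close>, or in the left part of the edge at the next cut.\<close>
  have E4: "X \<subseteq> (\<Union>v\<in>C. piece C v) \<union> (\<Union>f\<in>{i \<in> C. isE (q i)}. cedge (q f))"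
  proof
    fix x assume "x \<in> X"
    then obtain t where t: "0 \<le> t" "t \<le> 1" "x = \<gamma> t" using im by (metis atLeastAtMost_iff imageE)
    define A where "A = {j \<in> C. q j \<le> t}"
    have "0 \<in> A" "finite A" using G(1,2) q0 t by (auto simp: A_def)
    then have "Max (q ` A) \<in> q ` A" by (intro Max_in) auto
    then obtain v where v: "v \<in> A" "q v = Max (q ` A)" by auto
    have mx: "q j \<le> q v" if "j \<in> C" "q j \<le> t" for j
      unfolding v(2) using that \<open>finite A\<close> by (intro Max_ge) (auto simp: A_def)
    have vC: "v \<in> C" "q v \<le> t" using v(1) by (auto simp: A_def)
    show "x \<in> (\<Union>v\<in>C. piece C v) \<union> (\<Union>f\<in>{i \<in> C. isE (q i)}. cedge (q f))"
    proof (cases "t < cutR (q v)")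
      case True
      then have iE: "isE (q v)" using vC by (auto simp: cutR_def split: if_splits)
      then have "\<gamma> t \<in> cedge (q v)" using cb(9)[OF iE t(1,2)] True vC(2) cb(7)[OF iE] by simp
      then show ?thesis using iE vC t(3) by blast
    next
      case ge: False
      show ?thesis
      proof (cases "t \<le> lam (nx C v)")
        case True
        then have "x \<in> piece C v" using ge t(3) by (simp add: piece_def)
        then show ?thesis using vC by blast
      next
        case False
        define i where "i = nx C v"
        have i: "i \<in> C" "i \<noteq> 0" "cutL (q i) < t" using False t(2) nx(1)[OF C vC(1)] by (auto simp: lam_def i_def split: if_splits)
        have "q v < q i" using gap_nonempty(2)[OF C vC(1)] i(2) by (simp add: lim_def i_def)
        then have ti: "t < q i" using mx[OF i(1)] by force
        then have iE: "isE (q i)" using i(3) by (auto simp: cutL_def split: if_splits)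
        then have "\<gamma> t \<in> cedge (q i)" using cb(9)[OF iE t(1,2)] i(3) ti cb(3)[of i] by simp
        then show ?thesis using iE i(1) t(3) by blast
      qed
    qed
  qed
  have E5a: "\<not> (e \<subseteq> piece C v \<and> e \<subseteq> piece C w)" if e: "e \<in> edges X" and vw: "v \<in> C" "w \<in> C" "v \<noteq> w" for e v w
  proof
    assume sub: "e \<subseteq> piece C v \<and> e \<subseteq> piece C w"
    obtain x where x: "x \<in> e" using edge_basics(5)[OF e] by blast
    then have "x \<in> X" using edge_basics(2)[OF e] by blast
    then obtain t where t: "0 \<le> t" "t \<le> 1" "\<gamma> t = x" using im by (metis atLeastAtMost_iff imageE)
    \<comment> \<open>The time of an edge point common to both pieces is squeezed to
      \<open>cutR (q b)\<close>, which is a ground time.\<close>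
    have *: False if "a \<in> C" "b \<in> C" "q a < q b" "e \<subseteq> piece C a" "e \<subseteq> piece C b" for a b
    proof -
      have 1: "cutR (q b) \<le> t" using piece_edge_time(1)[OF C that(2) _ x e t] that(5) x by blast
      have 2: "t \<le> lam (nx C a)" using piece_edge_time(2)[OF C that(1) _ x e t] that(4) x by blast
      have "b \<noteq> 0" using that(3) q0 qb(1)[of a] by (metis not_le)
      then have "lam (nx C a) \<le> cutL (q b)" using gap_later(2)[OF C that(1,2)] that(3) by (simp add: lim_def lam_def)
      then have "t = cutR (q b)" using 1 2 cb(2,3)[of b] by linarith
      then show False using cb(6)[of b] t(3) x e by (auto simp: isE_def)
    qed
    have "q v \<noteq> q w" using G(4) vw by blast
    then show False using *[of v w] *[of w v] vw sub by linarith
  qed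
  have E5b: "\<not> (e \<subseteq> cedge (q f) \<and> e \<subseteq> cedge (q g))" if e: "e \<in> edges X" and fg: "f \<in> C" "isE (q f)" "g \<in> C" "isE (q g)" "f \<noteq> g" for e f g
  proof
    assume sub: "e \<subseteq> cedge (q f) \<and> e \<subseteq> cedge (q g)"
    obtain x where x: "x \<in> e" using edge_basics(5)[OF e] by blast
    then have "cedge (q f) = cedge (q g)" using edges_disjoint[OF cedge(1)[OF fg(2)] cedge(1)[OF fg(4)], of x] sub by blast
    then show False using G(3)[OF fg(1,3,5)] fg by (simp add: same_def)
  qed
  have E5c: "\<not> (e \<subseteq> piece C v \<and> e \<subseteq> cedge (q f))" if e: "e \<in> edges X" and v: "v \<in> C" and f: "f \<in> C" "isE (q f)" for e v f
  proof
    assume sub: "e \<subseteq> piece C v \<and> e \<subseteq> cedge (q f)"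
    obtain x where x: "x \<in> e" using edge_basics(5)[OF e] by blast
    then have "e = cedge (q f)" using edges_disjoint[OF e cedge(1)[OF f(2)], of x] sub by blast
    then have y: "\<gamma> (q f) \<in> e" "\<gamma> (q f) \<in> piece C v" using cedge(2)[OF f(2)] sub by auto
    have T: "cutR (q v) \<le> q f" "q f \<le> lam (nx C v)" using piece_edge_time[OF C v y(2,1) e qb] by simp_all
    consider "q f < q v" | "f = v" | "q v < q f" using G(4)[OF f(1) v] by linarith
    then show False
    proof cases
      case 1
      then show False using T(1) cb(3)[of v] by simp
    next
      case 2
      then show False using T(1) cb(8)[OF f(2)] by simp
    next
      case 3
      then have "f \<noteq> 0" using q0 qb(1)[of v] by (metis not_le)
      then have "lam (nx C v) \<le> cutL (q f)" using gap_later(2)[OF C v f(1)] 3 by (simp add: lim_def lam_def)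
      then show False using T(2) cb(7)[OF f(2)] by simp
    qed
  qed
  have Lp: "\<gamma> (cutL (q i)) \<in> piece C (prv C i)" if i: "i \<in> C" for i
  proof -
    have "\<gamma> (lam i) \<in> piece C (prv C i)"
      using gap_nonempty(1)[OF C prv(1)[OF C i]] nx_prv[OF C i] by (auto simp: piece_def)
    then show ?thesis by (simp add: lam_bounds(3))
  qed
  have Rp: "\<gamma> (cutR (q i)) \<in> piece C i" if i: "i \<in> C" for i
    using gap_nonempty(1)[OF C i] by (auto simp: piece_def)
  have E6: "p (cedge (q f)) 0 \<in> piece C (fst (dends (Dec C) f)) \<and> p (cedge (q f)) 1 \<in> piece C (snd (dends (Dec C) f))"
    if f: "f \<in> C" "isE (q f)" for f
  proof -
    have L: "cutL (q f) = lo (cedge (q f))" "cutR (q f) = hi (cedge (q f))" using f(2) by (simp_all add: cutL_def cutR_def)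
    show ?thesis
      using edge_ends[OF cedge(1)[OF f(2)], folded L] Lp[OF f(1)] Rp[OF f(1)] f(2) by (auto simp: flip_def)
  qed
  have E7: "\<gamma> (q d) \<in> piece C (fst (dends (Dec C) d)) \<and> \<gamma> (q d) \<in> piece C (snd (dends (Dec C) d))"
    if d: "d \<in> C" "\<not> isE (q d)" for d
    using Lp[OF d(1)] Rp[OF d(1)] d(2) by (simp add: cutL_def cutR_def)
  show ?thesis
    unfolding is_decomp_def
  proof (intro conjI ballI impI)
    fix d assume d: "d \<in> dE (Dec C) - dF (Dec C)"
    show "darc (Dec C) d \<subseteq> ground X"
      using d im qb[of d] by (auto simp: ground_def isE_def)
    show "arc_or_point (darc (Dec C) d) (darc0 (Dec C) d) (darc1 (Dec C) d)"
      by (simp add: arc_or_point_def)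
    show "darc0 (Dec C) d \<in> dvert (Dec C) (fst (dends (Dec C) d))" "darc1 (Dec C) d \<in> dvert (Dec C) (snd (dends (Dec C) d))"
      using E7[of d] d by auto
  next
    fix f assume f: "f \<in> dF (Dec C)"
    show "dfree (Dec C) f \<in> edges X" using cedge(1) f by simp
    show "p (dfree (Dec C) f) 0 \<in> dvert (Dec C) (fst (dends (Dec C) f))" "p (dfree (Dec C) f) 1 \<in> dvert (Dec C) (snd (dends (Dec C) f))"
      using E6[of f] f by auto
  next
    show "finite (dV (Dec C))" "finite (dE (Dec C))" "dF (Dec C) \<subseteq> dE (Dec C)" using G(1) by auto
    show "fst (dends (Dec C) x) \<in> dV (Dec C)" "snd (dends (Dec C) x) \<in> dV (Dec C)" if "x \<in> dE (Dec C)" for x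
      using ends[of x] that unfolding Dec_simps(1,2) by blast+
    show "dvert (Dec C) v \<noteq> {}" "dvert (Dec C) v \<subseteq> X" "peano_continuum (dvert (Dec C) v)"
      "standard X (dvert (Dec C) v)" if "v \<in> dV (Dec C)" for v
      using E1[of v] that unfolding Dec_simps(1,5) by blast+
    show "X \<subseteq> (\<Union>v\<in>dV (Dec C). dvert (Dec C) v) \<union> (\<Union>f\<in>dF (Dec C). dfree (Dec C) f)"
      unfolding Dec_simps(1,3,5,6) by (rule E4)
  next
    fix e v w assume "e \<in> edges X" "v \<in> dV (Dec C)" "w \<in> dV (Dec C)" "v \<noteq> w"
    then show "\<not> (e \<subseteq> dvert (Dec C) v \<and> e \<subseteq> dvert (Dec C) w)" unfolding Dec_simps(1,5) by (rule E5a)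
  next
    fix e f g assume A: "e \<in> edges X" "f \<in> dF (Dec C)" "g \<in> dF (Dec C)" "f \<noteq> g"
    then show "\<not> (e \<subseteq> dfree (Dec C) f \<and> e \<subseteq> dfree (Dec C) g)" using E5b[OF A(1), of f g] unfolding Dec_simps(3,6) by blast
  next
    fix e v f assume A: "e \<in> edges X" "v \<in> dV (Dec C)" "f \<in> dF (Dec C)"
    then show "\<not> (e \<subseteq> dvert (Dec C) v \<and> e \<subseteq> dfree (Dec C) f)" using E5c[OF A(1), of v f] unfolding Dec_simps(1,3,5,6) by blast
  qed
qed

text \<open>Each vertex \<open>v\<close> is an end of the edge \<open>v\<close> and of the edge
  \<open>nx C v\<close>, and of no others, since \<open>prv\<close> is a bijection;
  \<open>flip\<close> only exchanges ends. Connectedness follows by stepping back along predecessors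
  to the cut 0.\<close>

lemma Dec_eulerian:
  assumes C: "goodC C"
  shows "eulerian_decomp X p (Dec C)"
proof -
  note G = goodD[OF C]
  have deg: "degree (Dec C) v = 2" if v: "v \<in> C" for v
  proof -
    have card_sum: "card {x \<in> C. P x} = (\<Sum>x\<in>C. of_bool (P x))" for P
      using G(1) by (simp add: Int_def)
    have "degree (Dec C) v = (\<Sum>x\<in>C. of_bool (fst (dends (Dec C) x) = v) + of_bool (snd (dends (Dec C) x) = v))"
      unfolding degree_def card_sum sum.distrib Dec_simps(2) ..
    also have "\<dots> = (\<Sum>x\<in>C. of_bool (prv C x = v) + of_bool (x = v))"
      by (intro sum.cong) auto
    also have "\<dots> = card {x \<in> C. prv C x = v} + card {x \<in> C. x = v}"
      unfolding card_sum sum.distrib ..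
    also have "{x \<in> C. prv C x = v} = {nx C v}"
      using nx[OF C v] nx_prv[OF C] by auto
    also have "{x \<in> C. x = v} = {v}" using v by auto
    finally show ?thesis by simp
  qed
  have reach: "(0, v) \<in> (adj (Dec C))\<^sup>* \<and> (v, 0) \<in> (adj (Dec C))\<^sup>*" if "v \<in> C" for v
    using that
  proof (induction "card {j \<in> C. q j < q v}" arbitrary: v rule: less_induct)
    case less
    show ?case
    proof (cases "v = 0")
      case False
      note P = prv[OF C less.prems]
      have lt: "q (prv C v) < q v" using P(2) False by (simp add: lim_def)
      have "{j \<in> C. q j < q (prv C v)} \<subset> {j \<in> C. q j < q v}" using lt P(1) by auto
      then have "card {j \<in> C. q j < q (prv C v)} < card {j \<in> C. q j < q v}"
        using G(1) by (intro psubset_card_mono) auto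
      from less.hyps[OF this P(1)] have IH: "(0, prv C v) \<in> (adj (Dec C))\<^sup>*" "(prv C v, 0) \<in> (adj (Dec C))\<^sup>*" by auto
      have "(prv C v, v) \<in> adj (Dec C)" "(v, prv C v) \<in> adj (Dec C)"
        using less.prems by (auto simp: adj_def intro!: bexI[of _ v])
      then show ?thesis using IH by (meson rtrancl.rtrancl_into_rtrancl converse_rtrancl_into_rtrancl)
    qed simp
  qed
  have "graph_connected (Dec C)"
    unfolding graph_connected_def
  proof (intro conjI ballI)
    show "dV (Dec C) \<noteq> {}" using G(2) by auto
    show "(u, w) \<in> (adj (Dec C))\<^sup>*" if "u \<in> dV (Dec C)" "w \<in> dV (Dec C)" for u w
      using reach[of u] reach[of w] that by (auto intro: rtrancl_trans)
  qed
  then show ?thesis using is_decomp_Dec[OF C] deg by (simp add: eulerian_decomp_def)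
qed

end

lemma decomp_iso_refl: "decomp_iso D D"
  unfolding decomp_iso_def by (intro exI[of _ id]) (auto simp: prod.map_id)

context cut_loop
begin

section \<open>Refinement by one more cut\<close>

text \<open>No cut lies between \<open>m\<close> and its predecessor, so the cut after
  \<open>m\<close> falls back to that predecessor when \<open>m\<close> is left out.\<close>

lemma prv_insert:
  assumes C: "goodC C" and C': "goodC (insert m C)" and m: "m \<notin> C" and z: "z \<in> C"
  shows "prv C z = (if prv (insert m C) z = m then prv (insert m C) m else prv (insert m C) z)"
proof -
  have zC': "z \<in> insert m C" and mC': "m \<in> insert m C" using z by auto
  note Z = prv[OF C' zC'] and M = prv[OF C' mC']
  have m0: "m \<noteq> 0" using m goodD(2)[OF C] by metis
  then have lm: "lim m = q m" by (simp add: lim_def)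
  have xm: "prv (insert m C) m \<in> C" "q (prv (insert m C) m) < q m" using M(1,2) lm by auto
  show ?thesis
  proof (cases "prv (insert m C) z = m")
    case True
    have "prv C z = prv (insert m C) m"
    proof (rule prv_unique[OF C xm(1)])
      show "q (prv (insert m C) m) < lim z" using xm(2) Z(2) True by simp
      fix j assume j: "j \<in> C" "q j < lim z"
      then have "q j \<le> q m" using Z(3)[of j] True by simp
      moreover have "q j \<noteq> q m" using goodD(4)[OF C', of j m] j(1) m by auto
      ultimately show "q j \<le> q (prv (insert m C) m)" using M(3)[of j] j(1) lm by simp
    qed
    then show ?thesis using True by simp
  next
    case False
    then have "prv (insert m C) z \<in> C" using Z(1) by simp
    then have "prv C z = prv (insert m C) z" using Z(2,3) by (intro prv_unique[OF C]) auto
    then show ?thesis using False by simp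
  qed
qed

lemma nx_insert:
  assumes C: "goodC C" and C': "goodC (insert m C)" and m: "m \<notin> C"
  shows "v \<in> C \<Longrightarrow> v \<noteq> prv (insert m C) m \<Longrightarrow> nx C v = nx (insert m C) v"
    and "nx C (prv (insert m C) m) = nx (insert m C) m"
    and "nx (insert m C) (prv (insert m C) m) = m"
proof -
  show B: "nx (insert m C) (prv (insert m C) m) = m" using nx_prv[OF C'] by simp
  have xne: "prv (insert m C) m \<noteq> m"
  proof -
    have "m \<noteq> 0" using m goodD(2)[OF C] by metis
    then have "q (prv (insert m C) m) < q m" using prv(2)[OF C', of m] by (simp add: lim_def)
    then show ?thesis by auto
  qed
  show "nx C v = nx (insert m C) v" if v: "v \<in> C" "v \<noteq> prv (insert m C) m"
  proof -
    define i where "i = nx (insert m C) v"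
    have i: "i \<in> insert m C" "prv (insert m C) i = v" using nx[OF C', of v] v by (auto simp: i_def)
    then have "i \<in> C" "v \<noteq> m" using v m by auto
    then have "prv C i = v" using prv_insert[OF C C' m, of i] i by simp
    then show ?thesis using nx_prv[OF C \<open>i \<in> C\<close>] by (simp add: i_def)
  qed
  define i where "i = nx (insert m C) m"
  have i: "i \<in> insert m C" "prv (insert m C) i = m" using nx[OF C', of m] by (auto simp: i_def)
  then have "i \<in> C" using xne by auto
  then have "prv C i = prv (insert m C) m" using prv_insert[OF C C' m, of i] i by simp
  then show "nx C (prv (insert m C) m) = nx (insert m C) m" using nx_prv[OF C \<open>i \<in> C\<close>] by (simp add: i_def)
qed

lemma eta_edge_Dec:
  assumes "m \<in> C"
  shows "eta_edge (Dec C) m = (if isE (q m) then \<gamma> ` {cutL (q m)<..<cutR (q m)} else {\<gamma> (q m)})"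
  using assms cut_interval_image[OF qb] by (simp add: eta_edge_def)

text \<open>The coarser stretch is the concatenation of the stretch up to \<open>m\<close>, the cut
  \<open>m\<close> itself and the stretch after it. An open edge lacks its two boundary values, but
  these belong to the neighbouring pieces.\<close>

lemma piece_insert:
  assumes C: "goodC C" and C': "goodC (insert m C)" and m: "m \<notin> C"
  defines "x \<equiv> prv (insert m C) m"
  shows "piece C x = piece (insert m C) x \<union> eta_edge (Dec (insert m C)) m \<union> piece (insert m C) m"
proof -
  have m0: "m \<noteq> 0" using m goodD(2)[OF C] by metis
  have mC': "m \<in> insert m C" by simp
  have xC': "x \<in> insert m C" using prv(1)[OF C' mC'] by (simp add: x_def)
  have 1: "nx (insert m C) x = m" "nx C x = nx (insert m C) m"
    using nx_insert(2,3)[OF C C' m] by (simp_all add: x_def)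
  have l: "lam m = cutL (q m)" using m0 by (simp add: lam_def)
  define a where "a = cutR (q x)"
  define d where "d = lam (nx (insert m C) m)"
  have ord: "a \<le> cutL (q m)" "cutR (q m) \<le> d" "cutL (q m) \<le> cutR (q m)"
    using gap_nonempty(1)[OF C' xC'] gap_nonempty(1)[OF C' mC'] cb(2,3)[of m] 1 l by (auto simp: a_def d_def)
  have "eta_edge (Dec (insert m C)) m \<union> \<gamma> ` {cutL (q m), cutR (q m)} = \<gamma> ` {cutL (q m)..cutR (q m)}"
  proof (cases "isE (q m)")
    case True
    have "{cutL (q m)..cutR (q m)} = {cutL (q m)<..<cutR (q m)} \<union> {cutL (q m), cutR (q m)}" using ord(3) by auto
    then show ?thesis using eta_edge_Dec[OF mC'] True by (simp add: image_Un)
  next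
    case False
    then show ?thesis using eta_edge_Dec[OF mC'] by (simp add: cutL_def cutR_def)
  qed
  moreover have "\<gamma> (cutL (q m)) \<in> \<gamma> ` {a..cutL (q m)}" "\<gamma> (cutR (q m)) \<in> \<gamma> ` {cutR (q m)..d}" using ord by auto
  moreover have "A \<union> E \<union> D = A \<union> B \<union> D" if "E \<union> \<gamma> ` {u, w} = B" "\<gamma> u \<in> A" "\<gamma> w \<in> D" for A B D E u w
    using that by auto
  ultimately have "\<gamma> ` {a..cutL (q m)} \<union> eta_edge (Dec (insert m C)) m \<union> \<gamma> ` {cutR (q m)..d} =
      \<gamma> ` {a..cutL (q m)} \<union> \<gamma> ` {cutL (q m)..cutR (q m)} \<union> \<gamma> ` {cutR (q m)..d}" by metis
  also have "\<dots> = \<gamma> ` ({a..cutL (q m)} \<union> {cutL (q m)..cutR (q m)} \<union> {cutR (q m)..d})" by (simp only: image_Un)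
  also have "{a..cutL (q m)} \<union> {cutL (q m)..cutR (q m)} \<union> {cutR (q m)..d} = {a..d}" using ord by auto
  finally show ?thesis using 1 l by (simp add: piece_def a_def d_def)
qed

text \<open>Contracting the edge \<open>m\<close> undoes the insertion of the cut. Since
  \<open>contract\<close> keeps the label of the first end, which is \<open>m\<close> itself for a
  flipped edge, the renaming sends \<open>m\<close> back to \<open>x\<close>.\<close>

lemma Dec_insert_le:
  assumes C: "goodC C" and C': "goodC (insert m C)" and m: "m \<notin> C"
  shows "decomp_le (Dec C) (Dec (insert m C))"
proof -
  define x where "x = prv (insert m C) m"
  have mC': "m \<in> insert m C" by simp
  have m0: "m \<noteq> 0" using m goodD(2)[OF C] by metis
  have xm: "x \<noteq> m" using prv(2)[OF C' mC'] m0 by (auto simp: x_def lim_def)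
  then have xC: "x \<in> C" using prv(1)[OF C' mC'] by (auto simp: x_def)
  define K where "K = contract (Dec (insert m C)) m"
  define s where "s = (if flip m then m else x)"
  define t where "t = (if flip m then x else m)"
  define r where "r u = (if u = t then s else u)" for u
  define \<phi> where "\<phi> v = (if v = m then x else v)" for v
  have fs: "fst (dends (Dec (insert m C)) m) = s" "snd (dends (Dec (insert m C)) m) = t"
    by (simp_all add: s_def t_def x_def)
  have K: "dV K = (insert m C - {t}) \<union> {s}" "dE K = insert m C - {m}"
    "dF K = {i \<in> insert m C. isE (q i)} - {m}" "dends K = (\<lambda>z. map_prod r r (dends (Dec (insert m C)) z))"
    "dvert K = (piece (insert m C))(s := piece (insert m C) s \<union> eta_edge (Dec (insert m C)) m \<union> piece (insert m C) t)"
    "dfree K = dfree (Dec C)" "darc K = darc (Dec C)" "darc0 K = darc0 (Dec C)" "darc1 K = darc1 (Dec C)"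
    unfolding K_def contract_def Let_def fs by (simp_all add: r_def[abs_def])
  have EK: "dE K = C" using K(2) m by auto
  have st: "s = x \<and> t = m \<or> s = m \<and> t = x" by (auto simp: s_def t_def)
  have VK: "dV K = insert s (C - {x})" using K(1) st xC xm m by auto
  have \<phi>s: "\<phi> s = x" using st by (auto simp: \<phi>_def)
  have \<phi>r: "\<phi> (r u) = \<phi> u" for u using st by (auto simp: \<phi>_def r_def)
  have "decomp_iso K (Dec C)"
    unfolding decomp_iso_def
  proof (rule exI[of _ \<phi>], rule exI[of _ id], intro conjI ballI impI)
    show "bij_betw \<phi> (dV K) (dV (Dec C))"
      unfolding bij_betw_def
    proof
      have eq: "\<phi> v = v" if "v \<in> C" for v using that m by (auto simp: \<phi>_def)
      show "inj_on \<phi> (dV K)"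
        unfolding VK using eq \<phi>s by (auto simp: inj_on_def)
      have "\<phi> ` (C - {x}) = C - {x}" using eq by simp
      then show "\<phi> ` dV K = dV (Dec C)"
        unfolding VK Dec_simps(1) image_insert \<phi>s using xC by auto
    qed
    show "bij_betw id (dE K) (dE (Dec C))" using EK by simp
    fix v assume v: "v \<in> dV K"
    show "dvert (Dec C) (\<phi> v) = dvert K v"
    proof (cases "v = s")
      case True
      have "piece C x = piece (insert m C) s \<union> eta_edge (Dec (insert m C)) m \<union> piece (insert m C) t"
        using piece_insert[OF C C' m, folded x_def] st by auto
      then show ?thesis using True \<phi>s K(5) by simp
    next
      case False
      then have v': "v \<in> C" "v \<noteq> x" using v VK by auto
      then have "\<phi> v = v" using m by (auto simp: \<phi>_def)
      moreover have "piece C v = piece (insert m C) v"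
        unfolding piece_def using nx_insert(1)[OF C C' m v'(1)] v'(2) by (simp add: x_def)
      ultimately show ?thesis using False K(5) by simp
    qed
  next
    fix z assume "z \<in> dE K"
    then have z: "z \<in> C" using EK by simp
    then have zm: "z \<noteq> m" using m by auto
    show "z \<in> dF K \<longleftrightarrow> id z \<in> dF (Dec C)" using z zm K(3) by simp
    have "prv C z = \<phi> (prv (insert m C) z)" using prv_insert[OF C C' m z] by (simp add: \<phi>_def x_def)
    moreover have "z = \<phi> z" using zm by (simp add: \<phi>_def)
    ultimately show "dends (Dec C) (id z) = map_prod \<phi> \<phi> (dends K z)"
      unfolding K(4) Dec_simps(4) by (simp add: \<phi>r)
  qed (simp_all add: K)
  moreover have "contracts_to (Dec (insert m C)) K"
    unfolding K_def by (rule contracts_to.step[OF contracts_to.refl]) simp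
  ultimately show ?thesis unfolding decomp_le_def by blast
qed

text \<open>A time whose cut has occurred before is skipped, so each cut is represented by its first
  index; a stage may equal the one before.\<close>

definition stage :: "nat \<Rightarrow> nat set" where
  "stage n = {i. i \<le> n \<and> (\<forall>j<i. \<not> same (q j) (q i))}"

lemma good_stage: "goodC (stage n)"
  unfolding goodC_def
proof (intro conjI ballI impI)
  show "finite (stage n)" by (rule finite_subset[of _ "{..n}"]) (auto simp: stage_def)
  show "0 \<in> stage n" by (simp add: stage_def)
  fix i j assume ij: "i \<in> stage n" "j \<in> stage n" "i \<noteq> j"
  consider "i < j" | "j < i" using ij(3) by linarith
  then show "\<not> same (q i) (q j)"
  proof cases
    case 1
    then show ?thesis using ij(2) by (simp add: stage_def)
  next
    case 2
    then have "\<not> same (q j) (q i)" using ij(1) by (simp add: stage_def)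
    then show ?thesis using same_sym by blast
  qed
qed

lemma stage_Suc: "stage (Suc n) = stage n \<or> stage (Suc n) = insert (Suc n) (stage n) \<and> Suc n \<notin> stage n"
  by (auto simp: stage_def le_Suc_eq)

lemma Dec_stage_le: "decomp_le (Dec (stage n)) (Dec (stage (Suc n)))"
  using stage_Suc[of n]
proof (elim disjE conjE)
  assume "stage (Suc n) = stage n"
  then show ?thesis using contracts_to.refl decomp_iso_refl by (auto simp: decomp_le_def)
next
  assume A: "stage (Suc n) = insert (Suc n) (stage n)" "Suc n \<notin> stage n"
  then show ?thesis using Dec_insert_le[OF good_stage _ A(2)] good_stage[of "Suc n"] by simp
qed

text \<open>Every \<open>q j\<close> with \<open>j \<le> n\<close> lies in the closed time interval
  of a cut of the stage, represented by the first equivalent index, and this interval lies before or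
  after the open stretch.\<close>

lemma stage_gap_avoids:
  assumes v: "v \<in> stage n" and j: "j \<le> n"
  shows "\<not> (cutR (q v) < q j \<and> q j < lam (nx (stage n) v))"
proof -
  define k where "k = (LEAST k. same (q k) (q j))"
  have "same (q j) (q j)" by (simp add: same_def)
  then have k: "same (q k) (q j)" "k \<le> j" unfolding k_def by (rule LeastI, rule Least_le)
  have "\<not> same (q l) (q k)" if "l < k" for l
    using not_less_Least[of l "\<lambda>k. same (q k) (q j)"] that same_trans[of "q l" "q k" "q j"] k(1) by (auto simp: k_def)
  then have kS: "k \<in> stage n" using k(2) j by (auto simp: stage_def)
  note G = good_stage[of n]
  have cut: "cutL (q j) = cutL (q k)" "cutR (q j) = cutR (q k)" using same_cut[OF k(1)] by auto
  show ?thesis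
  proof (cases "q v < lim k")
    case True
    have "lam (nx (stage n) v) \<le> lam k" using gap_later(2)[OF G v kS True] .
    moreover have "lam k \<le> q j \<or> k = 0" using cb(2)[of j] cut by (simp add: lam_def)
    moreover have "q j \<le> cutR (q v)" if "k = 0"
    proof -
      have "q j = 0" using k(1) that q0 not_isE_01 by (auto simp: same_def)
      then show ?thesis using cb(3)[of v] qb(1)[of v] by simp
    qed
    ultimately show ?thesis by linarith
  next
    case False
    then have "k \<noteq> 0" using q01(2)[of v] by (cases "k = 0") (simp_all add: lim_def)
    then have "q k \<le> q v" using False by (simp add: lim_def)
    have "cutR (q k) \<le> cutR (q v)"
    proof (cases "k = v")
      case False
      then have "q k \<noteq> q v" using goodD(4)[OF G kS v] by blast
      then have "q k < q v" using \<open>q k \<le> q v\<close> by simp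
      then have "cutR (q k) \<le> cutL (q v)" using cut_order[OF qb(1) _ qb(2)] goodD(3)[OF G kS v False] by blast
      then show ?thesis using cb(2,3)[of v] by linarith
    qed simp
    then show ?thesis using cb(3)[of j] cut by simp
  qed
qed

text \<open>Stretches of a late stage are short because they avoid all the first times, and uniform
  continuity turns short stretches into small pieces.\<close>

lemma width_Dec_stage:
  assumes dense: "\<And>a b. 0 \<le> a \<Longrightarrow> a < b \<Longrightarrow> b \<le> 1 \<Longrightarrow> \<exists>i. a < q i \<and> q i < b"
  shows "(\<lambda>n. width (Dec (stage n))) \<longlonglongrightarrow> 0"
proof (rule LIMSEQ_I)
  fix \<epsilon> :: real assume \<epsilon>: "\<epsilon> > 0"
  obtain \<delta> where \<delta>: "\<delta> > 0" "\<And>s t. s \<in> {0..1} \<Longrightarrow> t \<in> {0..1} \<Longrightarrow> \<bar>s - t\<bar> < \<delta> \<Longrightarrow> dist (\<gamma> s) (\<gamma> t) < \<epsilon>/2"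
    using uniform_modulus[OF cont, of "\<epsilon>/2"] \<epsilon> by auto
  \<comment> \<open>With mesh below \<open>\<delta> / 2\<close>, any interval of length
    \<open>\<delta>\<close> contains a whole grid cell and hence one of the finitely many chosen
    times.\<close>
  obtain M :: nat where M: "M > 0" "1 / real M < \<delta> / 2"
    using real_arch_inverse[of "\<delta>/2"] \<delta>(1) by (auto simp: inverse_eq_divide)
  have "\<exists>i. real k / real M < q i \<and> q i < real (Suc k) / real M" if "k < M" for k
    using dense[of "real k / real M" "real (Suc k) / real M"] that M(1) by (simp add: divide_strict_right_mono)
  then obtain i where i: "\<And>k. k < M \<Longrightarrow> real k / real M < q (i k) \<and> q (i k) < real (Suc k) / real M" by metis
  define n0 where "n0 = Max (i ` {..<M})"
  have hit: "\<exists>j\<le>n0. a < q j \<and> q j < b" if ab: "0 \<le> a" "b \<le> 1" "\<delta> \<le> b - a" for a b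
  proof -
    define k where "k = nat \<lceil>a * real M\<rceil>"
    have k: "a * real M \<le> real k" "real k < a * real M + 1"
    proof -
      have "0 \<le> a * real M" using ab(1) by simp
      then have "0 \<le> \<lceil>a * real M\<rceil>" by linarith
      then have "real k = of_int \<lceil>a * real M\<rceil>" by (simp add: k_def)
      then show "a * real M \<le> real k" "real k < a * real M + 1"
        using ceiling_correct[of "a * real M"] by linarith+
    qed
    have "2 < \<delta> * real M" using M by (simp add: field_simps)
    also have "\<dots> \<le> (b - a) * real M" using ab(3) by (intro mult_right_mono) auto
    finally have 1: "real k + 1 < b * real M" using k by (simp add: algebra_simps)
    also have "\<dots> \<le> 1 * real M" using ab(2) by (intro mult_right_mono) auto
    finally have "k < M" by simp
    have "a \<le> real k / real M" "real (Suc k) / real M \<le> b"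
      using k 1 M(1) by (simp_all add: field_simps)
    moreover have "i k \<le> n0" using \<open>k < M\<close> unfolding n0_def by (intro Max_ge) auto
    ultimately show ?thesis using i[OF \<open>k < M\<close>] by (intro exI[of _ "i k"]) auto
  qed
  have "norm (width (Dec (stage n)) - 0) < \<epsilon>" if n: "n \<ge> n0" for n
  proof -
    note G = good_stage[of n]
    have dia: "0 \<le> diameter (piece (stage n) v) \<and> diameter (piece (stage n) v) \<le> \<epsilon>/2" if v: "v \<in> stage n" for v
    proof
      define a where "a = cutR (q v)"
      define b where "b = lam (nx (stage n) v)"
      have ab: "0 \<le> a" "a \<le> b" "b \<le> 1"
        using cb(3)[of v] qb(1)[of v] gap_nonempty(1)[OF G v] lam_bounds(2) by (auto simp: a_def b_def)
      have len: "b - a < \<delta>"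
      proof (rule ccontr)
        assume "\<not> ?thesis"
        then obtain j where "j \<le> n0" "a < q j" "q j < b" using hit[of a b] ab by auto
        then show False using stage_gap_avoids[OF v, of j] n by (auto simp: a_def b_def)
      qed
      have pc: "piece (stage n) v = \<gamma> ` {a..b}" by (simp add: piece_def a_def b_def)
      have "dist x y \<le> \<epsilon>/2" if xy: "x \<in> piece (stage n) v" "y \<in> piece (stage n) v" for x y
      proof -
        from xy obtain s t where st: "s \<in> {a..b}" "t \<in> {a..b}" "x = \<gamma> s" "y = \<gamma> t" unfolding pc by blast
        then have "\<bar>s - t\<bar> < \<delta>" using len by auto
        then show ?thesis using \<delta>(2)[of s t] st ab by auto
      qed
      then have "(SUP (x, y)\<in>piece (stage n) v \<times> piece (stage n) v. dist x y) \<le> \<epsilon>/2"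
        using ab(2) unfolding pc by (intro cSUP_least) auto
      then show "diameter (piece (stage n) v) \<le> \<epsilon>/2" using \<epsilon> by (simp add: diameter_def)
      show "0 \<le> diameter (piece (stage n) v)"
      proof (rule diameter_ge_0)
        have "compact (piece (stage n) v)" unfolding pc
          using ab by (intro compact_continuous_image continuous_on_subset[OF cont]) auto
        then show "bounded (piece (stage n) v)" by (rule compact_imp_bounded)
      qed
    qed
    have fin: "finite ((\<lambda>v. diameter (piece (stage n) v)) ` stage n)" "(\<lambda>v. diameter (piece (stage n) v)) ` stage n \<noteq> {}"
      using goodD(1,2)[OF G] by auto
    have "width (Dec (stage n)) \<in> (\<lambda>v. diameter (piece (stage n) v)) ` stage n"
      unfolding width_def Dec_simps using Max_in[OF fin] .
    then show ?thesis using dia \<epsilon> by force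
  qed
  then show "\<exists>no. \<forall>n\<ge>no. norm (width (Dec (stage n)) - 0) < \<epsilon>" by blast
qed

end

lemma simple_loop_imp_approximating_sequence:
  assumes "simple_loop X p \<gamma>"
  shows "\<exists>D. approximating_sequence X p D"
proof -
  define Q where "Q = \<rat> \<inter> {0<..<1::real}"
  have Qne: "Q \<noteq> {}" using Rats_dense_in_real[of 0 1] by (auto simp: Q_def)
  have cQ: "countable Q" unfolding Q_def using countable_rat by (rule countable_Int1)
  \<comment> \<open>The time 0 comes first, as the base cut; the rationals of the open interval
    follow.\<close>
  define q where "q n = (case n of 0 \<Rightarrow> 0 | Suc k \<Rightarrow> from_nat_into Q k)" for n
  have qQ: "q (Suc k) \<in> Q" for k using from_nat_into[OF Qne] by (simp add: q_def)
  have qsurj: "\<exists>i. q i = x" if "x \<in> Q" for x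
    using from_nat_into_surj[OF cQ that] by (metis q_def nat.case(2))
  interpret simple_loop X p \<gamma> by (rule assms)
  interpret cut_loop X p \<gamma> q
  proof
    show "q 0 = 0" by (simp add: q_def)
    show "0 \<le> q i" "q i < 1" for i
      using qQ by (cases i; auto simp: q_def Q_def less_imp_le)+
  qed
  have "\<exists>i. a < q i \<and> q i < b" if "0 \<le> a" "a < b" "b \<le> 1" for a b
  proof -
    from Rats_dense_in_real[OF that(2)] obtain x where x: "x \<in> \<rat>" "a < x" "x < b" by blast
    then have "x \<in> Q" using that by (simp add: Q_def)
    then show ?thesis using qsurj x by metis
  qed
  then have "approximating_sequence X p (\<lambda>n. Dec (stage n))"
    unfolding approximating_sequence_def
    using Dec_eulerian[OF good_stage] Dec_stage_le width_Dec_stage by blast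
  then show ?thesis by blast
qed

section \<open>The equivalence\<close>

theorem theorem1p1:
  fixes X :: "'a::metric_space set" and p :: "'a set \<Rightarrow> real \<Rightarrow> 'a"
  assumes "peano_continuum X"
    and "\<exists>x\<in>X. \<exists>y\<in>X. x \<noteq> y"
    and "\<not> X homeomorphic (sphere (0::complex) 1)"
    and "edge_param X p"
  shows "(eulerian X \<longleftrightarrow> edgewise_eulerian X) \<and>
         (edgewise_eulerian X \<longleftrightarrow> (\<exists>Ds. approximating_sequence X p Ds))"
proof -
  have "edgewise_eulerian X" if "eulerian X"
    using that eulerian_map_imp_edgewise unfolding eulerian_def edgewise_eulerian_def by blast
  moreover have "\<exists>Ds. approximating_sequence X p Ds" if "edgewise_eulerian X"
    using edgewise_eulerian_imp_simple_loop[OF assms(4) that assms(3)]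
      simple_loop_imp_approximating_sequence by blast
  moreover have "eulerian X" if seq: "approximating_sequence X p Ds" for Ds
  proof -
    have "compact X" using assms(1) by (simp add: peano_continuum_def)
    then obtain b \<gamma> where "mono_loop X b \<gamma>"
      using approximating_sequence_imp_mono_loop[OF _ assms(4) seq] by blast
    then show ?thesis using mono_loop_imp_eulerian assms(2) by blast
  qed
  ultimately show ?thesis by blast
qed

end
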